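(* Any complete $+$isotropic surface in the pseudosphere $\mathbf{S}^4_1$ is isometric to the unit sphere $\mathbf{S}^2$, and, up to an isometry of $\mathbf{S}^4_1$, a $+$isotropic surface in $\mathbf{S}^4_1$ has (locally) the form $$i_\lambda:\mathbf{S}^2\hookrightarrow\mathbf{S}^4_1\subset\mathbb{R}^5_1,\qquad y\mapsto(\lambda(y),\lambda(y),y),\quad \|y\|=1,\ y\in\mathbb{R}^3,$$ where $\lambda$ is a smooth function on $\mathbf{S}^2$.
   Context: $\mathbb{R}^5_1$ is $\mathbb{R}^5$ with metric $\langle x,x\rangle^5_1=-x_1^2+x_2^2+x_3^2+x_4^2+x_5^2$, and $\mathbf{S}^4_1=\{x\in\mathbb{R}^5_1:\langle x,x\rangle^5_1=1\}$ with the induced Lorentzian metric (constant sectional curvature $1$), oriented. Surfaces are oriented, immersed and spacelike (the induced metric is positive definite); completeness refers to the induced Riemannian metric. For an oriented spacelike immersed surface $N^2$ in an oriented Lorentzian 4-manifold $(M,g)$, take a local Darboux frame $e=(e_1,\dots,e_4)$: positively oriented in $M$, pseudo-orthonormal with $g(e_1,e_1)=-1$, and $(e_3,e_4)$ a positively oriented orthonormal frame of $TN$. The normal bundle splits into null line bundles $TN^\perp=TN_+^\perp\oplus TN_-^\perp$, $TN^\perp_\pm=\mathbb{R}(e_1\pm e_2)$. The surface is $+$isotropic if its second fundamental form takes values in $TN_+^\perp$, i.e. $II(V,W)\in TN^\perp_+$ for all tangent $V,W$. *)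

theory Defs
  imports "HOL-Analysis.Analysis"
begin

section \<open>Smooth maps\<close>

primrec C_k :: "nat \<Rightarrow> ('a::real_normed_vector \<Rightarrow> 'b::real_normed_vector) \<Rightarrow> 'a set \<Rightarrow> bool" where
  "C_k 0 g W \<longleftrightarrow> continuous_on W g"
| "C_k (Suc k) g W \<longleftrightarrow> (\<forall>x\<in>W. g differentiable (at x)) \<and>
     (\<forall>v. C_k k (\<lambda>x. frechet_derivative g (at x) v) W)"

text \<open>The set \<open>S\<close> need not be open: a map is smooth on \<open>S\<close> if it is locally the restriction of
  a \<open>C\<^sup>\<infinity>\<close> map on an open set.  For open \<open>S\<close> this is the usual notion, and for embedded submanifolds
  (\<open>S\<close> the unit sphere, or the pseudosphere) it is the manifold notion.\<close>

definition smooth_on :: "'a::real_normed_vector set \<Rightarrow> ('a \<Rightarrow> 'b::real_normed_vector) \<Rightarrow> bool" where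
  "smooth_on S g \<longleftrightarrow>
     (\<forall>x\<in>S. \<exists>W h. open W \<and> x \<in> W \<and> (\<forall>k. C_k k h W) \<and> (\<forall>z\<in>S \<inter> W. h z = g z))"


section \<open>The pseudosphere and its isometries\<close>

definition lor :: "real^5 \<Rightarrow> real^5 \<Rightarrow> real" where
  "lor x y = - (x$1 * y$1) + x$2 * y$2 + x$3 * y$3 + x$4 * y$4 + x$5 * y$5"

definition S41 :: "(real^5) set" where
  "S41 = {x. lor x x = 1}"

definition tangent_S41 :: "real^5 \<Rightarrow> (real^5) set" where
  "tangent_S41 x = {v. lor x v = 0}"

text \<open>The derivative within \<open>S41\<close> is determined on the tangent space only, and only that
  restriction is used.\<close>

definition isometry_S41 :: "(real^5 \<Rightarrow> real^5) \<Rightarrow> bool" where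
  "isometry_S41 \<Phi> \<longleftrightarrow>
     bij_betw \<Phi> S41 S41 \<and> smooth_on S41 \<Phi> \<and> smooth_on S41 (inv_into S41 \<Phi>) \<and>
     (\<forall>x\<in>S41. \<exists>D. (\<Phi> has_derivative D) (at x within S41) \<and>
        (\<forall>v\<in>tangent_S41 x. \<forall>w\<in>tangent_S41 x. lor (D v) (D w) = lor v w))"

text \<open>\<open>S41\<close> is connected and so has exactly two orientations, selected by \<open>\<epsilon> = 1\<close> and
  \<open>\<epsilon> = -1\<close>: a frame of the tangent space at \<open>x\<close>, completed by the normal \<open>x\<close> in first place, is
  compared with the standard orientation of \<open>\<real>\<^sup>5\<close>.\<close>

definition positive_frame_S41 :: "real \<Rightarrow> real^5 \<Rightarrow> (nat \<Rightarrow> real^5) \<Rightarrow> bool" where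
  "positive_frame_S41 \<epsilon> x e \<longleftrightarrow>
     (\<forall>i\<in>{1..4}. e i \<in> tangent_S41 x) \<and>
     \<epsilon> * det (vector [x, e 1, e 2, e 3, e 4] :: real^5^5) > 0"


section \<open>Oriented surfaces\<close>

type_synonym 'a chart = "'a set \<times> ('a \<Rightarrow> real^2)"

definition carrier_of :: "'a chart set \<Rightarrow> 'a set" where
  "carrier_of \<A> = (\<Union>(U, \<phi>)\<in>\<A>. U)"

text \<open>An oriented smooth surface is given by an oriented atlas (transition maps are smooth with
  positive Jacobian); as usual, it is nonempty, connected, Hausdorff and second countable.\<close>

definition oriented_surface :: "'a::{t2_space, second_countable_topology} chart set \<Rightarrow> bool" where
  "oriented_surface \<A> \<longleftrightarrow>
     carrier_of \<A> \<noteq> {} \<and> connected (carrier_of \<A>) \<and>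
     (\<forall>(U, \<phi>)\<in>\<A>. open U \<and> open (\<phi> ` U) \<and> homeomorphism U (\<phi> ` U) \<phi> (inv_into U \<phi>)) \<and>
     (\<forall>(U, \<phi>)\<in>\<A>. \<forall>(V, \<psi>)\<in>\<A>.
        smooth_on (\<phi> ` (U \<inter> V)) (\<psi> \<circ> inv_into U \<phi>) \<and>
        (\<forall>z\<in>\<phi> ` (U \<inter> V).
           det (matrix (frechet_derivative (\<psi> \<circ> inv_into U \<phi>) (at z))) > 0))"

text \<open>Differential at \<open>p\<close> of a map \<open>f\<close> into a vector space; tangent vectors of the surface are
  written in the coordinates of the chart \<open>(U, \<phi>)\<close>.\<close>

definition differential ::
  "'a chart \<Rightarrow> ('a \<Rightarrow> 'b::real_normed_vector) \<Rightarrow> 'a \<Rightarrow> real^2 \<Rightarrow> 'b" where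
  "differential c f p v =
     (case c of (U, \<phi>) \<Rightarrow> frechet_derivative (f \<circ> inv_into U \<phi>) (at (\<phi> p)) v)"

definition spacelike_immersion :: "'a chart set \<Rightarrow> ('a \<Rightarrow> real^5) \<Rightarrow> bool" where
  "spacelike_immersion \<A> f \<longleftrightarrow>
     f ` carrier_of \<A> \<subseteq> S41 \<and>
     (\<forall>(U, \<phi>)\<in>\<A>. smooth_on (\<phi> ` U) (f \<circ> inv_into U \<phi>) \<and>
        (\<forall>p\<in>U. inj (differential (U, \<phi>) f p) \<and>
           (\<forall>v. v \<noteq> 0 \<longrightarrow>
              lor (differential (U, \<phi>) f p v) (differential (U, \<phi>) f p v) > 0)))"


section \<open>Completeness of the induced metric\<close>

definition C1_on_interval :: "(real \<Rightarrow> real^2) \<Rightarrow> real \<Rightarrow> real \<Rightarrow> bool" where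
  "C1_on_interval g a b \<longleftrightarrow>
     (\<exists>D. continuous_on {a..b} D \<and>
        (\<forall>t\<in>{a..b}. (g has_vector_derivative D t) (at t within {a..b})))"

text \<open>The library predicate \<^const>\<open>piecewise_C1_differentiable_on\<close> is not used here: it allows the
  derivative to be unbounded near the break points, so that the length integral may diverge
  (and then evaluate to \<open>0\<close>).\<close>

definition piecewise_C1_curve ::
  "'a::topological_space chart set \<Rightarrow> (real \<Rightarrow> 'a) \<Rightarrow> bool" where
  "piecewise_C1_curve \<A> \<gamma> \<longleftrightarrow>
     path \<gamma> \<and> path_image \<gamma> \<subseteq> carrier_of \<A> \<and>
     (\<exists>T. finite T \<and>
        (\<forall>(U, \<phi>)\<in>\<A>. \<forall>a b. 0 \<le> a \<and> a < b \<and> b \<le> 1 \<and> {a<..<b} \<inter> T = {} \<and> \<gamma> ` {a..b} \<subseteq> U \<longrightarrow>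
           C1_on_interval (\<phi> \<circ> \<gamma>) a b))"

definition curve_length :: "('a \<Rightarrow> real^5) \<Rightarrow> (real \<Rightarrow> 'a) \<Rightarrow> real" where
  "curve_length f \<gamma> =
     integral {0..1} (\<lambda>t. sqrt (lor (vector_derivative (f \<circ> \<gamma>) (at t))
                                    (vector_derivative (f \<circ> \<gamma>) (at t))))"

text \<open>The value \<open>0\<close> outside the carrier is needed only because \<^locale>\<open>Metric_space\<close> asks for a
  nonnegative function on the whole type.\<close>

definition riem_dist ::
  "'a::topological_space chart set \<Rightarrow> ('a \<Rightarrow> real^5) \<Rightarrow> 'a \<Rightarrow> 'a \<Rightarrow> real" where
  "riem_dist \<A> f p q =
     (if p \<in> carrier_of \<A> \<and> q \<in> carrier_of \<A>
      then Inf (curve_length f `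
             {\<gamma>. piecewise_C1_curve \<A> \<gamma> \<and> pathstart \<gamma> = p \<and> pathfinish \<gamma> = q})
      else 0)"

definition complete_surface :: "'a::topological_space chart set \<Rightarrow> ('a \<Rightarrow> real^5) \<Rightarrow> bool" where
  "complete_surface \<A> f \<longleftrightarrow> Metric_space.mcomplete (carrier_of \<A>) (riem_dist \<A> f)"


section \<open>Second fundamental form and isotropy\<close>

definition normal_space :: "'a chart \<Rightarrow> ('a \<Rightarrow> real^5) \<Rightarrow> 'a \<Rightarrow> (real^5) set" where
  "normal_space c f p =
     {\<xi> \<in> tangent_S41 (f p). \<forall>v. lor (differential c f p v) \<xi> = 0}"

text \<open>For the coordinate (constant coefficient) fields \<open>v\<close>, \<open>w\<close>, the flat derivative of
  \<open>df(w)\<close> in direction \<open>v\<close> is the second derivative of \<open>f \<circ> \<phi>\<^sup>-\<^sup>1\<close>.  The Levi-Civita derivative of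
  \<open>S41\<close> differs from it by a multiple of the position vector \<open>f p\<close>, and \<open>II\<close> is the component of the
  latter in the normal space of the surface in \<open>S41\<close>, so that the remaining part lies in the span
  of \<open>f p\<close> and the tangent plane of the surface.\<close>

definition second_fundamental_form ::
  "'a chart \<Rightarrow> ('a \<Rightarrow> real^5) \<Rightarrow> 'a \<Rightarrow> real^2 \<Rightarrow> real^2 \<Rightarrow> real^5" where
  "second_fundamental_form c f p v w =
     (case c of (U, \<phi>) \<Rightarrow>
        (let X = f \<circ> inv_into U \<phi>;
             H = frechet_derivative (\<lambda>z. frechet_derivative X (at z) w) (at (\<phi> p)) v
         in THE \<xi>. \<xi> \<in> normal_space c f p \<and>
                   H - \<xi> \<in> span (insert (f p) (range (differential c f p)))))"

definition darboux_frame ::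
  "real \<Rightarrow> 'a chart \<Rightarrow> ('a \<Rightarrow> real^5) \<Rightarrow> 'a \<Rightarrow> (nat \<Rightarrow> real^5) \<Rightarrow> bool" where
  "darboux_frame \<epsilon> c f p e \<longleftrightarrow>
     positive_frame_S41 \<epsilon> (f p) e \<and>
     (\<forall>i\<in>{1..4}. \<forall>j\<in>{1..4}. lor (e i) (e j) = (if i \<noteq> j then 0 else if i = 1 then -1 else 1)) \<and>
     (\<exists>a b. e 3 = differential c f p a \<and> e 4 = differential c f p b \<and>
        det (vector [a, b] :: real^2^2) > 0)"

text \<open>All Darboux frames at \<open>p\<close> give the same line.\<close>

definition normal_plus :: "real \<Rightarrow> 'a chart \<Rightarrow> ('a \<Rightarrow> real^5) \<Rightarrow> 'a \<Rightarrow> (real^5) set" where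
  "normal_plus \<epsilon> c f p = {s *\<^sub>R (e 1 + e 2) | s e. darboux_frame \<epsilon> c f p e}"

definition plus_isotropic :: "real \<Rightarrow> 'a chart set \<Rightarrow> ('a \<Rightarrow> real^5) \<Rightarrow> bool" where
  "plus_isotropic \<epsilon> \<A> f \<longleftrightarrow>
     (\<forall>c\<in>\<A>. \<forall>p\<in>fst c. \<forall>v w. second_fundamental_form c f p v w \<in> normal_plus \<epsilon> c f p)"


section \<open>Comparison with the unit sphere\<close>

definition diffeo_into_S2 ::
  "'a::topological_space chart set \<Rightarrow> 'a set \<Rightarrow> (real^3) set \<Rightarrow> ('a \<Rightarrow> real^3) \<Rightarrow> bool" where
  "diffeo_into_S2 \<A> U V y \<longleftrightarrow>
     open U \<and> U \<subseteq> carrier_of \<A> \<and> openin (top_of_set (sphere 0 1)) V \<and>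
     (\<exists>x. homeomorphism U V y x \<and>
        (\<forall>(W, \<phi>)\<in>\<A>. smooth_on (\<phi> ` (U \<inter> W)) (y \<circ> inv_into W \<phi>) \<and>
                     smooth_on (y ` (U \<inter> W)) (\<phi> \<circ> x)))"

definition isometric_to_S2 :: "'a::topological_space chart set \<Rightarrow> ('a \<Rightarrow> real^5) \<Rightarrow> bool" where
  "isometric_to_S2 \<A> f \<longleftrightarrow>
     (\<exists>F. diffeo_into_S2 \<A> (carrier_of \<A>) (sphere 0 1) F \<and>
        (\<forall>c\<in>\<A>. \<forall>p\<in>fst c. \<forall>v w.
           differential c F p v \<bullet> differential c F p w
             = lor (differential c f p v) (differential c f p w)))"

definition i_map :: "(real^3 \<Rightarrow> real) \<Rightarrow> real^3 \<Rightarrow> real^5" where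
  "i_map l y = vector [l y, l y, y$1, y$2, y$3]"

end

theory Submission
  imports Defs "HOL-Computational_Algebra.Polynomial"
begin

text \<open>In the normal plane of the surface let \<open>n\<close> span the distinguished null line, so that the second
  fundamental form is a multiple of \<open>n\<close>.  Differentiating \<open>\<langle>n,n\<rangle> = \<langle>n,f\<rangle> = \<langle>n,df\<rangle> = 0\<close> shows that every
  derivative of \<open>n\<close> is orthogonal to \<open>f\<close>, to the tangent plane and to \<open>n\<close>; for the tangent plane this
  uses \<open>\<langle>n,II\<rangle> = 0\<close>.  In the normal plane, which is Lorentzian, the orthogonal complement of a null line is the
  line itself, so \<open>n\<close> moves only along itself and its direction is the same on the whole connected
  surface (\<open>constant_null_normal\<close>).  Thus \<open>f\<close> lies in the degenerate hyperplane \<open>n\<^sup>\<bottom>\<close>.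

  A Lorentz reflection \<open>\<Phi>\<close> carries \<open>n\<close> to \<open>(1,1,0,0,0)\<close> (\<open>lorentz_reflection\<close>).  Then
  \<open>\<Phi> \<circ> f = (\<lambda>,\<lambda>,y)\<close>; the first two coordinates cancel in the Lorentz product, so \<open>|y| = 1\<close> and \<open>y\<close> is a local isometry
  into the unit sphere (\<open>development\<close>).  By the inverse function theorem \<open>y\<close> has smooth local inverses
  (\<open>local_section\<close>), through which \<open>\<lambda>\<close> becomes a smooth function near a point of the sphere; cutting
  it off by a bump function makes it smooth on the whole sphere (\<open>local_graph\<close>).

  For a complete surface it remains to see that the local isometry \<open>y\<close> is bijective.  Curves are as
  long as their images under \<open>y\<close>, so a short curve starting at \<open>q\<close> stays in the image of a local
  section of \<open>y\<close> around \<open>q\<close> (\<open>small_ball\<close>).  Call \<open>p\<close> obstructed at radius \<open>r\<close> if no section of \<open>y\<close> through \<open>p\<close> exists over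
  the spherical cap of angular radius \<open>r\<close> around \<open>y p\<close>.  Sections over caps of half the radius glue,
  because all the caps concerned contain \<open>y p\<close> and intersect in connected sets; hence an obstruction at \<open>p\<close> of radius
  \<open>r\<close> forces one of radius \<open>r/2\<close> at distance \<open>O(r)\<close> from \<open>p\<close> (\<open>obstruction_nearby\<close>).  Iteration yields
  a Cauchy sequence, and at its limit the existence of a local section is contradicted.  Already \<open>r = \<pi>\<close> is
  unobstructed, so that there are sections over the sphere without a point (\<open>section_off_antipode\<close>), and one
  further section over a hemisphere fills the gap (\<open>global_section\<close>).  The section \<open>s\<close> so obtained
  inverts \<open>y\<close>: both \<open>s \<circ> y\<close> and the identity lift \<open>y\<close>, and they agree at one point.\<close>

section \<open>Calculus of finitely differentiable maps\<close>

lemma C_k_subset: "C_k k g W \<Longrightarrow> V \<subseteq> W \<Longrightarrow> C_k k g V"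
  by (induction k arbitrary: g) (auto intro: continuous_on_subset)

lemma C_k_continuous:
  assumes "C_k k g W" shows "continuous_on W g"
proof (cases k)
  case (Suc j)
  then have "\<forall>x\<in>W. g differentiable (at x)" using assms by simp
  then show ?thesis
    by (simp add: continuous_at_imp_continuous_on differentiable_imp_continuous_within)
qed (use assms in simp)

lemma C_k_SucD: "C_k (Suc k) g W \<Longrightarrow> C_k k g W"
proof (induction k arbitrary: g)
  case 0
  show ?case using C_k_continuous[OF 0] by simp
next
  case (Suc k)
  then show ?case by (metis C_k.simps(2))
qed

lemma C_k_local:
  assumes "\<And>x. x \<in> W \<Longrightarrow> \<exists>V. open V \<and> x \<in> V \<and> C_k k g V"
  shows "C_k k g W"
  using assms
proof (induction k arbitrary: g)
  case 0
  have "isCont g x" if "x \<in> W" for x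
  proof -
    obtain V where "open V" "x \<in> V" "continuous_on V g" using 0[OF \<open>x \<in> W\<close>] by auto
    then show ?thesis by (simp add: continuous_on_eq_continuous_at)
  qed
  then show ?case by (simp add: continuous_at_imp_continuous_on)
next
  case (Suc k)
  have "C_k k (\<lambda>x. frechet_derivative g (at x) v) W" for v
  proof (rule Suc.IH)
    fix x assume "x \<in> W"
    then obtain V where "open V" "x \<in> V" "C_k (Suc k) g V" using Suc.prems by meson
    then show "\<exists>V. open V \<and> x \<in> V \<and> C_k k (\<lambda>x. frechet_derivative g (at x) v) V"
      by (intro exI[of _ V]) simp
  qed
  moreover have "g differentiable (at x)" if "x \<in> W" for x
  proof -
    obtain V where "x \<in> V" "C_k (Suc k) g V" using Suc.prems \<open>x \<in> W\<close> by meson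
    then show ?thesis by simp
  qed
  ultimately show ?case by simp
qed

lemma C_k_cong:
  assumes "open W" "C_k k g W" "\<And>x. x \<in> W \<Longrightarrow> g x = h x"
  shows "C_k k h W"
  using assms(2,3)
proof (induction k arbitrary: g h)
  case 0
  then show ?case by (metis C_k.simps(1) continuous_on_cong)
next
  case (Suc k)
  have d: "(h has_derivative frechet_derivative g (at x)) (at x)" if "x \<in> W" for x
    using Suc.prems that frechet_derivative_works[of g "at x"]
    by (auto intro: has_derivative_transform_within_open[OF _ assms(1)])
  then have "frechet_derivative h (at x) = frechet_derivative g (at x)" if "x \<in> W" for x
    using that frechet_derivative_at by metis
  with Suc.IH[of "\<lambda>x. frechet_derivative g (at x) v" "\<lambda>x. frechet_derivative h (at x) v" for v]
  have "C_k k (\<lambda>x. frechet_derivative h (at x) v) W" for v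
    using Suc.prems by auto
  then show ?case using d by (auto simp: differentiable_def)
qed

text \<open>The recursive clause for \<open>C_k\<close> speaks of \<open>frechet_derivative\<close>; this rule and the next one translate
  between it and \<open>has_derivative\<close>, for which derivatives can be computed by rules.\<close>

lemma C_k_SucI:
  assumes "open W" and d: "\<And>x. x \<in> W \<Longrightarrow> (g has_derivative D x) (at x)"
    and "\<And>v. C_k k (\<lambda>x. D x v) W"
  shows "C_k (Suc k) g W"
proof -
  have "D x = frechet_derivative g (at x)" if "x \<in> W" for x
    using d[OF that] by (rule frechet_derivative_at)
  then have "C_k k (\<lambda>x. frechet_derivative g (at x) v) W" for v
    using C_k_cong[OF assms(1,3), of v] by simp
  with d show ?thesis by (auto simp: differentiable_def)
qed

lemma C_k_SucE:
  assumes "C_k (Suc k) g W" "x \<in> W"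
  shows "(g has_derivative frechet_derivative g (at x)) (at x)"
  using assms frechet_derivative_works by auto

lemma C_k_const: "C_k k (\<lambda>x. c) W"
  by (induction k arbitrary: c) auto

lemma C_k_bounded_linear:
  assumes "bounded_linear L" shows "C_k k L W"
proof (cases k)
  case (Suc j)
  have "frechet_derivative L (at x) = L" for x
    using frechet_derivative_at[OF bounded_linear_imp_has_derivative[OF assms]] by metis
  then show ?thesis
    using Suc assms by (simp add: C_k_const bounded_linear_imp_differentiable)
qed (use assms in \<open>simp add: linear_continuous_on\<close>)

lemma C_k_linear_comp:
  assumes "open W" "bounded_linear L" "C_k k g W"
  shows "C_k k (\<lambda>x. L (g x)) W"
  using assms(3)
proof (induction k arbitrary: g)
  case 0
  then show ?case using assms(2) by (simp add: bounded_linear.continuous_on)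
next
  case (Suc k)
  show ?case
  proof (rule C_k_SucI[OF assms(1)])
    show "((\<lambda>x. L (g x)) has_derivative (\<lambda>v. L (frechet_derivative g (at x) v))) (at x)"
      if "x \<in> W" for x
      using bounded_linear.has_derivative[OF assms(2) C_k_SucE[OF Suc.prems that]] .
    show "C_k k (\<lambda>x. L (frechet_derivative g (at x) v)) W" for v
      using Suc by auto
  qed
qed

lemma C_k_add:
  assumes "open W" "C_k k f W" "C_k k g W"
  shows "C_k k (\<lambda>x. f x + g x) W"
  using assms(2,3)
proof (induction k arbitrary: f g)
  case 0
  then show ?case by (simp add: continuous_on_add)
next
  case (Suc k)
  show ?case
    by (rule C_k_SucI[OF assms(1) has_derivative_add[OF C_k_SucE[OF Suc.prems(1)] C_k_SucE[OF Suc.prems(2)]]])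
      (use Suc in auto)
qed

lemma C_k_sum:
  assumes "open W" "finite I" "\<And>i. i \<in> I \<Longrightarrow> C_k k (f i) W"
  shows "C_k k (\<lambda>x. \<Sum>i\<in>I. f i x) W"
  using assms(2,3)
  by (induction I rule: finite_induct) (auto simp: C_k_const intro: C_k_add[OF assms(1)])

text \<open>One product rule serves the scalar, the inner and the Lorentz product.\<close>

lemma (in bounded_bilinear) C_k_prod:
  assumes "open W" "C_k k f W" "C_k k g W"
  shows "C_k k (\<lambda>x. prod (f x) (g x)) W"
  using assms(2,3)
proof (induction k arbitrary: f g)
  case 0
  then show ?case by (simp add: continuous_on)
next
  case (Suc k)
  show ?case
  proof (rule C_k_SucI[OF assms(1) FDERIV[OF C_k_SucE[OF Suc.prems(1)] C_k_SucE[OF Suc.prems(2)]]])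
    fix v
    show "C_k k (\<lambda>x. prod (f x) (frechet_derivative g (at x) v) +
               prod (frechet_derivative f (at x) v) (g x)) W"
      using C_k_SucD[OF Suc.prems(1)] C_k_SucD[OF Suc.prems(2)] Suc.prems
      by (intro C_k_add[OF assms(1)] Suc.IH) auto
  qed
qed

lemmas C_k_scaleR = bounded_bilinear.C_k_prod[OF bounded_bilinear_scaleR]
lemmas C_k_mult = bounded_bilinear.C_k_prod[OF bounded_bilinear_mult]

text \<open>The derivative of the composition at \<open>x\<close> in direction \<open>v\<close> is a sum of products of coordinates of
  the inner derivative with directional derivatives of the outer map along basis vectors.  All of these have
  one order of differentiability less, and the finite basis is where the Euclidean domain enters.\<close>

lemma C_k_compose:
  fixes f :: "'a::real_normed_vector \<Rightarrow> 'b::euclidean_space" and g :: "'b \<Rightarrow> 'c::real_normed_vector"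
  assumes "open W" "C_k k f W" "C_k k g V" "f ` W \<subseteq> V"
  shows "C_k k (g \<circ> f) W"
  using assms(2-4)
proof (induction k arbitrary: g)
  case 0
  then show ?case by (metis C_k.simps(1) continuous_on_compose continuous_on_subset)
next
  case (Suc k)
  let ?f = "\<lambda>x. frechet_derivative f (at x)" and ?g = "\<lambda>x. frechet_derivative g (at x)"
  have lin: "linear (?g y)" if "y \<in> V" for y
    using C_k_SucE[OF Suc.prems(2) that] has_derivative_linear by blast
  show ?case
  proof (rule C_k_SucI[OF assms(1)])
    fix x assume x: "x \<in> W"
    have "(g \<circ> f has_derivative ?g (f x) \<circ> ?f x) (at x)"
      by (rule diff_chain_at[OF C_k_SucE[OF Suc.prems(1) x] C_k_SucE[OF Suc.prems(2)]])
        (use x Suc.prems in auto)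
    moreover have "?g (f x) \<circ> ?f x = (\<lambda>v. \<Sum>b\<in>Basis. (?f x v \<bullet> b) *\<^sub>R ?g (f x) b)" (is "_ = ?D x")
    proof
      fix v
      have L: "linear (?g (f x))" using lin x Suc.prems(3) by auto
      have "?g (f x) (?f x v) = ?g (f x) (\<Sum>b\<in>Basis. (?f x v \<bullet> b) *\<^sub>R b)"
        by (simp add: euclidean_representation)
      also have "\<dots> = ?D x v"
        by (simp add: linear_sum[OF L] linear_scale[OF L])
      finally show "(?g (f x) \<circ> ?f x) v = ?D x v" by simp
    qed
    ultimately show "(g \<circ> f has_derivative ?D x) (at x)" by simp
  next
    fix v
    have "C_k k (\<lambda>x. ?g (f x) b) W" for b
      using Suc.IH[OF C_k_SucD[OF Suc.prems(1)], of "\<lambda>y. ?g y b"] Suc.prems(2,3)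
      by (simp add: o_def)
    moreover have "C_k k (\<lambda>x. ?f x v \<bullet> b) W" for b
      using Suc.prems by (intro C_k_linear_comp[OF assms(1) bounded_linear_inner_left]) auto
    ultimately show "C_k k (\<lambda>x. \<Sum>b\<in>Basis. (?f x v \<bullet> b) *\<^sub>R ?g (f x) b) W"
      by (intro C_k_sum[OF assms(1)] C_k_scaleR[OF assms(1)]) auto
  qed
qed

lemma C_k_inverse: "C_k k (inverse :: real \<Rightarrow> real) (- {0})"
proof (induction k)
  case 0
  show ?case by (auto intro!: continuous_intros)
next
  case (Suc k)
  have o: "open (- {0::real})" by auto
  show ?case
  proof (rule C_k_SucI[OF o])
    show "(inverse has_derivative (\<lambda>h. - (inverse x * h * inverse x))) (at x)"
      if "x \<in> - {0::real}" for x using that by (auto intro: has_derivative_inverse')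
    show "C_k k (\<lambda>x::real. - (inverse x * v * inverse x)) (- {0})" for v
      by (intro C_k_linear_comp[OF o bounded_linear_minus[OF bounded_linear_ident]] C_k_mult[OF o]
          C_k_const Suc.IH)
  qed
qed

lemma C_k_vec:
  fixes g :: "'a::real_normed_vector \<Rightarrow> real^'n"
  assumes "open W" "\<And>i. C_k k (\<lambda>x. g x $ i) W"
  shows "C_k k g W"
proof -
  have "C_k k (\<lambda>x. \<Sum>i\<in>UNIV. (g x $ i) *\<^sub>R axis i 1) W"
    by (intro C_k_sum[OF assms(1)] C_k_scaleR[OF assms(1)] C_k_const assms(2)) auto
  then show ?thesis
    by (rule C_k_cong[OF assms(1)]) (metis basis_expansion scalar_mult_eq_scaleR)
qed

section \<open>Smooth maps on arbitrary sets\<close>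

lemma smooth_on_open_iff:
  assumes "open W"
  shows "smooth_on W g \<longleftrightarrow> (\<forall>k. C_k k g W)"
proof
  assume *: "smooth_on W g"
  show "\<forall>k. C_k k g W"
  proof (intro allI C_k_local)
    fix k x assume "x \<in> W"
    then obtain V h where "open V" "x \<in> V" "\<forall>k. C_k k h V" "\<forall>z\<in>W \<inter> V. h z = g z"
      using * unfolding smooth_on_def by meson
    then have "C_k k g (W \<inter> V)"
      using C_k_cong[of "W \<inter> V" k h g] C_k_subset[of k h V "W \<inter> V"] assms by auto
    with \<open>open V\<close> \<open>x \<in> V\<close> \<open>x \<in> W\<close> assms show "\<exists>V. open V \<and> x \<in> V \<and> C_k k g V" by blast
  qed
next
  assume "\<forall>k. C_k k g W"
  with assms show "smooth_on W g" unfolding smooth_on_def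
    by (intro ballI exI[of _ W] exI[of _ g]) simp
qed

lemma smooth_onE:
  assumes "smooth_on S g" "x \<in> S"
  obtains W h where "open W" "x \<in> W" "\<forall>k. C_k k h W" "\<forall>z. z \<in> S \<longrightarrow> z \<in> W \<longrightarrow> h z = g z"
  using assms unfolding smooth_on_def by (metis IntI)

lemma smooth_onI:
  assumes "\<And>x. x \<in> S \<Longrightarrow>
    \<exists>W h. open W \<and> x \<in> W \<and> (\<forall>k. C_k k h W) \<and> (\<forall>z. z \<in> S \<longrightarrow> z \<in> W \<longrightarrow> h z = g z)"
  shows "smooth_on S g"
  unfolding smooth_on_def
proof
  fix x assume "x \<in> S"
  then obtain W h where "open W \<and> x \<in> W \<and> (\<forall>k. C_k k h W) \<and> (\<forall>z. z \<in> S \<longrightarrow> z \<in> W \<longrightarrow> h z = g z)"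
    using assms by presburger
  then show "\<exists>W h. open W \<and> x \<in> W \<and> (\<forall>k. C_k k h W) \<and> (\<forall>z\<in>S \<inter> W. h z = g z)"
    by (intro exI[of _ W] exI[of _ h]) simp
qed

lemma smooth_on_subset:
  assumes "smooth_on S g" "T \<subseteq> S" shows "smooth_on T g"
proof (rule smooth_onI)
  fix x assume "x \<in> T"
  then obtain W h where "open W" "x \<in> W" "\<forall>k. C_k k h W" "\<forall>z. z \<in> S \<longrightarrow> z \<in> W \<longrightarrow> h z = g z"
    using smooth_onE[OF assms(1), of x] assms(2) by (metis subsetD)
  then show "\<exists>W h. open W \<and> x \<in> W \<and> (\<forall>k. C_k k h W) \<and> (\<forall>z. z \<in> T \<longrightarrow> z \<in> W \<longrightarrow> h z = g z)"
    using assms(2) by (intro exI[of _ W] exI[of _ h]) auto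
qed

lemma smooth_on_cong:
  assumes "smooth_on S g" "\<And>x. x \<in> S \<Longrightarrow> g x = h x" shows "smooth_on S h"
  using assms unfolding smooth_on_def by simp

lemma smooth_on_local:
  assumes "\<And>x. x \<in> S \<Longrightarrow> \<exists>V. open V \<and> x \<in> V \<and> smooth_on (S \<inter> V) g"
  shows "smooth_on S g"
  unfolding smooth_on_def
proof
  fix x assume x: "x \<in> S"
  then obtain V where V: "open V" "x \<in> V" "smooth_on (S \<inter> V) g" using assms by blast
  then obtain W h where "open W" "x \<in> W" "\<forall>k. C_k k h W" "\<forall>z\<in>S \<inter> V \<inter> W. h z = g z"
    using x unfolding smooth_on_def by (meson IntI)
  then show "\<exists>W h. open W \<and> x \<in> W \<and> (\<forall>k. C_k k h W) \<and> (\<forall>z\<in>S \<inter> W. h z = g z)"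
    using V by (intro exI[of _ "V \<inter> W"] exI[of _ h]) (auto intro: C_k_subset)
qed

lemma smooth_on_compose:
  fixes f :: "'a::real_normed_vector \<Rightarrow> 'b::euclidean_space"
  assumes f: "smooth_on S f" and g: "smooth_on T g" and im: "f ` S \<subseteq> T"
  shows "smooth_on S (g \<circ> f)"
proof (rule smooth_onI)
  fix x assume x: "x \<in> S"
  obtain W h where W: "open W" "x \<in> W" "\<forall>k. C_k k h W" "\<forall>z. z \<in> S \<longrightarrow> z \<in> W \<longrightarrow> h z = f z"
    using smooth_onE[OF f x] by metis
  have "f x \<in> T" using x im by auto
  then obtain V j where V: "open V" "f x \<in> V" "\<forall>k. C_k k j V" "\<forall>z. z \<in> T \<longrightarrow> z \<in> V \<longrightarrow> j z = g z"
    using smooth_onE[OF g] by metis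
  let ?W = "W \<inter> h -` V"
  have o: "open ?W"
    by (rule continuous_open_preimage[OF C_k_continuous[OF W(3)[rule_format, of 0]] W(1) V(1)])
  have "C_k k (j \<circ> h) ?W" for k
    by (rule C_k_compose[OF o C_k_subset[OF W(3)[rule_format]] V(3)[rule_format]]) auto
  moreover have "x \<in> ?W" using W V x by auto
  moreover have "(j \<circ> h) z = (g \<circ> f) z" if "z \<in> S" "z \<in> ?W" for z
  proof -
    have "h z = f z" "h z \<in> V" using that W(4) by auto
    moreover have "f z \<in> T" using that im by blast
    ultimately show ?thesis using V(4) by simp
  qed
  ultimately show "\<exists>W h. open W \<and> x \<in> W \<and> (\<forall>k. C_k k h W) \<and>
      (\<forall>z. z \<in> S \<longrightarrow> z \<in> W \<longrightarrow> h z = (g \<circ> f) z)"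
    using o by (intro exI[of _ ?W] exI[of _ "j \<circ> h"] conjI) simp_all
qed

lemma smooth_on_linear:
  assumes "bounded_linear L" shows "smooth_on S L"
proof -
  have "smooth_on UNIV L"
    using C_k_bounded_linear[OF assms, of _ UNIV] by (simp add: smooth_on_open_iff)
  then show ?thesis by (rule smooth_on_subset) simp
qed


section \<open>Smooth inverse functions in the plane\<close>

text \<open>Cramer's rule for the matrix with columns \<open>p\<close> and \<open>q\<close>.\<close>

definition cramer2 :: "real^2 \<Rightarrow> real^2 \<Rightarrow> real^2 \<Rightarrow> real^2" where
  "cramer2 p q w = (\<chi> i. (if i = 1 then w$1 * q$2 - w$2 * q$1 else p$1 * w$2 - p$2 * w$1) *
     inverse (p$1 * q$2 - p$2 * q$1))"

lemma linear_real2: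
  fixes L :: "real^2 \<Rightarrow> 'b::real_vector"
  assumes "linear L"
  shows "L v = v$1 *\<^sub>R L (axis 1 1) + v$2 *\<^sub>R L (axis 2 1)"
proof -
  have "L v = L (v$1 *\<^sub>R axis 1 1 + v$2 *\<^sub>R axis 2 1)"
    by (rule arg_cong[of _ _ L]) (simp add: vec_eq_iff forall_2 axis_def)
  then show ?thesis by (simp add: linear_add[OF assms] linear_scale[OF assms])
qed

lemma inv_eq_cramer2:
  fixes L :: "real^2 \<Rightarrow> real^2"
  assumes L: "linear L" and "bij L"
  shows "(L (axis 1 1))$1 * (L (axis 2 1))$2 - (L (axis 1 1))$2 * (L (axis 2 1))$1 \<noteq> 0"
    and "inv L w = cramer2 (L (axis 1 1)) (L (axis 2 1)) w"
proof -
  let ?p = "L (axis 1 1)" and ?q = "L (axis 2 1)"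
  have L2: "L v = v$1 *\<^sub>R ?p + v$2 *\<^sub>R ?q" for v by (rule linear_real2[OF L])
  show nz: "?p$1 * ?q$2 - ?p$2 * ?q$1 \<noteq> 0"
  proof
    assume 0: "?p$1 * ?q$2 - ?p$2 * ?q$1 = 0"
    have k0: "v = 0" if "L v = 0" for v
      using that assms(2) linear_0[OF L] by (metis bij_def injD)
    have "L (vector [?q$2, - ?p$2]) = 0" "L (vector [?q$1, - ?p$1]) = 0"
      using 0 by (auto simp: L2[of "vector _"] vec_eq_iff forall_2 algebra_simps)
    then have "(vector [?q$2, - ?p$2] :: real^2) = 0" "(vector [?q$1, - ?p$1] :: real^2) = 0"
      using k0 by blast+
    then have "?p = 0" by (simp add: vec_eq_iff forall_2)
    then have "(axis 1 1 :: real^2) = 0" using k0 by blast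
    then show False by (simp add: axis_eq_0_iff)
  qed
  have "L (cramer2 ?p ?q w) = w"
  proof -
    define i where "i = inverse (?p$1 * ?q$2 - ?p$2 * ?q$1)"
    have i: "(?p$1 * ?q$2 - ?p$2 * ?q$1) * i = 1" using nz by (simp add: i_def)
    have "(w$1 * ?q$2 - w$2 * ?q$1) * i * ?p$1 + (?p$1 * w$2 - ?p$2 * w$1) * i * ?q$1 = w$1"
      "(w$1 * ?q$2 - w$2 * ?q$1) * i * ?p$2 + (?p$1 * w$2 - ?p$2 * w$1) * i * ?q$2 = w$2"
      using i by algebra+
    then show ?thesis
      by (subst L2) (simp add: vec_eq_iff forall_2 cramer2_def flip: i_def)
  qed
  then show "inv L w = cramer2 ?p ?q w"
    using assms(2) by (metis bij_def inv_f_f)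
qed

text \<open>The inverse function theorem supplies a differentiable inverse \<open>g\<close>, with derivative
  \<open>(Df (g y))\<^sup>-\<^sup>1\<close>.  By Cramer's rule this is a rational expression in \<open>Df \<circ> g\<close>, so \<open>g\<close> gains one order of
  differentiability from each order it already has.\<close>

lemma smooth_inverse_function_real2:
  fixes f :: "real^2 \<Rightarrow> real^2"
  assumes "open U" and f: "\<And>k. C_k k f U" and "x0 \<in> U" and inj: "inj (frechet_derivative f (at x0))"
  obtains U' V g where "open U'" "U' \<subseteq> U" "x0 \<in> U'" "open V" "homeomorphism U' V f g" "\<And>k. C_k k g V"
proof -
  let ?D = "\<lambda>x. frechet_derivative f (at x)"
  define f' where "f' x = Blinfun (?D x)" for x
  have der: "(f has_derivative ?D x) (at x)" if "x \<in> U" for x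
    using C_k_SucE[OF f that] .
  have f': "blinfun_apply (f' x) = ?D x" if "x \<in> U" for x
    unfolding f'_def
    by (rule bounded_linear_Blinfun_apply[OF has_derivative_bounded_linear[OF der[OF that]]])
  have "continuous_on U f'"
  proof (rule continuous_on_blinfun_componentwise)
    fix i :: "real^2"
    have "continuous_on U (\<lambda>x. ?D x i)" using f[of 1] by simp
    then show "continuous_on U (\<lambda>x. blinfun_apply (f' x) i)"
      using f' by (simp cong: continuous_on_cong)
  qed
  moreover obtain l where l: "linear l" "l \<circ> ?D x0 = id"
    using linear_injective_left_inverse[OF has_derivative_linear[OF der[OF \<open>x0 \<in> U\<close>]] inj] by blast
  have "Blinfun l o\<^sub>L f' x0 = id_blinfun"
  proof (rule blinfun_eqI)
    fix i
    have "l (?D x0 i) = i" using fun_cong[OF l(2), of i] by (simp only: o_apply id_apply)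
    then show "blinfun_apply (Blinfun l o\<^sub>L f' x0) i = blinfun_apply id_blinfun i"
      using l(1) f'[OF \<open>x0 \<in> U\<close>]
      by (simp add: bounded_linear_Blinfun_apply linear_conv_bounded_linear)
  qed
  ultimately obtain U' V g g' where U': "open U'" "U' \<subseteq> U" "x0 \<in> U'" "open V" "homeomorphism U' V f g"
    and g: "\<And>y. y \<in> V \<Longrightarrow> (g has_derivative (g' y)) (at y)"
      "\<And>y. y \<in> V \<Longrightarrow> g' y = inv (blinfun_apply (f' (g y)))"
      "\<And>y. y \<in> V \<Longrightarrow> bij (blinfun_apply (f' (g y)))"
    using inverse_function_theorem[of U f f' x0 "Blinfun l"] assms(1,3) der f' by (metis (no_types, lifting))
  have gU: "g y \<in> U" if "y \<in> V" for y
    using U' that by (metis homeomorphism_image2 imageI subsetD)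
  have lin: "linear (?D (g y))" "bij (?D (g y))" if "y \<in> V" for y
    using has_derivative_linear[OF der[OF gU[OF that]]] g(3)[OF that] f'[OF gU[OF that]] by auto
  have gder: "(g has_derivative cramer2 (?D (g y) (axis 1 1)) (?D (g y) (axis 2 1))) (at y)" if "y \<in> V" for y
  proof -
    have "g' y = cramer2 (?D (g y) (axis 1 1)) (?D (g y) (axis 2 1))"
      using g(2)[OF that] f'[OF gU[OF that]] inv_eq_cramer2(2)[OF lin[OF that]] by (simp add: fun_eq_iff)
    then show ?thesis using g(1)[OF that] by simp
  qed
  have "C_k k g V" for k
  proof (induction k)
    case 0
    show ?case using U'(5) by (simp add: homeomorphism_def)
  next
    case (Suc k)
    note oV = \<open>open V\<close>
    have c: "C_k k (\<lambda>y. ?D (g y) v) V" for v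
      using C_k_compose[OF oV Suc, of "\<lambda>x. ?D x v" U] f[of "Suc k"] gU by (auto simp: o_def)
    have c1: "C_k k (\<lambda>y. ?D (g y) v $ i) V" for v i
      using C_k_linear_comp[OF oV bounded_linear_vec_nth c] .
    let ?p = "\<lambda>y. ?D (g y) (axis 1 1)" and ?q = "\<lambda>y. ?D (g y) (axis 2 1)"
    let ?det = "\<lambda>y. ?p y $ 1 * ?q y $ 2 - ?p y $ 2 * ?q y $ 1"
    have minus: "C_k k (\<lambda>y. a y - b y) V" if "C_k k a V" "C_k k b V" for a b :: "real^2 \<Rightarrow> real"
      using C_k_add[OF oV that(1) C_k_linear_comp[OF oV bounded_linear_minus[OF bounded_linear_ident] that(2)]]
      by simp
    have "C_k k ?det V" by (intro minus C_k_mult[OF oV] c1)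
    moreover have "?det ` V \<subseteq> - {0}" using inv_eq_cramer2(1)[OF lin] by auto
    ultimately have "C_k k (inverse \<circ> ?det) V"
      using C_k_compose[OF oV _ C_k_inverse] by blast
    then have i: "C_k k (\<lambda>y. inverse (?det y)) V" by (simp add: o_def)
    show ?case
    proof (rule C_k_SucI[OF oV gder])
      fix v :: "real^2"
      show "C_k k (\<lambda>y. cramer2 (?p y) (?q y) v) V"
      proof (rule C_k_vec[OF oV])
        fix i :: 2
        show "C_k k (\<lambda>y. cramer2 (?p y) (?q y) v $ i) V"
          by (cases "i = 1") (simp_all add: cramer2_def, (intro C_k_mult[OF oV] minus c1 C_k_const i)+)
      qed
    qed
  qed
  with U' that show ?thesis by blast
qed

section \<open>Bump functions\<close>

text \<open>The functions \<open>p(1/t) exp(-1/t)\<close>, extended by zero to \<open>t \<le> 0\<close>.  Keeping the polynomial as a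
  parameter makes the family closed under differentiation.\<close>

definition flat_exp :: "real poly \<Rightarrow> real \<Rightarrow> real" where
  "flat_exp p t = (if t > 0 then poly p (inverse t) * exp (- inverse t) else 0)"

lemma tendsto_poly_exp_0:
  fixes p :: "real poly"
  shows "((\<lambda>u. u ^ k * poly p u * exp (- u)) \<longlongrightarrow> 0) at_top"
proof (induction p arbitrary: k)
  case 0
  then show ?case by simp
next
  case (pCons a p)
  have "((\<lambda>u. a * (u ^ k / exp u) + u ^ Suc k * poly p u * exp (- u)) \<longlongrightarrow> a * 0 + 0) at_top"
    by (intro tendsto_intros tendsto_power_div_exp_0 pCons.IH)
  then show ?case by (simp add: exp_minus field_simps)
qed

lemma flat_exp_has_derivative:
  "(flat_exp p has_real_derivative flat_exp ([:0,0,1:] * (p - pderiv p)) t) (at t)"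
proof -
  consider "t > 0" | "t < 0" | "t = 0" by linarith
  then show ?thesis
  proof cases
    case 1
    have "((\<lambda>t. poly p (inverse t) * exp (- inverse t)) has_real_derivative
        flat_exp ([:0,0,1:] * (p - pderiv p)) t) (at t)"
      using 1 by (auto intro!: derivative_eq_intros DERIV_chain2[OF poly_DERIV]
          simp: flat_exp_def field_simps power2_eq_square)
    then show ?thesis
      by (rule has_field_derivative_transform_within_open[of _ _ _ "{0<..}"]) (use 1 in \<open>auto simp: flat_exp_def\<close>)
  next
    case 2
    have "((\<lambda>t. 0) has_real_derivative flat_exp ([:0,0,1:] * (p - pderiv p)) t) (at t)"
      using 2 by (auto simp: flat_exp_def)
    then show ?thesis
      by (rule has_field_derivative_transform_within_open[of _ _ _ "{..<0}"]) (use 2 in \<open>auto simp: flat_exp_def\<close>)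
  next
    case 3
    have "((\<lambda>h. inverse h ^ 1 * poly p (inverse h) * exp (- inverse h)) \<longlongrightarrow> 0) (at_right 0)"
      by (rule filterlim_compose[OF tendsto_poly_exp_0 filterlim_inverse_at_top_right])
    then have "((\<lambda>h. flat_exp p h / h) \<longlongrightarrow> 0) (at_right 0)"
      by (rule Lim_transform_eventually)
        (auto simp: eventually_at_right_field flat_exp_def field_simps intro!: exI[of _ 1])
    moreover have "((\<lambda>h. flat_exp p h / h) \<longlongrightarrow> 0) (at_left 0)"
      by (rule Lim_transform_eventually[OF tendsto_const])
        (auto simp: eventually_at_left_field flat_exp_def intro!: exI[of _ "-1"])
    ultimately have "((\<lambda>h. flat_exp p h / h) \<longlongrightarrow> 0) (at 0)"
      by (simp add: filterlim_at_split)
    then show ?thesis using 3 by (simp add: DERIV_def flat_exp_def)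
  qed
qed

text \<open>Differentiation stays inside the family, so continuity of all its members gives smoothness.\<close>

lemma C_k_flat_exp: "C_k k (flat_exp p) UNIV"
proof (induction k arbitrary: p)
  case 0
  show ?case
    using DERIV_isCont[OF flat_exp_has_derivative] by (simp add: continuous_at_imp_continuous_on)
next
  case (Suc k)
  show ?case
  proof (rule C_k_SucI[OF open_UNIV])
    show "(flat_exp p has_derivative (\<lambda>v. flat_exp ([:0,0,1:] * (p - pderiv p)) x * v)) (at x)" for x
      using flat_exp_has_derivative by (simp add: has_field_derivative_def)
    show "C_k k (\<lambda>x. flat_exp ([:0,0,1:] * (p - pderiv p)) x * v) UNIV" for v
      by (intro C_k_mult[OF open_UNIV] Suc C_k_const)
  qed
qed

text \<open>With \<open>\<psi>(t) = exp(-1/t)\<close> the quotient \<open>\<psi>(R\<^sup>2 - |x-a|\<^sup>2) / (\<psi>(R\<^sup>2 - |x-a|\<^sup>2) + \<psi>(|x-a|\<^sup>2 - r\<^sup>2))\<close> has the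
  required values; its denominator cannot vanish because \<open>r < R\<close>.\<close>

lemma smooth_bump:
  fixes a :: "'a::euclidean_space"
  assumes "0 < r" "r < R"
  obtains \<beta> :: "'a \<Rightarrow> real" where "\<And>k. C_k k \<beta> UNIV" "\<And>x. dist x a \<le> r \<Longrightarrow> \<beta> x = 1"
    "\<And>x. dist x a \<ge> R \<Longrightarrow> \<beta> x = 0"
proof -
  let ?\<psi> = "flat_exp 1"
  let ?u = "\<lambda>x. ?\<psi> (R\<^sup>2 - (x - a) \<bullet> (x - a))" and ?v = "\<lambda>x. ?\<psi> ((x - a) \<bullet> (x - a) - r\<^sup>2)"
  define \<beta> where "\<beta> x = ?u x * inverse (?u x + ?v x)" for x :: 'a
  have n: "(x - a) \<bullet> (x - a) = (dist x a)\<^sup>2" for x :: 'a by (simp add: dist_norm power2_norm_eq_inner)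
  have r2: "r\<^sup>2 < R\<^sup>2" using assms by (simp add: power_strict_mono)
  have p: "?\<psi> t > 0 \<longleftrightarrow> t > 0" "?\<psi> t \<ge> 0" for t by (auto simp: flat_exp_def)
  have pos: "?u x + ?v x > 0" for x
  proof (cases "(x - a) \<bullet> (x - a) < R\<^sup>2")
    case True
    then show ?thesis by (intro add_pos_nonneg p) (simp add: p)
  next
    case False
    then show ?thesis using r2 by (intro add_nonneg_pos p) (simp add: p)
  qed
  have sm: "C_k k \<beta> UNIV" for k
  proof -
    note o = open_UNIV[where 'a='a]
    have id: "C_k k (\<lambda>x. x - a) UNIV"
      using C_k_add[OF o C_k_bounded_linear[OF bounded_linear_ident] C_k_const[of k "- a"]] by simp
    have sq: "C_k k (\<lambda>x. (x - a) \<bullet> (x - a)) UNIV"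
      by (rule bounded_bilinear.C_k_prod[OF bounded_bilinear_inner o id id])
    have 1: "C_k k (\<lambda>x. R\<^sup>2 - (x - a) \<bullet> (x - a)) UNIV"
      using C_k_add[OF o C_k_const[of k "R\<^sup>2"] C_k_linear_comp[OF o bounded_linear_minus[OF bounded_linear_ident] sq]]
      by simp
    have 2: "C_k k (\<lambda>x. (x - a) \<bullet> (x - a) - r\<^sup>2) UNIV"
      using C_k_add[OF o sq C_k_const[of k "- r\<^sup>2"]] by simp
    have u: "C_k k ?u UNIV" using C_k_compose[OF o 1 C_k_flat_exp] by (simp add: o_def)
    have v: "C_k k ?v UNIV" using C_k_compose[OF o 2 C_k_flat_exp] by (simp add: o_def)
    have "C_k k (inverse \<circ> (\<lambda>x. ?u x + ?v x)) UNIV"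
      by (rule C_k_compose[OF o C_k_add[OF o u v] C_k_inverse]) (use pos in \<open>auto simp: less_imp_neq[THEN not_sym]\<close>)
    then show ?thesis unfolding \<beta>_def by (intro C_k_mult[OF o] u) (simp add: o_def)
  qed
  show ?thesis
  proof (rule that[of \<beta>])
    show "\<beta> x = 1" if "dist x a \<le> r" for x
    proof -
      have "(dist x a)\<^sup>2 \<le> r\<^sup>2" using that by (simp add: power_mono)
      then have "?v x = 0" by (simp add: n flat_exp_def)
      then show ?thesis using pos[of x] by (simp add: \<beta>_def)
    qed
    show "\<beta> x = 0" if "dist x a \<ge> R" for x
    proof -
      have "R\<^sup>2 \<le> (dist x a)\<^sup>2" using that assms by (simp add: power_mono)
      then have "?u x = 0" by (simp add: n flat_exp_def)
      then show ?thesis by (simp add: \<beta>_def)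
    qed
  qed (rule sm)
qed

lemma smooth_germ_extends:
  fixes h :: "'a::euclidean_space \<Rightarrow> 'b::real_normed_vector"
  assumes "open W" "\<And>k. C_k k h W" "a \<in> W"
  obtains H r where "r > 0" "\<And>k. C_k k H UNIV" "\<And>x. x \<in> ball a r \<Longrightarrow> H x = h x"
proof -
  obtain R where R: "R > 0" "cball a R \<subseteq> W" using assms open_contains_cball by blast
  obtain \<beta> :: "'a \<Rightarrow> real" where \<beta>: "\<And>k. C_k k \<beta> UNIV" "\<And>x. dist x a \<le> R/2 \<Longrightarrow> \<beta> x = 1"
    "\<And>x. dist x a \<ge> R \<Longrightarrow> \<beta> x = 0"
    using smooth_bump[of "R/2" R a] R by auto
  define H where "H x = (if x \<in> W then \<beta> x *\<^sub>R h x else 0)" for x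
  have "C_k k H UNIV" for k
  proof (rule C_k_local)
    fix x :: 'a
    show "\<exists>V. open V \<and> x \<in> V \<and> C_k k H V"
    proof (cases "x \<in> W")
      case True
      have "C_k k (\<lambda>x. \<beta> x *\<^sub>R h x) W"
        using C_k_scaleR[OF assms(1) C_k_subset[OF \<beta>(1)] assms(2)] by simp
      then have "C_k k H W" by (rule C_k_cong[OF assms(1)]) (simp add: H_def)
      then show ?thesis using True assms(1) by blast
    next
      case False
      have o: "open (- cball a R)" by (simp add: open_Compl)
      have "C_k k H (- cball a R)"
        by (rule C_k_cong[OF o C_k_const[of k 0]]) (simp add: H_def \<beta>(3) dist_commute)
      then show ?thesis using False R o by blast
    qed
  qed
  moreover have "H x = h x" if "x \<in> ball a (R/2)" for x
  proof -
    have "x \<in> W" using that R by (auto simp: subset_iff)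
    then show ?thesis using that \<beta>(2)[of x] by (simp add: H_def dist_commute)
  qed
  ultimately show ?thesis using R that[of "R/2" H] by auto
qed

section \<open>The Lorentz product and determinants of order five\<close>

lemma exhaust_5: fixes i :: 5 shows "i = 1 \<or> i = 2 \<or> i = 3 \<or> i = 4 \<or> i = 5"
proof (induct i)
  case (of_int z)
  then have "z = 0 \<or> z = 1 \<or> z = 2 \<or> z = 3 \<or> z = 4" by fastforce
  then show ?case by auto
qed

lemma forall_5: "(\<forall>i::5. P i) \<longleftrightarrow> P 1 \<and> P 2 \<and> P 3 \<and> P 4 \<and> P 5"
  by (metis exhaust_5)

lemma UNIV_5: "UNIV = {1, 2, 3, 4, 5::5}"
  using exhaust_5 by auto

lemma sum_5: "sum f (UNIV::5 set) = f 1 + f 2 + f 3 + f 4 + f 5"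
  unfolding UNIV_5 by (simp add: ac_simps)

lemma vector_5 [simp]:
  "(vector [a, b, c, d, e] :: ('a::zero)^5) $ 1 = a" "(vector [a, b, c, d, e] :: 'a^5) $ 2 = b"
  "(vector [a, b, c, d, e] :: 'a^5) $ 3 = c" "(vector [a, b, c, d, e] :: 'a^5) $ 4 = d"
  "(vector [a, b, c, d, e] :: 'a^5) $ 5 = e"
  unfolding vector_def by simp_all

lemma bounded_bilinear_lor: "bounded_bilinear lor"
proof -
  have "bilinear lor"
    by (auto simp: bilinear_def lor_def linear_iff algebra_simps)
  then show ?thesis using bilinear_conv_bounded_bilinear by blast
qed

interpretation lor: bounded_bilinear lor by (rule bounded_bilinear_lor)

lemma lor_commute: "lor x y = lor y x"
  by (simp add: lor_def mult.commute)

lemma lor_nondegenerate: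
  assumes "\<And>w. lor u w = lor v w" shows "u = v"
  using assms[of "axis 1 1"] assms[of "axis 2 1"] assms[of "axis 3 1"] assms[of "axis 4 1"] assms[of "axis 5 1"]
  by (simp add: lor_def axis_def vec_eq_iff forall_5)

text \<open>On the hyperplane where the first coordinate vanishes the Lorentz product is positive definite.\<close>

lemma null_first_component:
  assumes "lor n n = 0" "n \<noteq> 0" shows "n $ 1 \<noteq> 0"
proof
  assume "n $ 1 = 0"
  then have "n$2*n$2 + n$3*n$3 + n$4*n$4 + n$5*n$5 = 0" using assms(1) by (simp add: lor_def)
  moreover have "n$2*n$2 \<ge> 0" "n$3*n$3 \<ge> 0" "n$4*n$4 \<ge> 0" "n$5*n$5 \<ge> 0" by simp_all
  ultimately have "n$2*n$2 = 0" "n$3*n$3 = 0" "n$4*n$4 = 0" "n$5*n$5 = 0" by linarith+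
  with \<open>n $ 1 = 0\<close> have "n = 0" by (simp add: vec_eq_iff forall_5)
  then show False using assms(2) by simp
qed

abbreviation det5 :: "real^5 \<Rightarrow> real^5 \<Rightarrow> real^5 \<Rightarrow> real^5 \<Rightarrow> real^5 \<Rightarrow> real" where
  "det5 x v w p q \<equiv> det (vector [x, v, w, p, q] :: real^5^5)"

lemma linear_det_row:
  fixes M :: "real^'n^'n"
  shows "linear (\<lambda>w. det (\<chi> i. if i = k then w else M $ i))"
proof (rule linearI)
  fix v w show "det (\<chi> i. if i = k then v + w else M $ i) =
     det (\<chi> i. if i = k then v else M $ i) + det (\<chi> i. if i = k then w else M $ i)"
    using det_row_add[of k "\<lambda>_. v" "\<lambda>_. w" "\<lambda>i. M $ i"] by simp
  fix c show "det (\<chi> i. if i = k then c *\<^sub>R w else M $ i) = c *\<^sub>R det (\<chi> i. if i = k then w else M $ i)"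
    using det_row_mul[of k c "\<lambda>_. w" "\<lambda>i. M $ i"] unfolding scalar_mult_eq_scaleR by simp
qed

text \<open>A determinant of order five has too many terms to be expanded; linearity in the last four rows and vanishing on repeated
  rows evaluate the determinants of vectors given in a frame.\<close>

lemma linear_det5:
  "linear (\<lambda>v. det5 x v w p q)" "linear (\<lambda>w. det5 x v w p q)"
  "linear (\<lambda>p. det5 x v w p q)" "linear (\<lambda>q. det5 x v w p q)"
proof -
  have "vector [x, v, w, p, q] = (\<chi> i. if i = 2 then v else (vector [x, 0, w, p, q] :: real^5^5) $ i)"
    "vector [x, v, w, p, q] = (\<chi> i. if i = 3 then w else (vector [x, v, 0, p, q] :: real^5^5) $ i)"
    "vector [x, v, w, p, q] = (\<chi> i. if i = 4 then p else (vector [x, v, w, 0, q] :: real^5^5) $ i)"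
    "vector [x, v, w, p, q] = (\<chi> i. if i = 5 then q else (vector [x, v, w, p, 0] :: real^5^5) $ i)"
    for v w p q :: "real^5"
    by (simp_all add: vec_eq_iff forall_5)
  note e = this
  show "linear (\<lambda>v. det5 x v w p q)"
    using linear_det_row[of 2 "vector [x, 0, w, p, q]"] unfolding e(1)[symmetric] .
  show "linear (\<lambda>w. det5 x v w p q)"
    using linear_det_row[of 3 "vector [x, v, 0, p, q]"] unfolding e(2)[symmetric] .
  show "linear (\<lambda>p. det5 x v w p q)"
    using linear_det_row[of 4 "vector [x, v, w, 0, q]"] unfolding e(3)[symmetric] .
  show "linear (\<lambda>q. det5 x v w p q)"
    using linear_det_row[of 5 "vector [x, v, w, p, 0]"] unfolding e(4)[symmetric] .
qed

lemmas det5_simps = linear_det5[THEN linear_add] linear_det5[THEN linear_scale]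

lemma det5_repeated:
  "det5 x x w p q = 0" "det5 x v x p q = 0" "det5 x v v p q = 0" "det5 x v w v q = 0"
  "det5 x v w p v = 0" "det5 x v w w q = 0" "det5 x v w p w = 0" "det5 x v w p p = 0"
  using det_identical_rows[of 1 2 "vector [x, x, w, p, q] :: real^5^5"]
    det_identical_rows[of 1 3 "vector [x, v, x, p, q] :: real^5^5"]
    det_identical_rows[of 2 3 "vector [x, v, v, p, q] :: real^5^5"]
    det_identical_rows[of 2 4 "vector [x, v, w, v, q] :: real^5^5"]
    det_identical_rows[of 2 5 "vector [x, v, w, p, v] :: real^5^5"]
    det_identical_rows[of 3 4 "vector [x, v, w, w, q] :: real^5^5"]
    det_identical_rows[of 3 5 "vector [x, v, w, p, w] :: real^5^5"]
    det_identical_rows[of 4 5 "vector [x, v, w, p, p] :: real^5^5"]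
  by (simp_all add: row_def vec_eq_iff)

lemma det5_swap:
  "det5 x w v p q = - det5 x v w p q" "det5 x v w q p = - det5 x v w p q"
proof -
  have "det5 x v w p q + det5 x w v p q = 0"
    using det5_repeated(3)[of x "v + w" p q] by (simp only: det5_simps, simp add: det5_repeated)
  then show "det5 x w v p q = - det5 x v w p q" by linarith
  have "det5 x v w p q + det5 x v w q p = 0"
    using det5_repeated(8)[of x v w "p + q"] by (simp only: det5_simps, simp add: det5_repeated)
  then show "det5 x v w q p = - det5 x v w p q" by linarith
qed

section \<open>Rotation of the normal plane\<close>

text \<open>The vector dual, with respect to the Lorentz product, to \<open>w \<mapsto> \<epsilon> det(x,v,w,p,q)\<close>.  If \<open>p\<close> and \<open>q\<close> are
  positively oriented tangent vectors, this operator is a positive multiple of the one that exchanges the first two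
  vectors of any Darboux frame and annihilates \<open>x\<close> and the tangent plane.  It is written without reference to a frame and depends smoothly on its
  arguments, so that its positive eigenline is a smooth, frame independent description of the null line.\<close>

definition normal_rot :: "real \<Rightarrow> real^5 \<Rightarrow> real^5 \<Rightarrow> real^5 \<Rightarrow> real^5 \<Rightarrow> real^5" where
  "normal_rot \<epsilon> x p q v = (\<chi> i. (if i = 1 then -1 else 1) * (\<epsilon> * det5 x v (axis i 1) p q))"

lemma lor_normal_rot: "lor (normal_rot \<epsilon> x p q v) w = \<epsilon> * det5 x v w p q"
proof -
  have w: "w = w$1 *\<^sub>R axis 1 1 + w$2 *\<^sub>R axis 2 1 + w$3 *\<^sub>R axis 3 1 + w$4 *\<^sub>R axis 4 1 + w$5 *\<^sub>R axis 5 1"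
    by (simp add: vec_eq_iff forall_5 axis_def)
  have "det5 x v w p q = w$1 * det5 x v (axis 1 1) p q + w$2 * det5 x v (axis 2 1) p q
     + w$3 * det5 x v (axis 3 1) p q + w$4 * det5 x v (axis 4 1) p q + w$5 * det5 x v (axis 5 1) p q"
    by (subst w) (simp add: det5_simps)
  then show ?thesis by (simp add: lor_def normal_rot_def algebra_simps)
qed

text \<open>A Darboux frame, stated for a point \<open>x\<close> and a parametrisation \<open>L\<close> of the tangent plane instead of
  an immersion and a chart; this is the form in which it appears in a coordinate patch.\<close>

definition adapted_frame ::
  "real \<Rightarrow> real^5 \<Rightarrow> (real^2 \<Rightarrow> real^5) \<Rightarrow> (nat \<Rightarrow> real^5) \<Rightarrow> bool" where
  "adapted_frame \<epsilon> x L e \<longleftrightarrow>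
     positive_frame_S41 \<epsilon> x e \<and>
     (\<forall>i\<in>{1..4}. \<forall>j\<in>{1..4}. lor (e i) (e j) = (if i \<noteq> j then 0 else if i = 1 then -1 else 1)) \<and>
     (\<exists>a b. e 3 = L a \<and> e 4 = L b \<and> det (vector [a, b] :: real^2^2) > 0)"

lemma darboux_frame_eq: "darboux_frame \<epsilon> c f p e = adapted_frame \<epsilon> (f p) (differential c f p) e"
  by (simp add: darboux_frame_def adapted_frame_def)

locale frame_S41 =
  fixes \<epsilon> :: real and x :: "real^5" and L :: "real^2 \<Rightarrow> real^5" and e :: "nat \<Rightarrow> real^5"
  assumes lor_x: "lor x x = 1" and lin: "linear L" and fr: "adapted_frame \<epsilon> x L e"
begin

lemma lor_frame:
  "lor (e 1) (e 1) = -1" "lor (e 2) (e 2) = 1" "lor (e 3) (e 3) = 1" "lor (e 4) (e 4) = 1"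
  "lor (e 1) (e 2) = 0" "lor (e 1) (e 3) = 0" "lor (e 1) (e 4) = 0"
  "lor (e 2) (e 3) = 0" "lor (e 2) (e 4) = 0" "lor (e 3) (e 4) = 0"
  "lor (e 2) (e 1) = 0" "lor (e 3) (e 1) = 0" "lor (e 4) (e 1) = 0"
  "lor (e 3) (e 2) = 0" "lor (e 4) (e 2) = 0" "lor (e 4) (e 3) = 0"
  "lor x (e 1) = 0" "lor x (e 2) = 0" "lor x (e 3) = 0" "lor x (e 4) = 0"
  "lor (e 1) x = 0" "lor (e 2) x = 0" "lor (e 3) x = 0" "lor (e 4) x = 0"
  using fr unfolding adapted_frame_def positive_frame_S41_def tangent_S41_def
  by (auto simp: lor_commute[of _ x])

lemma orientation: "\<epsilon> * det5 x (e 1) (e 2) (e 3) (e 4) > 0"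
  using fr unfolding adapted_frame_def positive_frame_S41_def by simp

text \<open>A frame has nonzero determinant, hence spans; the coefficients are then read off from orthonormality.\<close>

lemma expansion:
  "v = lor v x *\<^sub>R x - lor v (e 1) *\<^sub>R e 1 + lor v (e 2) *\<^sub>R e 2 + lor v (e 3) *\<^sub>R e 3 + lor v (e 4) *\<^sub>R e 4"
proof -
  let ?M = "vector [x, e 1, e 2, e 3, e 4] :: real^5^5"
  have "det (transpose ?M) \<noteq> 0" using orientation by (auto simp: det_transpose)
  then have "invertible (transpose ?M)" by (simp add: invertible_det_nz)
  then obtain c where "transpose ?M *v c = v"
    by (metis invertible_right_inverse matrix_vector_mul_assoc matrix_vector_mul_lid)
  then have v: "v = c$1 *\<^sub>R x + c$2 *\<^sub>R e 1 + c$3 *\<^sub>R e 2 + c$4 *\<^sub>R e 3 + c$5 *\<^sub>R e 4"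
    by (auto simp: vec_eq_iff matrix_vector_mult_def sum_5 transpose_def algebra_simps)
  show ?thesis
    by (simp add: v lor.add_left lor.scaleR_left lor_frame lor_x del: One_nat_def)
qed

text \<open>Replacing the coordinate vectors \<open>L e\<^sub>1, L e\<^sub>2\<close> by \<open>e 3, e 4\<close> multiplies the determinant by a positive number, as both
  pairs are positively oriented.  Expanding \<open>v\<close> and \<open>w\<close> in the frame, only the coefficients along \<open>e 1\<close> and
  \<open>e 2\<close> survive.  Thus \<open>e 1 + e 2\<close> and \<open>e 1 - e 2\<close> are eigenvectors, for \<open>\<kappa>\<close> and \<open>-\<kappa>\<close>.\<close>

lemma normal_rot_frame:
  obtains \<kappa> where "\<kappa> > 0"
    "\<And>v. normal_rot \<epsilon> x (L (axis 1 1)) (L (axis 2 1)) v = \<kappa> *\<^sub>R (lor v (e 2) *\<^sub>R e 1 - lor v (e 1) *\<^sub>R e 2)"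
proof -
  let ?p = "L (axis 1 1)" and ?q = "L (axis 2 1)"
  obtain a b where ab: "e 3 = L a" "e 4 = L b" and "det (vector [a, b] :: real^2^2) > 0"
    using fr unfolding adapted_frame_def by blast
  then have \<delta>: "a$1 * b$2 - a$2 * b$1 > 0" (is "?\<delta> > 0") by (simp add: det_2)
  have e34: "e 3 = a$1 *\<^sub>R ?p + a$2 *\<^sub>R ?q" "e 4 = b$1 *\<^sub>R ?p + b$2 *\<^sub>R ?q"
    using linear_real2[OF lin] ab by metis+
  have d: "det5 x v w (e 3) (e 4) = ?\<delta> * det5 x v w ?p ?q" for v w
    unfolding e34 by (simp add: det5_simps det5_repeated det5_swap(2)[of x v w ?q ?p] algebra_simps)
  let ?\<Delta> = "det5 x (e 1) (e 2) (e 3) (e 4)"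
  have D: "det5 x v w (e 3) (e 4) = (lor v (e 2) * lor w (e 1) - lor v (e 1) * lor w (e 2)) * ?\<Delta>" for v w
  proof -
    have v: "det5 x v w (e 3) (e 4) =
      - (lor v (e 1) * det5 x (e 1) w (e 3) (e 4)) + lor v (e 2) * det5 x (e 2) w (e 3) (e 4)" for w
      by (subst expansion[of v])
        (simp add: det5_simps linear_diff[OF linear_det5(1)] det5_repeated)
    have w: "det5 x v w (e 3) (e 4) =
      - (lor w (e 1) * det5 x v (e 1) (e 3) (e 4)) + lor w (e 2) * det5 x v (e 2) (e 3) (e 4)" for v
      by (subst expansion[of w])
        (simp add: det5_simps linear_diff[OF linear_det5(2)] det5_repeated)
    show ?thesis
      unfolding v[of w] w[of "e 1"] w[of "e 2"]
      using det5_swap(1)[of x "e 2" "e 1" "e 3" "e 4"] det5_repeated(3)[of x _ "e 3" "e 4"]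
      by (simp add: algebra_simps)
  qed
  define \<kappa> where "\<kappa> = \<epsilon> * ?\<Delta> / ?\<delta>"
  have cancel: "\<epsilon> * det5 x v w ?p ?q = \<epsilon> * det5 x v w (e 3) (e 4) / ?\<delta>" for v w
    using \<delta> d[of v w] by simp
  show ?thesis
  proof (rule that)
    show "\<kappa> > 0" unfolding \<kappa>_def using orientation \<delta> by simp
    fix v
    show "normal_rot \<epsilon> x ?p ?q v = \<kappa> *\<^sub>R (lor v (e 2) *\<^sub>R e 1 - lor v (e 1) *\<^sub>R e 2)"
    proof (rule lor_nondegenerate)
      fix w
      have "lor (normal_rot \<epsilon> x ?p ?q v) w = \<epsilon> * det5 x v w (e 3) (e 4) / ?\<delta>"
        by (rule trans[OF lor_normal_rot cancel])
      also have "\<dots> = \<kappa> * (lor v (e 2) * lor w (e 1) - lor v (e 1) * lor w (e 2))"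
        unfolding D[of v w] \<kappa>_def by simp
      finally show "lor (normal_rot \<epsilon> x ?p ?q v) w = lor (\<kappa> *\<^sub>R (lor v (e 2) *\<^sub>R e 1 - lor v (e 1) *\<^sub>R e 2)) w"
        by (simp add: lor.scaleR_left lor.diff_left lor_commute[of w])
    qed
  qed
qed

lemma null_vector: "lor (e 1 + e 2) (e 1 + e 2) = 0" "e 1 + e 2 \<noteq> 0" "(e 1 + e 2) $ 1 \<noteq> 0"
proof -
  show 1: "lor (e 1 + e 2) (e 1 + e 2) = 0" by (simp add: lor.add_left lor.add_right lor_frame del: One_nat_def)
  have "lor (e 1 + e 2) (e 2) = 1" by (simp add: lor.add_left lor_frame del: One_nat_def)
  then show 2: "e 1 + e 2 \<noteq> 0" using lor.zero_left[of "e 2"] by (metis zero_neq_one)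
  show "(e 1 + e 2) $ 1 \<noteq> 0" by (rule null_first_component[OF 1 2])
qed

lemma range_L: "range L = {s *\<^sub>R e 3 + t *\<^sub>R e 4 | s t. True}"
proof -
  obtain a b where ab: "e 3 = L a" "e 4 = L b" and "det (vector [a, b] :: real^2^2) > 0"
    using fr unfolding adapted_frame_def by blast
  then have \<delta>: "a$1 * b$2 - a$2 * b$1 > 0" (is "?\<delta> > 0") by (simp add: det_2)
  have "L v \<in> {s *\<^sub>R e 3 + t *\<^sub>R e 4 | s t. True}" for v
  proof -
    define i where "i = inverse ?\<delta>"
    have i: "?\<delta> * i = 1" using \<delta> by (simp add: i_def)
    have "v = ((v$1 * b$2 - v$2 * b$1) * i) *\<^sub>R a + ((a$1 * v$2 - a$2 * v$1) * i) *\<^sub>R b"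
      unfolding vec_eq_iff forall_2 using i by (simp, algebra)
    then have "L v = ((v$1 * b$2 - v$2 * b$1) * i) *\<^sub>R e 3 + ((a$1 * v$2 - a$2 * v$1) * i) *\<^sub>R e 4"
      unfolding ab by (metis linear_add[OF lin] linear_scale[OF lin])
    then show ?thesis by blast
  qed
  moreover have "s *\<^sub>R e 3 + t *\<^sub>R e 4 \<in> range L" for s t
    unfolding ab by (metis linear_add[OF lin] linear_scale[OF lin] rangeI)
  ultimately show ?thesis by auto
qed

lemma orthogonal_tangent: "lor (e 1 + e 2) x = 0" "lor (e 1 + e 2) (L v) = 0"
proof -
  show "lor (e 1 + e 2) x = 0" by (simp add: lor.add_left lor_frame del: One_nat_def)
  have "L v \<in> {s *\<^sub>R e 3 + t *\<^sub>R e 4 | s t. True}" using range_L by blast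
  then show "lor (e 1 + e 2) (L v) = 0"
    by (auto simp: lor.add_left lor.add_right lor.scaleR_right lor_frame simp del: One_nat_def)
qed

text \<open>A null line in a Lorentzian plane is its own orthogonal complement.\<close>

lemma parallel_null_vector:
  assumes "lor v x = 0" "\<And>w. lor v (L w) = 0" "lor v (e 1 + e 2) = 0"
  shows "v = lor v (e 2) *\<^sub>R (e 1 + e 2)"
proof -
  obtain a b where ab: "e 3 = L a" "e 4 = L b" using fr unfolding adapted_frame_def by blast
  have "lor v (e 1) = - lor v (e 2)" using assms(3) by (simp add: lor.add_right del: One_nat_def)
  then show ?thesis
    using expansion[of v] assms(1,2) ab by (simp add: algebra_simps del: One_nat_def)
qed

end

section \<open>The null direction in a coordinate patch\<close>

lemma C_k_prod_finite:
  fixes f :: "'i \<Rightarrow> 'a::real_normed_vector \<Rightarrow> real"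
  assumes "open W" "finite I" "\<And>i. i \<in> I \<Longrightarrow> C_k k (f i) W"
  shows "C_k k (\<lambda>x. \<Prod>i\<in>I. f i x) W"
  using assms(2,3)
  by (induction I rule: finite_induct) (auto simp: C_k_const intro: C_k_mult[OF assms(1)])

lemma C_k_det:
  fixes M :: "'a::real_normed_vector \<Rightarrow> real^'n^'n"
  assumes "open W" "\<And>i j. C_k k (\<lambda>x. M x $ i $ j) W"
  shows "C_k k (\<lambda>x. det (M x)) W"
  unfolding det_def
  by (intro C_k_sum[OF assms(1)] C_k_mult[OF assms(1)] C_k_const C_k_prod_finite[OF assms(1)] assms(2))
    (simp_all add: finite_permutations)

lemma C_k_normal_rot:
  assumes "open W" "C_k k X W" "C_k k p W" "C_k k q W" "C_k k v W"
  shows "C_k k (\<lambda>z. normal_rot \<epsilon> (X z) (p z) (q z) (v z)) W"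
proof (rule C_k_vec[OF assms(1)])
  fix l :: 5
  note comp = C_k_linear_comp[OF assms(1) bounded_linear_vec_nth]
  have "\<forall>i::5. C_k k (\<lambda>z. vector [X z, v z, axis l 1, p z, q z] $ i $ j) W" for j :: 5
    using comp[OF assms(2)] comp[OF assms(3)] comp[OF assms(4)] comp[OF assms(5)]
    unfolding forall_5 by (simp add: C_k_const)
  then have "C_k k (\<lambda>z. det5 (X z) (v z) (axis l 1) (p z) (q z)) W"
    by (intro C_k_det[OF assms(1)]) blast
  then show "C_k k (\<lambda>z. normal_rot \<epsilon> (X z) (p z) (q z) (v z) $ l) W"
    unfolding normal_rot_def vec_lambda_beta by (intro C_k_mult[OF assms(1)] C_k_const)
qed

lemma has_derivative_locally_const:
  assumes "(h has_derivative h') (at z)" "open S" "z \<in> S" "\<And>x. x \<in> S \<Longrightarrow> h x = c"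
  shows "h' v = 0"
proof -
  have "(h has_derivative (\<lambda>_. 0)) (at z)"
    by (rule has_derivative_transform_within_open[OF has_derivative_const[of c] assms(2,3)]) (simp add: assms(4))
  from has_derivative_unique[OF assms(1) this] show ?thesis by simp
qed

text \<open>The heart of the matter: the null normal \<open>P\<close>, normalised to first coordinate \<open>1\<close>, has derivative zero.
  Its derivative is orthogonal to \<open>X\<close>, to the tangent plane (here the hypothesis on the second derivatives of \<open>X\<close>
  enters) and to \<open>P\<close>, hence is a multiple of \<open>P\<close>; its first coordinate is \<open>0\<close>, so the multiple is zero.

  Darboux frames are given at each point separately.  A differentiable choice of \<open>P\<close> is obtained
  from the operator \<open>K = normal_rot\<close>: on the normal plane \<open>K\<^sup>2 = \<kappa>\<^sup>2\<close>, so for a normal vector \<open>m\<close> the vector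
  \<open>K m + \<kappa> m\<close> lies in the eigenline of \<open>\<kappa>\<close>.  The number \<open>\<kappa>\<close> depends on the point; as \<open>K\<close> is \<open>\<kappa>\<close> times
  an anti-isometry of the normal plane, \<open>\<kappa>\<^sup>2 = - \<langle>K m, K m\<rangle> / \<langle>m, m\<rangle>\<close>.\<close>

lemma null_direction_locally_constant:
  fixes X :: "real^2 \<Rightarrow> real^5"
  assumes W: "open W" and X: "\<And>k. C_k k X W" and z0: "z0 \<in> W"
    and S: "\<And>z. z \<in> W \<Longrightarrow> lor (X z) (X z) = 1"
    and fr: "\<And>z. z \<in> W \<Longrightarrow> \<exists>e. adapted_frame \<epsilon> (X z) (frechet_derivative X (at z)) e"
    and iso: "\<And>z v w. z \<in> W \<Longrightarrow> \<exists>s e. adapted_frame \<epsilon> (X z) (frechet_derivative X (at z)) e \<and>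
       frechet_derivative (\<lambda>z. frechet_derivative X (at z) w) (at z) v - s *\<^sub>R (e 1 + e 2)
         \<in> span (insert (X z) (range (frechet_derivative X (at z))))"
  obtains r n where "r > 0" "ball z0 r \<subseteq> W" "n $ 1 = 1"
    "\<And>z e. z \<in> ball z0 r \<Longrightarrow> adapted_frame \<epsilon> (X z) (frechet_derivative X (at z)) e \<Longrightarrow>
        e 1 + e 2 = (e 1 + e 2) $ 1 *\<^sub>R n"
proof -
  let ?D = "\<lambda>z. frechet_derivative X (at z)"
  have XD: "(X has_derivative ?D z) (at z)" if "z \<in> W" for z by (rule C_k_SucE[OF X that])
  have XDD: "((\<lambda>z. ?D z w) has_derivative frechet_derivative (\<lambda>z. ?D z w) (at z)) (at z)"
    if "z \<in> W" for z w
    using C_k_SucE[of 0 "\<lambda>z. ?D z w" W z] X[of "Suc (Suc 0)"] that by auto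
  have loc: "frame_S41 \<epsilon> (X z) (?D z) e" if "z \<in> W" "adapted_frame \<epsilon> (X z) (?D z) e" for z e
    using that S has_derivative_linear[OF XD[OF that(1)]] by (intro frame_S41.intro) auto
  define K where "K z v = normal_rot \<epsilon> (X z) (?D z (axis 1 1)) (?D z (axis 2 1)) v" for z v
  have K_smooth: "C_k k (\<lambda>z. K z (v z)) W" if "C_k k v W" for k v
    unfolding K_def using X[of "Suc k"] that by (intro C_k_normal_rot[OF W] X) auto
  obtain e0 where e0: "adapted_frame \<epsilon> (X z0) (?D z0) e0" using fr[OF z0] by blast
  \<comment> \<open>at \<open>z0\<close> this vector is a positive multiple of the timelike \<open>e0 1\<close>, so it stays timelike nearby\<close>
  define m where "m z = K z (e0 2)" for z
  define g where "g z = K z (m z)" for z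
  have m: "C_k k m W" for k unfolding m_def by (intro K_smooth C_k_const)
  have g: "C_k k g W" for k unfolding g_def by (intro K_smooth m)
  define \<mu> where "\<mu> z = lor (m z) (m z)" for z
  have \<mu>: "C_k k \<mu> W" for k unfolding \<mu>_def by (intro lor.C_k_prod[OF W] m)
  define N where "N z = g z + sqrt (- lor (g z) (g z) / \<mu> z) *\<^sub>R m z" for z
  have coord: "\<exists>\<kappa>>0. m z = \<kappa> *\<^sub>R (lor (e0 2) (e 2) *\<^sub>R e 1 - lor (e0 2) (e 1) *\<^sub>R e 2) \<and>
      g z = \<kappa> *\<^sub>R (lor (m z) (e 2) *\<^sub>R e 1 - lor (m z) (e 1) *\<^sub>R e 2)"
    if "z \<in> W" "adapted_frame \<epsilon> (X z) (?D z) e" for z e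
    using frame_S41.normal_rot_frame[OF loc[OF that]] unfolding m_def g_def K_def by metis
  have "\<mu> z0 < 0"
  proof -
    interpret frame_S41 \<epsilon> "X z0" "?D z0" e0 by (rule loc[OF z0 e0])
    obtain \<kappa> where "\<kappa> > 0" "m z0 = \<kappa> *\<^sub>R (lor (e0 2) (e0 2) *\<^sub>R e0 1 - lor (e0 2) (e0 1) *\<^sub>R e0 2)"
      using coord[OF z0 e0] by blast
    then show ?thesis
      unfolding \<mu>_def by (simp add: lor_frame lor.scaleR_left lor.scaleR_right del: One_nat_def)
  qed
  have "open (W \<inter> \<mu> -` {..<0})"
    by (rule continuous_open_preimage[OF C_k_continuous[OF \<mu>[of 0]] W]) simp
  then obtain r where r: "r > 0" "ball z0 r \<subseteq> W \<inter> \<mu> -` {..<0}"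
    using z0 \<open>\<mu> z0 < 0\<close> open_contains_ball by (metis IntI lessThan_iff vimageI)
  have N_frame: "- lor (g z) (g z) / \<mu> z > 0 \<and> (\<exists>t. t \<noteq> 0 \<and> N z = t *\<^sub>R (e 1 + e 2))"
    if z: "z \<in> ball z0 r" and e: "adapted_frame \<epsilon> (X z) (?D z) e" for z e
  proof -
    have zW: "z \<in> W" and neg: "\<mu> z < 0" using z r by auto
    interpret frame_S41 \<epsilon> "X z" "?D z" e by (rule loc[OF zW e])
    obtain \<kappa> where \<kappa>: "\<kappa> > 0" "m z = \<kappa> *\<^sub>R (lor (e0 2) (e 2) *\<^sub>R e 1 - lor (e0 2) (e 1) *\<^sub>R e 2)"
      and gz: "g z = \<kappa> *\<^sub>R (lor (m z) (e 2) *\<^sub>R e 1 - lor (m z) (e 1) *\<^sub>R e 2)"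
      using coord[OF zW e] by blast
    define \<alpha> \<beta> where "\<alpha> = \<kappa> * lor (e0 2) (e 2)" and "\<beta> = - \<kappa> * lor (e0 2) (e 1)"
    have mz: "m z = \<alpha> *\<^sub>R e 1 + \<beta> *\<^sub>R e 2" using \<kappa>(2) by (simp add: \<alpha>_def \<beta>_def algebra_simps)
    have gz: "g z = \<kappa> *\<^sub>R (\<beta> *\<^sub>R e 1 + \<alpha> *\<^sub>R e 2)"
      unfolding gz mz by (simp add: lor.add_left lor.scaleR_left lor_frame del: One_nat_def)
    have \<mu>z: "\<mu> z = \<beta> * \<beta> - \<alpha> * \<alpha>"
      unfolding \<mu>_def mz by (simp add: lor.add_left lor.add_right lor.scaleR_left lor.scaleR_right lor_frame del: One_nat_def)
    have "lor (g z) (g z) = \<kappa> * \<kappa> * (\<alpha> * \<alpha> - \<beta> * \<beta>)"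
      unfolding gz by (simp add: lor.add_left lor.add_right lor.scaleR_left lor.scaleR_right lor_frame algebra_simps del: One_nat_def)
    then have q: "- lor (g z) (g z) / \<mu> z = \<kappa>\<^sup>2"
      using neg unfolding \<mu>z by (simp add: power2_eq_square field_simps)
    have "\<alpha> + \<beta> \<noteq> 0"
    proof
      assume "\<alpha> + \<beta> = 0"
      then have "\<beta> = - \<alpha>" by simp
      then show False using neg \<mu>z by simp
    qed
    moreover have "N z = (\<kappa> * (\<alpha> + \<beta>)) *\<^sub>R (e 1 + e 2)"
      unfolding N_def q using \<kappa>(1) by (simp add: mz gz algebra_simps)
    ultimately show ?thesis using \<kappa>(1) q by (metis mult_eq_0_iff less_irrefl zero_less_power)
  qed
  define P where "P z = inverse (N z $ 1) *\<^sub>R N z" for z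
  have P_frame: "e 1 + e 2 = (e 1 + e 2) $ 1 *\<^sub>R P z" "(e 1 + e 2) $ 1 \<noteq> 0" "N z $ 1 \<noteq> 0"
    if z: "z \<in> ball z0 r" and e: "adapted_frame \<epsilon> (X z) (?D z) e" for z e
  proof -
    have zW: "z \<in> W" using z r by auto
    obtain t where t: "t \<noteq> 0" "N z = t *\<^sub>R (e 1 + e 2)" using N_frame[OF z e] by blast
    show ne: "(e 1 + e 2) $ 1 \<noteq> 0" by (rule frame_S41.null_vector(3)[OF loc[OF zW e]])
    have N1: "N z $ 1 = t * (e 1 + e 2) $ 1" unfolding t(2) by (simp only: vector_scaleR_component real_scaleR_def)
    then show "N z $ 1 \<noteq> 0" using t(1) ne by (metis mult_eq_0_iff)
    show "e 1 + e 2 = (e 1 + e 2) $ 1 *\<^sub>R P z"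
      unfolding P_def N1 unfolding t(2) scaleR_scaleR using t(1) ne
      by (simp add: divide_inverse[symmetric] del: vector_add_component)
  qed
  have P_diff: "P differentiable (at z)" if z: "z \<in> ball z0 r" for z
  proof -
    have zW: "z \<in> W" using z r by auto
    obtain e where e: "adapted_frame \<epsilon> (X z) (?D z) e" using fr[OF zW] by blast
    have d: "m differentiable (at z)" "g differentiable (at z)" "\<mu> differentiable (at z)"
      "(\<lambda>z. lor (g z) (g z)) differentiable (at z)"
      using m[of "Suc 0"] g[of "Suc 0"] \<mu>[of "Suc 0"] lor.C_k_prod[OF W g[of "Suc 0"] g[of "Suc 0"]] zW by auto
    have "\<mu> z \<noteq> 0" using z r by auto
    then have q: "(\<lambda>z. - lor (g z) (g z) / \<mu> z) differentiable (at z)"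
      by (intro differentiable_divide differentiable_minus d)
    have "sqrt differentiable (at (- lor (g z) (g z) / \<mu> z))"
      using DERIV_real_sqrt N_frame[OF z e] real_differentiable_def by blast
    then have "(sqrt \<circ> (\<lambda>z. - lor (g z) (g z) / \<mu> z)) differentiable (at z)"
      by (intro differentiable_chain_at q)
    then have "(\<lambda>z. sqrt (- lor (g z) (g z) / \<mu> z)) differentiable (at z)" by (simp add: o_def)
    then have N: "N differentiable (at z)" unfolding N_def[abs_def]
      by (intro differentiable_add differentiable_scaleR d)
    then have "(\<lambda>z. N z $ 1) differentiable (at z)"
      using bounded_linear.has_derivative[OF bounded_linear_vec_nth] unfolding differentiable_def by blast
    then have "(\<lambda>z. inverse (N z $ 1)) differentiable (at z)"
      using P_frame(3)[OF z e] by (intro differentiable_inverse)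
    then show ?thesis unfolding P_def[abs_def] by (intro differentiable_scaleR N)
  qed
  have P_props: "lor (P z) (P z) = 0" "lor (P z) (X z) = 0" "lor (P z) (?D z w) = 0" "P z $ 1 = 1"
    if z: "z \<in> ball z0 r" for z w
  proof -
    have zW: "z \<in> W" using z r by auto
    obtain e where e: "adapted_frame \<epsilon> (X z) (?D z) e" using fr[OF zW] by blast
    interpret frame_S41 \<epsilon> "X z" "?D z" e by (rule loc[OF zW e])
    have P: "P z = inverse ((e 1 + e 2) $ 1) *\<^sub>R (e 1 + e 2)"
    proof -
      have "inverse ((e 1 + e 2) $ 1) *\<^sub>R (e 1 + e 2) = inverse ((e 1 + e 2) $ 1) *\<^sub>R ((e 1 + e 2) $ 1 *\<^sub>R P z)"
        by (rule arg_cong[OF P_frame(1)[OF z e]])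
      also have "\<dots> = P z" using P_frame(2)[OF z e] by (simp del: vector_add_component)
      finally show ?thesis by simp
    qed
    show "lor (P z) (P z) = 0" "lor (P z) (X z) = 0" "lor (P z) (?D z w) = 0"
      unfolding P lor.scaleR_left lor.scaleR_right null_vector(1) orthogonal_tangent by simp_all
    show "P z $ 1 = 1" using P_frame(3)[OF z e] by (simp add: P_def)
  qed
  have P_const: "(P has_derivative (\<lambda>_. 0)) (at z)" if z: "z \<in> ball z0 r" for z
  proof -
    have zW: "z \<in> W" using z r by auto
    obtain P' where P': "(P has_derivative P') (at z)" using P_diff[OF z] unfolding differentiable_def by blast
    obtain e where e: "adapted_frame \<epsilon> (X z) (?D z) e" using fr[OF zW] by blast
    interpret frame_S41 \<epsilon> "X z" "?D z" e by (rule loc[OF zW e])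
    note const = has_derivative_locally_const[OF _ open_ball z]
    have "P' v = 0" for v
    proof -
      have "P' v $ 1 = 0"
        by (rule const[OF bounded_linear.has_derivative[OF bounded_linear_vec_nth P']]) (rule P_props(4))
      have "lor (P z) (?D z v) + lor (P' v) (X z) = 0"
        by (rule const[OF lor.FDERIV[OF P' XD[OF zW]]]) (rule P_props(2))
      then have 1: "lor (P' v) (X z) = 0" using P_props(3)[OF z] by simp
      have "lor (P z) (P' v) + lor (P' v) (P z) = 0"
        by (rule const[OF lor.FDERIV[OF P' P']]) (rule P_props(1))
      then have 2: "lor (P' v) (P z) = 0" by (simp add: lor_commute[of "P z"])
      have 3: "lor (P' v) (?D z w) = 0" for w
      proof -
        let ?H = "frechet_derivative (\<lambda>z. ?D z w) (at z) v"
        have H: "lor (P z) ?H + lor (P' v) (?D z w) = 0"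
          by (rule const[OF lor.FDERIV[OF P' XDD[OF zW]]]) (rule P_props(3))
        obtain s e' where e': "adapted_frame \<epsilon> (X z) (?D z) e'"
          and sp: "?H - s *\<^sub>R (e' 1 + e' 2) \<in> span (insert (X z) (range (?D z)))"
          using iso[OF zW] by blast
        have "lor (P z) u = 0" if "u \<in> span (insert (X z) (range (?D z)))" for u
          using that
        proof (induction rule: span_induct_alt)
          case base
          then show ?case by (simp add: lor.zero_right)
        next
          case (step c x y)
          then show ?case using P_props(2,3)[OF z] by (auto simp: lor.add_right lor.scaleR_right)
        qed
        from this[OF sp] have "lor (P z) ?H = s * lor (P z) (e' 1 + e' 2)"
          by (simp only: lor.diff_right lor.scaleR_right real_scaleR_def right_minus_eq)
        moreover have "lor (P z) (e' 1 + e' 2) = 0"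
          by (subst P_frame(1)[OF z e']) (simp only: lor.scaleR_right P_props(1)[OF z], simp)
        ultimately show ?thesis using H by simp
      qed
      have "lor (P' v) (e 1 + e 2) = 0"
        by (subst P_frame(1)[OF z e]) (simp only: lor.scaleR_right 2, simp)
      then obtain t where t: "P' v = t *\<^sub>R (e 1 + e 2)" using parallel_null_vector[OF 1 3] by blast
      then have "t * (e 1 + e 2) $ 1 = 0" using \<open>P' v $ 1 = 0\<close> by (metis vector_scaleR_component real_scaleR_def)
      then show ?thesis using t null_vector(3) by (metis mult_eq_0_iff scaleR_zero_left)
    qed
    then have "P' = (\<lambda>_. 0)" by auto
    with P' show ?thesis by simp
  qed
  have "\<exists>c. \<forall>z\<in>ball z0 r. P z = c"
    by (rule has_derivative_zero_constant[OF convex_ball]) (rule has_derivative_at_withinI[OF P_const])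
  then obtain n where n: "\<And>z. z \<in> ball z0 r \<Longrightarrow> P z = n" by blast
  show ?thesis
  proof (rule that[of r n])
    show "n $ 1 = 1" using P_props(4)[of z0] n[of z0] r by simp
    show "e 1 + e 2 = (e 1 + e 2) $ 1 *\<^sub>R n"
      if "z \<in> ball z0 r" "adapted_frame \<epsilon> (X z) (?D z) e" for z e
      using P_frame(1)[OF that] unfolding n[OF that(1)] .
  qed (use r in auto)
qed

section \<open>Surfaces and their charts\<close>

definition smooth_in_charts :: "'a chart set \<Rightarrow> ('a \<Rightarrow> 'b::real_normed_vector) \<Rightarrow> bool" where
  "smooth_in_charts \<A> g \<longleftrightarrow> (\<forall>(U, \<phi>)\<in>\<A>. smooth_on (\<phi> ` U) (g \<circ> inv_into U \<phi>))"

lemma differential_eq: "differential (U, \<phi>) g p = frechet_derivative (g \<circ> inv_into U \<phi>) (at (\<phi> p))"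
  by (simp add: fun_eq_iff differential_def)

locale surface =
  fixes \<A> :: "'a::{t2_space, second_countable_topology} chart set"
  assumes surf: "oriented_surface \<A>"
begin

abbreviation M where "M \<equiv> carrier_of \<A>"

lemma connected_M: "connected M" and M_nonempty: "M \<noteq> {}"
  using surf unfolding oriented_surface_def by auto

lemma chart_at:
  assumes "p \<in> M"
  obtains U \<phi> where "(U, \<phi>) \<in> \<A>" "p \<in> U"
  using assms unfolding carrier_of_def by auto

lemma chart_subset: "(U, \<phi>) \<in> \<A> \<Longrightarrow> U \<subseteq> M"
  unfolding carrier_of_def by auto

lemma chart_open: "(U, \<phi>) \<in> \<A> \<Longrightarrow> open U" "(U, \<phi>) \<in> \<A> \<Longrightarrow> open (\<phi> ` U)"
  and chart_homeomorphism: "(U, \<phi>) \<in> \<A> \<Longrightarrow> homeomorphism U (\<phi> ` U) \<phi> (inv_into U \<phi>)"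
  using surf unfolding oriented_surface_def by auto

lemma open_M: "open M"
  unfolding carrier_of_def using chart_open by (intro open_UN) auto

lemma inv_chart:
  assumes "(U, \<phi>) \<in> \<A>" "p \<in> U" shows "inv_into U \<phi> (\<phi> p) = p"
  using chart_homeomorphism[OF assms(1)] assms(2) by (simp add: homeomorphism_def)

lemma chart_inv:
  assumes "z \<in> \<phi> ` U" shows "\<phi> (inv_into U \<phi> z) = z" "inv_into U \<phi> z \<in> U"
  using assms by (simp_all add: f_inv_into_f inv_into_into)

lemma chart_image_open:
  assumes "(U, \<phi>) \<in> \<A>" "open V" shows "open (\<phi> ` (U \<inter> V))"
proof -
  have "openin (top_of_set (\<phi> ` U)) (\<phi> ` (U \<inter> V))"
    by (rule homeomorphism_imp_open_map[OF chart_homeomorphism[OF assms(1)]]) (use assms in auto)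
  then show ?thesis using chart_open(2)[OF assms(1)] openin_open_trans by blast
qed

lemma transition_smooth:
  assumes "(U, \<phi>) \<in> \<A>" "(V, \<psi>) \<in> \<A>"
  shows "C_k k (\<psi> \<circ> inv_into U \<phi>) (\<phi> ` (U \<inter> V))"
proof -
  have "smooth_on (\<phi> ` (U \<inter> V)) (\<psi> \<circ> inv_into U \<phi>)"
    using surf assms unfolding oriented_surface_def by fast
  then show ?thesis
    using smooth_on_open_iff chart_image_open[OF assms(1) chart_open(1)[OF assms(2)]] by blast
qed

lemma transition_det:
  assumes "(U, \<phi>) \<in> \<A>" "(V, \<psi>) \<in> \<A>" "p \<in> U" "p \<in> V"
  shows "det (matrix (frechet_derivative (\<psi> \<circ> inv_into U \<phi>) (at (\<phi> p)))) > 0"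
  using surf assms unfolding oriented_surface_def by fast

lemma smooth_in_chartsD:
  assumes "smooth_in_charts \<A> g" "(U, \<phi>) \<in> \<A>"
  shows "C_k k (g \<circ> inv_into U \<phi>) (\<phi> ` U)"
  using assms smooth_on_open_iff[OF chart_open(2)[OF assms(2)]] unfolding smooth_in_charts_def by blast

lemma differential_has_derivative:
  assumes "smooth_in_charts \<A> g" "(U, \<phi>) \<in> \<A>" "p \<in> U"
  shows "(g \<circ> inv_into U \<phi> has_derivative differential (U, \<phi>) g p) (at (\<phi> p))"
  using C_k_SucE[OF smooth_in_chartsD[OF assms(1,2), of "Suc 0"], of "\<phi> p"] assms(3)
  by (simp add: differential_eq)

lemma linear_differential:
  assumes "smooth_in_charts \<A> g" "(U, \<phi>) \<in> \<A>" "p \<in> U"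
  shows "linear (differential (U, \<phi>) g p)"
  by (rule has_derivative_linear[OF differential_has_derivative[OF assms]])

text \<open>The chain rule for \<open>g \<circ> \<phi>\<^sup>-\<^sup>1 = (g \<circ> \<psi>\<^sup>-\<^sup>1) \<circ> (\<psi> \<circ> \<phi>\<^sup>-\<^sup>1)\<close>.\<close>

lemma differential_change_chart:
  assumes g: "smooth_in_charts \<A> g" and c: "(U, \<phi>) \<in> \<A>" "(V, \<psi>) \<in> \<A>" and p: "p \<in> U" "p \<in> V"
  shows "differential (U, \<phi>) g p v =
    differential (V, \<psi>) g p (frechet_derivative (\<psi> \<circ> inv_into U \<phi>) (at (\<phi> p)) v)"
proof -
  let ?T = "\<psi> \<circ> inv_into U \<phi>"
  have o: "open (\<phi> ` (U \<inter> V))" by (rule chart_image_open[OF c(1) chart_open(1)[OF c(2)]])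
  have Tp: "?T (\<phi> p) = \<psi> p" using inv_chart[OF c(1) p(1)] by simp
  have "(?T has_derivative frechet_derivative ?T (at (\<phi> p))) (at (\<phi> p))"
    by (rule C_k_SucE[OF transition_smooth[OF c, of "Suc 0"]]) (use p in auto)
  moreover have "(g \<circ> inv_into V \<psi> has_derivative differential (V, \<psi>) g p) (at (?T (\<phi> p)))"
    unfolding Tp by (rule differential_has_derivative[OF g c(2) p(2)])
  ultimately have "((g \<circ> inv_into V \<psi>) \<circ> ?T has_derivative
      differential (V, \<psi>) g p \<circ> frechet_derivative ?T (at (\<phi> p))) (at (\<phi> p))"
    by (rule diff_chain_at)
  then have "(g \<circ> inv_into U \<phi> has_derivative
      differential (V, \<psi>) g p \<circ> frechet_derivative ?T (at (\<phi> p))) (at (\<phi> p))"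
    by (rule has_derivative_transform_within_open[OF _ o])
      (use p inv_chart[OF c(1)] inv_chart[OF c(2)] in auto)
  from has_derivative_unique[OF differential_has_derivative[OF g c(1) p(1)] this]
  show ?thesis by simp
qed

end

lemma det_vector2_linear:
  assumes "linear T"
  shows "det (vector [T a, T b] :: real^2^2) = det (matrix T) * det (vector [a, b] :: real^2^2)"
proof -
  have "T v $ i = v$1 * matrix T $ i $ 1 + v$2 * matrix T $ i $ 2" for v i
    using linear_real2[OF assms, of v] by (simp add: matrix_def)
  then show ?thesis by (simp add: det_2 algebra_simps)
qed

locale immersed_surface = surface \<A> for \<A> :: "'a::{t2_space, second_countable_topology} chart set" +
  fixes f :: "'a \<Rightarrow> real^5"
  assumes imm: "spacelike_immersion \<A> f"
begin

lemma f_S41: "p \<in> M \<Longrightarrow> lor (f p) (f p) = 1"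
  using imm unfolding spacelike_immersion_def S41_def by auto

lemma f_smooth: "smooth_in_charts \<A> f"
  using imm unfolding spacelike_immersion_def smooth_in_charts_def by auto

lemma f_spacelike:
  assumes "(U, \<phi>) \<in> \<A>" "p \<in> U" "v \<noteq> 0"
  shows "lor (differential (U, \<phi>) f p v) (differential (U, \<phi>) f p v) > 0"
  using imm assms unfolding spacelike_immersion_def by auto

lemma frame_S41_if_darboux:
  assumes "(U, \<phi>) \<in> \<A>" "p \<in> U" "darboux_frame \<epsilon> (U, \<phi>) f p e"
  shows "frame_S41 \<epsilon> (f p) (differential (U, \<phi>) f p) e"
proof (rule frame_S41.intro)
  show "lor (f p) (f p) = 1" using assms chart_subset f_S41 by blast
qed (use assms linear_differential[OF f_smooth] in \<open>auto simp: darboux_frame_eq\<close>)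

text \<open>Positive Jacobians of the transition maps are what makes the distinguished null line independent of the
  chart.\<close>

lemma darboux_frame_change_chart:
  assumes c: "(U, \<phi>) \<in> \<A>" "(V, \<psi>) \<in> \<A>" and p: "p \<in> U" "p \<in> V"
    and e: "darboux_frame \<epsilon> (U, \<phi>) f p e"
  shows "darboux_frame \<epsilon> (V, \<psi>) f p e"
proof -
  let ?T = "frechet_derivative (\<psi> \<circ> inv_into U \<phi>) (at (\<phi> p))"
  obtain a b where ab: "e 3 = differential (U, \<phi>) f p a" "e 4 = differential (U, \<phi>) f p b"
    "det (vector [a, b] :: real^2^2) > 0"
    using e unfolding darboux_frame_def by blast
  have "linear ?T"
    by (rule has_derivative_linear[OF C_k_SucE[OF transition_smooth[OF c, of "Suc 0"]]]) (use p in auto)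
  then have "det (vector [?T a, ?T b] :: real^2^2) > 0"
    using ab(3) transition_det[OF c p] by (simp add: det_vector2_linear)
  moreover have "e 3 = differential (V, \<psi>) f p (?T a)" "e 4 = differential (V, \<psi>) f p (?T b)"
    using ab differential_change_chart[OF f_smooth c p] by simp_all
  ultimately show ?thesis using e unfolding darboux_frame_def by blast
qed

end

text \<open>The definite description in the definition of the second fundamental form has to be unfolded through the
  following orthogonal decomposition.\<close>

context frame_S41
begin

lemma second_form_unique:
  "\<exists>!\<xi>. \<xi> \<in> {\<xi> \<in> tangent_S41 x. \<forall>v. lor (L v) \<xi> = 0} \<and> H - \<xi> \<in> span (insert x (range L))"
proof (rule ex1I)
  let ?\<xi> = "lor H (e 2) *\<^sub>R e 2 - lor H (e 1) *\<^sub>R e 1"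
  have e34: "e 3 \<in> range L" "e 4 \<in> range L" using fr unfolding adapted_frame_def by auto
  have normal: "lor (e 1) (L v) = 0" "lor (e 2) (L v) = 0" for v
  proof -
    have "L v \<in> {s *\<^sub>R e 3 + t *\<^sub>R e 4 | s t. True}" using range_L by blast
    then show "lor (e 1) (L v) = 0" "lor (e 2) (L v) = 0"
      by (auto simp: lor.add_right lor.scaleR_right lor_frame simp del: One_nat_def)
  qed
  have "H - ?\<xi> = lor H x *\<^sub>R x + lor H (e 3) *\<^sub>R e 3 + lor H (e 4) *\<^sub>R e 4"
    using expansion[of H] by (simp add: algebra_simps)
  moreover have "\<dots> \<in> span (insert x (range L))"
    using e34 by (intro span_add span_scale) (auto intro: span_base)
  ultimately have "H - ?\<xi> \<in> span (insert x (range L))" by simp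
  then show "?\<xi> \<in> {\<xi> \<in> tangent_S41 x. \<forall>v. lor (L v) \<xi> = 0} \<and> H - ?\<xi> \<in> span (insert x (range L))"
    using normal
    by (auto simp: tangent_S41_def lor.diff_right lor.scaleR_right lor_frame lor.diff_left lor.scaleR_left
        lor_commute[of "L _"] simp del: One_nat_def)
  fix \<xi> assume \<xi>: "\<xi> \<in> {\<xi> \<in> tangent_S41 x. \<forall>v. lor (L v) \<xi> = 0} \<and> H - \<xi> \<in> span (insert x (range L))"
  have "(H - \<xi>) - (H - ?\<xi>) = ?\<xi> - \<xi>" by simp
  then have sp: "?\<xi> - \<xi> \<in> span (insert x (range L))"
    using span_diff[OF conjunct2[OF \<xi>] \<open>H - ?\<xi> \<in> _\<close>] by simp
  have "lor u (e 1) = 0 \<and> lor u (e 2) = 0" if "u \<in> span (insert x (range L))" for u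
    using that
  proof (induction rule: span_induct_alt)
    case base
    then show ?case by (simp add: lor.zero_left)
  next
    case (step c y z)
    then show ?case using normal
      by (auto simp: lor.add_left lor.scaleR_left lor_frame lor_commute[of "L _"] simp del: One_nat_def)
  qed
  note n12 = this[OF sp]
  have t: "lor \<xi> x = 0" "lor \<xi> (e 3) = 0" "lor \<xi> (e 4) = 0"
    using \<xi> e34 by (auto simp: tangent_S41_def lor_commute[of \<xi>])
  have "lor (?\<xi> - \<xi>) x = 0" "lor (?\<xi> - \<xi>) (e 3) = 0" "lor (?\<xi> - \<xi>) (e 4) = 0"
    by (simp_all add: lor.diff_left lor.scaleR_left lor_frame t del: One_nat_def)
  with n12 have "?\<xi> - \<xi> = 0"
    using expansion[of "?\<xi> - \<xi>"] by (simp only: scaleR_zero_left diff_0_right add_0_right)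
  then show "\<xi> = ?\<xi>" by simp
qed

end

lemma (in immersed_surface) second_fundamental_form_remainder:
  assumes c: "(U, \<phi>) \<in> \<A>" and p: "p \<in> U" and e: "darboux_frame \<epsilon> (U, \<phi>) f p e"
  shows "frechet_derivative (\<lambda>z. frechet_derivative (f \<circ> inv_into U \<phi>) (at z) w) (at (\<phi> p)) v
     - second_fundamental_form (U, \<phi>) f p v w \<in> span (insert (f p) (range (differential (U, \<phi>) f p)))"
proof -
  interpret frame_S41 \<epsilon> "f p" "differential (U, \<phi>) f p" e by (rule frame_S41_if_darboux[OF assms])
  show ?thesis
    using theI'[OF second_form_unique]
    unfolding second_fundamental_form_def normal_space_def by (simp add: Let_def)
qed


section \<open>The null direction of an isotropic surface\<close>

locale isotropic_surface = immersed_surface \<A> f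
  for \<A> :: "'a::{t2_space, second_countable_topology} chart set" and f +
  fixes \<epsilon> :: real
  assumes iso: "plus_isotropic \<epsilon> \<A> f"
begin

lemma II_null:
  assumes "(U, \<phi>) \<in> \<A>" "p \<in> U"
  obtains s e where "darboux_frame \<epsilon> (U, \<phi>) f p e"
    "second_fundamental_form (U, \<phi>) f p v w = s *\<^sub>R (e 1 + e 2)"
  using iso assms unfolding plus_isotropic_def normal_plus_def by fastforce

text \<open>The normalisation of the first coordinate makes the vector unique, and hence allows local constancy to be
  turned into constancy.  It is possible since nonzero null vectors have nonzero first coordinate.\<close>

definition null_direction :: "'a \<Rightarrow> real^5 \<Rightarrow> bool" where
  "null_direction p n \<longleftrightarrow> n $ 1 = 1 \<and> (\<forall>c\<in>\<A>. \<forall>e. p \<in> fst c \<longrightarrow> darboux_frame \<epsilon> c f p e \<longrightarrow>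
     e 1 + e 2 = (e 1 + e 2) $ 1 *\<^sub>R n)"

lemma null_direction_unique:
  assumes "null_direction p n" "null_direction p m" "p \<in> M" shows "n = m"
proof -
  obtain U \<phi> where c: "(U, \<phi>) \<in> \<A>" "p \<in> U" using chart_at[OF assms(3)] .
  obtain e where e: "darboux_frame \<epsilon> (U, \<phi>) f p e" using II_null[OF c] by metis
  have "(e 1 + e 2) $ 1 \<noteq> 0" by (rule frame_S41.null_vector(3)[OF frame_S41_if_darboux[OF c e]])
  moreover have "e 1 + e 2 = (e 1 + e 2) $ 1 *\<^sub>R n" "e 1 + e 2 = (e 1 + e 2) $ 1 *\<^sub>R m"
    using assms c e unfolding null_direction_def by auto
  ultimately show ?thesis by (metis scaleR_cancel_left)
qed

lemma null_direction_locally: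
  assumes "p \<in> M"
  obtains U n where "open U" "p \<in> U" "\<And>q. q \<in> U \<Longrightarrow> null_direction q n"
proof -
  obtain U \<phi> where c: "(U, \<phi>) \<in> \<A>" "p \<in> U" using chart_at[OF assms] .
  let ?X = "f \<circ> inv_into U \<phi>"
  have point: "inv_into U \<phi> z \<in> U" "\<phi> (inv_into U \<phi> z) = z" if "z \<in> \<phi> ` U" for z
    using chart_inv[OF that] by auto
  have frame: "darboux_frame \<epsilon> (U, \<phi>) f (inv_into U \<phi> z) e \<longleftrightarrow>
      adapted_frame \<epsilon> (?X z) (frechet_derivative ?X (at z)) e" if "z \<in> \<phi> ` U" for z e
    using point(2)[OF that] by (simp add: darboux_frame_eq differential_eq)
  obtain r n where r: "r > 0" "ball (\<phi> p) r \<subseteq> \<phi> ` U" "n $ 1 = 1"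
    "\<And>z e. z \<in> ball (\<phi> p) r \<Longrightarrow> adapted_frame \<epsilon> (?X z) (frechet_derivative ?X (at z)) e \<Longrightarrow>
        e 1 + e 2 = (e 1 + e 2) $ 1 *\<^sub>R n"
  proof (rule null_direction_locally_constant[OF chart_open(2)[OF c(1)] smooth_in_chartsD[OF f_smooth c(1)]])
    show "\<phi> p \<in> \<phi> ` U" using c by auto
    fix z assume z: "z \<in> \<phi> ` U"
    show "lor (?X z) (?X z) = 1" using f_S41 chart_subset[OF c(1)] point[OF z] by auto
    show "\<exists>e. adapted_frame \<epsilon> (?X z) (frechet_derivative ?X (at z)) e"
      using II_null[OF c(1) point(1)[OF z]] frame[OF z] by metis
    fix v w
    obtain s e where e: "darboux_frame \<epsilon> (U, \<phi>) f (inv_into U \<phi> z) e"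
      "second_fundamental_form (U, \<phi>) f (inv_into U \<phi> z) v w = s *\<^sub>R (e 1 + e 2)"
      by (rule II_null[OF c(1) point(1)[OF z]])
    show "\<exists>s e. adapted_frame \<epsilon> (?X z) (frechet_derivative ?X (at z)) e \<and>
       frechet_derivative (\<lambda>z. frechet_derivative ?X (at z) w) (at z) v - s *\<^sub>R (e 1 + e 2)
         \<in> span (insert (?X z) (range (frechet_derivative ?X (at z))))"
    proof (intro exI conjI)
      show "adapted_frame \<epsilon> (?X z) (frechet_derivative ?X (at z)) e" using e(1) frame[OF z] by blast
      show "frechet_derivative (\<lambda>z. frechet_derivative ?X (at z) w) (at z) v - s *\<^sub>R (e 1 + e 2)
         \<in> span (insert (?X z) (range (frechet_derivative ?X (at z))))"
        using second_fundamental_form_remainder[OF c(1) point(1)[OF z] e(1), of w v]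
        unfolding e(2) differential_eq point(2)[OF z] by simp
    qed
  qed blast
  let ?V = "U \<inter> \<phi> -` ball (\<phi> p) r"
  have "open ?V"
    using chart_homeomorphism[OF c(1)] chart_open(1)[OF c(1)]
    by (intro continuous_open_preimage) (auto simp: homeomorphism_def)
  moreover have "null_direction q n" if q: "q \<in> ?V" for q
    unfolding null_direction_def
  proof (intro conjI ballI allI impI)
    fix c' e assume c': "c' \<in> \<A>" "q \<in> fst c'" and e: "darboux_frame \<epsilon> c' f q e"
    obtain V \<psi> where V: "c' = (V, \<psi>)" by fastforce
    have qU: "q \<in> U" using q by simp
    have "darboux_frame \<epsilon> (U, \<phi>) f q e"
      by (rule darboux_frame_change_chart[where U=V and \<phi>=\<psi>]) (use c c' q e V in auto)
    then have "adapted_frame \<epsilon> (?X (\<phi> q)) (frechet_derivative ?X (at (\<phi> q))) e"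
      using frame[of "\<phi> q" e] inv_chart[OF c(1) qU] qU by auto
    then show "e 1 + e 2 = (e 1 + e 2) $ 1 *\<^sub>R n"
      using q by (intro r(4)) simp_all
  qed (rule r(3))
  ultimately show ?thesis using that[of ?V n] c r by auto
qed

lemma constant_null_normal:
  obtains n where "lor n n = 0" "n $ 1 = 1" "\<And>p. p \<in> M \<Longrightarrow> lor n (f p) = 0"
proof -
  define \<nu> where "\<nu> p = (SOME n. null_direction p n)" for p
  have \<nu>: "\<nu> q = n" if "null_direction q n" "q \<in> M" for q n
    using that null_direction_unique someI[of "null_direction q" n] unfolding \<nu>_def by blast
  have nd: "null_direction q (\<nu> q)" if "q \<in> M" for q
    using null_direction_locally[OF that] someI unfolding \<nu>_def by metis
  obtain p0 where p0: "p0 \<in> M" using M_nonempty by blast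
  have const: "\<nu> p = \<nu> p0" if "p \<in> M" for p
  proof (rule connected_local_const[OF connected_M that p0])
    show "\<forall>a\<in>M. eventually (\<lambda>b. \<nu> a = \<nu> b) (at a within M)"
    proof
      fix a assume a: "a \<in> M"
      obtain U n where U: "open U" "a \<in> U" "\<And>q. q \<in> U \<Longrightarrow> null_direction q n"
        by (rule null_direction_locally[OF a]) blast
      then show "eventually (\<lambda>b. \<nu> a = \<nu> b) (at a within M)"
        using \<nu> a unfolding eventually_at_topological by metis
    qed
  qed
  define n where "n = \<nu> p0"
  have n: "lor n n = 0 \<and> lor n (f p) = 0" if p: "p \<in> M" for p
  proof -
    obtain U \<phi> where c: "(U, \<phi>) \<in> \<A>" "p \<in> U" using chart_at[OF p] .
    obtain e where e: "darboux_frame \<epsilon> (U, \<phi>) f p e" using II_null[OF c] by metis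
    interpret frame_S41 \<epsilon> "f p" "differential (U, \<phi>) f p" e by (rule frame_S41_if_darboux[OF c e])
    have e12: "e 1 + e 2 = (e 1 + e 2) $ 1 *\<^sub>R n"
      using nd[OF p] const[OF p] c e unfolding null_direction_def n_def by auto
    define t where "t = (e 1 + e 2) $ 1"
    have t: "t \<noteq> 0" using null_vector(3) unfolding t_def .
    have "lor (e 1 + e 2) (e 1 + e 2) = t * (t * lor n n)" "lor (e 1 + e 2) (f p) = t * lor n (f p)"
      unfolding t_def by (subst (1 2) e12, simp only: lor.scaleR_left lor.scaleR_right real_scaleR_def)
        (subst e12, simp only: lor.scaleR_left real_scaleR_def)
    then show ?thesis using null_vector(1) orthogonal_tangent(1) t by (metis mult_eq_0_iff)
  qed
  show ?thesis
    by (rule that[of n]) (use n p0 nd[OF p0] in \<open>auto simp: n_def null_direction_def\<close>)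
qed

end

section \<open>Normalising the null direction\<close>

text \<open>With \<open>m = (1,1,0,0,0)\<close> the vector \<open>u = n - m\<close> is spacelike if it is not zero, since its first coordinate vanishes,
  and as \<open>n\<close> and \<open>m\<close> are both null the reflection in the hyperplane \<open>u\<^sup>\<bottom>\<close> exchanges them.\<close>

lemma lorentz_reflection:
  assumes n: "lor n n = 0" "n $ 1 = 1"
  obtains \<Phi> where "linear \<Phi>" "\<And>x y. lor (\<Phi> x) (\<Phi> y) = lor x y" "\<And>x. \<Phi> (\<Phi> x) = x"
    "\<And>x. lor n x = 0 \<Longrightarrow> \<Phi> x $ 1 = \<Phi> x $ 2"
proof -
  define m :: "real^5" where "m = axis 1 1 + axis 2 1"
  have lm: "lor m x = - x$1 + x$2" for x by (simp add: m_def lor_def axis_def)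
  show ?thesis
  proof (cases "n = m")
    case True
    show ?thesis by (rule that[of "\<lambda>x. x"]) (use True lm linear_ident in auto)
  next
    case False
    define u where "u = n - m"
    have "lor m m = 0" unfolding lm by (simp add: m_def axis_def)
    have "u $ 1 = 0" using n by (simp add: u_def m_def axis_def)
    have c: "lor u u \<noteq> 0" (is "?c \<noteq> 0")
      using null_first_component[of u] False \<open>u $ 1 = 0\<close> by (auto simp: u_def)
    define \<Phi> where "\<Phi> x = x - (2 * lor x u / ?c) *\<^sub>R u" for x
    have lin: "linear \<Phi>"
      by (rule linearI)
        (simp_all add: \<Phi>_def lor.add_left lor.scaleR_left add_divide_distrib distrib_left scaleR_left_distrib
          scaleR_right_diff_distrib mult.left_commute)
    have \<Phi>u: "lor (\<Phi> x) u = - lor x u" for x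
      using c by (simp add: \<Phi>_def lor.diff_left lor.scaleR_left)
    have inv: "\<Phi> (\<Phi> x) = x" for x
      unfolding \<Phi>_def[of "\<Phi> x"] \<Phi>u by (simp add: \<Phi>_def)
    have pres: "lor (\<Phi> x) (\<Phi> y) = lor x y" for x y
    proof -
      have "lor (\<Phi> x) (\<Phi> y) = lor (\<Phi> x) y + (2 * lor y u / ?c) * lor x u"
        by (simp add: \<Phi>_def[of y] lor.diff_right lor.scaleR_right \<Phi>u)
      also have "lor (\<Phi> x) y = lor x y - (2 * lor x u / ?c) * lor y u"
        by (simp add: \<Phi>_def lor.diff_left lor.scaleR_left lor_commute[of u y])
      finally show ?thesis by simp
    qed
    have "?c = 2 * lor n u"
      using n \<open>lor m m = 0\<close> by (simp add: u_def lor.diff_left lor.diff_right lor_commute[of m n])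
    then have "2 * lor n u / ?c = 1" using c by simp
    then have \<Phi>n: "\<Phi> n = m" by (simp add: \<Phi>_def u_def)
    have "\<Phi> x $ 1 = \<Phi> x $ 2" if "lor n x = 0" for x
      using pres[of n x] that by (simp add: \<Phi>n lm)
    then show ?thesis using that[OF lin pres inv] by blast
  qed
qed

lemma isometry_S41_if_linear:
  assumes "linear \<Phi>" "\<And>x y. lor (\<Phi> x) (\<Phi> y) = lor x y" "\<And>x. \<Phi> (\<Phi> x) = x"
  shows "isometry_S41 \<Phi>"
proof -
  have bl: "bounded_linear \<Phi>" using assms(1) by (simp add: linear_conv_bounded_linear)
  have S: "\<Phi> x \<in> S41" if "x \<in> S41" for x using that assms(2) by (simp add: S41_def)
  have bij: "bij_betw \<Phi> S41 S41"
    by (rule bij_betw_byWitness[where f'=\<Phi>]) (use assms(3) S in auto)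
  have sm: "smooth_on S41 \<Phi>" by (rule smooth_on_linear[OF bl])
  have "inv_into S41 \<Phi> x = \<Phi> x" if "x \<in> S41" for x
    by (rule inv_into_f_eq) (use bij assms(3) S that in \<open>auto simp: bij_betw_def\<close>)
  then have "smooth_on S41 (inv_into S41 \<Phi>)" using smooth_on_cong[OF sm] by metis
  with bij sm bounded_linear_imp_has_derivative[OF bl] assms(2) show ?thesis
    unfolding isometry_S41_def by blast
qed

section \<open>Local isometries into the sphere\<close>

locale spherical_development = immersed_surface \<A> f
  for \<A> :: "'a::{t2_space, second_countable_topology} chart set" and f +
  fixes y :: "'a \<Rightarrow> real^3"
  assumes y_sphere: "p \<in> carrier_of \<A> \<Longrightarrow> norm (y p) = 1"
    and y_smooth: "smooth_in_charts \<A> y"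
    and y_metric: "c \<in> \<A> \<Longrightarrow> p \<in> fst c \<Longrightarrow>
      differential c y p v \<bullet> differential c y p w = lor (differential c f p v) (differential c f p w)"

text \<open>On \<open>n\<^sup>\<bottom>\<close> the first two coordinates of \<open>\<Phi>\<close> agree and cancel in the Lorentz product, so the last three
  carry the whole product.  Both \<open>f\<close> and, by differentiation, \<open>df\<close> take values in \<open>n\<^sup>\<bottom>\<close>.\<close>

lemma (in immersed_surface) development:
  assumes n: "\<And>p. p \<in> M \<Longrightarrow> lor n (f p) = 0" and \<Phi>: "linear \<Phi>" "\<And>x y. lor (\<Phi> x) (\<Phi> y) = lor x y"
    "\<And>x. lor n x = 0 \<Longrightarrow> \<Phi> x $ 1 = \<Phi> x $ 2"
  defines "y \<equiv> \<lambda>p. vector [\<Phi> (f p) $ 3, \<Phi> (f p) $ 4, \<Phi> (f p) $ 5]"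
  shows "spherical_development \<A> f y"
proof unfold_locales
  let ?\<pi> = "\<lambda>x. vector [\<Phi> x $ 3, \<Phi> x $ 4, \<Phi> x $ 5] :: real^3"
  have lin: "linear ?\<pi>"
    by (rule linearI) (simp_all add: vec_eq_iff forall_3 linear_add[OF \<Phi>(1)] linear_scale[OF \<Phi>(1)])
  then have bl: "bounded_linear ?\<pi>" by (simp add: linear_conv_bounded_linear)
  have inner: "?\<pi> v \<bullet> ?\<pi> w = lor v w" if "lor n v = 0" "lor n w = 0" for v w
  proof -
    have "lor v w = lor (\<Phi> v) (\<Phi> w)" using \<Phi>(2) by simp
    also have "\<dots> = ?\<pi> v \<bullet> ?\<pi> w"
      using \<Phi>(3)[OF that(1)] \<Phi>(3)[OF that(2)] by (simp add: lor_def inner_vec_def sum_3)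
    finally show ?thesis by simp
  qed
  show "norm (y p) = 1" if "p \<in> M" for p
    using inner[OF n n, OF that that] f_S41[OF that] unfolding y_def norm_eq_1 by simp
  have comp: "y \<circ> g = (\<lambda>z. ?\<pi> ((f \<circ> g) z))" for g :: "real^2 \<Rightarrow> 'a" by (simp add: y_def o_def)
  show "smooth_in_charts \<A> y"
    unfolding smooth_in_charts_def comp
  proof clarify
    fix U \<phi> assume c: "(U, \<phi>) \<in> \<A>"
    show "smooth_on (\<phi> ` U) (\<lambda>z. ?\<pi> ((f \<circ> inv_into U \<phi>) z))"
      unfolding smooth_on_open_iff[OF chart_open(2)[OF c]]
      using C_k_linear_comp[OF chart_open(2)[OF c] bl smooth_in_chartsD[OF f_smooth c]] by blast
  qed
  fix c p v w assume c: "c \<in> \<A>" "p \<in> fst c"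
  then obtain U \<phi> where U: "c = (U, \<phi>)" "(U, \<phi>) \<in> \<A>" "p \<in> U" by (cases c) auto
  note df = differential_has_derivative[OF f_smooth U(2,3)]
  have "(y \<circ> inv_into U \<phi> has_derivative (\<lambda>v. ?\<pi> (differential c f p v))) (at (\<phi> p))"
    unfolding comp U(1) by (rule bounded_linear.has_derivative[OF bl df])
  then have dy: "differential c y p = (\<lambda>v. ?\<pi> (differential c f p v))"
    unfolding U(1) differential_eq by (rule frechet_derivative_at[symmetric])
  have "lor n (differential c f p v) = 0" for v
    unfolding U(1)
  proof (rule has_derivative_locally_const[OF bounded_linear.has_derivative[OF lor.bounded_linear_right df]
        chart_open(2)[OF U(2)]])
    show "\<phi> p \<in> \<phi> ` U" using U by auto
    show "lor n ((f \<circ> inv_into U \<phi>) z) = 0" if "z \<in> \<phi> ` U" for z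
      using chart_inv(2)[OF that] chart_subset[OF U(2)] n by auto
  qed
  then show "differential c y p v \<bullet> differential c y p w = lor (differential c f p v) (differential c f p w)"
    unfolding dy by (intro inner)
qed

context spherical_development
begin

text \<open>Near \<open>p\<close> the map \<open>y\<close> has an inverse which, in a chart, is the restriction to the sphere of a smooth map \<open>K\<close>
  on an open subset of space.  To stay with the plane inverse function theorem, \<open>y\<close> is composed with the
  projection \<open>P w = (D1 \<bullet> w, D2 \<bullet> w)\<close>, where \<open>D1\<close> and \<open>D2\<close> span the image of the differential at \<open>p\<close>.
  The projection is injective on the open hemisphere around \<open>y p\<close>, which the sphere covers as a graph over
  that tangent plane; so inverting \<open>P \<circ> y\<close> inverts \<open>y\<close>.\<close>

lemma local_section:
  assumes "p \<in> M"
  obtains U0 \<phi> U W K where "(U0, \<phi>) \<in> \<A>" "open U" "p \<in> U" "U \<subseteq> U0" "open W" "y p \<in> W"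
    "homeomorphism U (sphere 0 1 \<inter> W) y (inv_into U0 \<phi> \<circ> K)"
    "smooth_on W K" "K ` W \<subseteq> \<phi> ` U0"
proof -
  obtain U0 \<phi> where c: "(U0, \<phi>) \<in> \<A>" "p \<in> U0" using chart_at[OF assms] .
  let ?Y = "y \<circ> inv_into U0 \<phi>" and ?z = "\<phi> p" and ?W = "\<phi> ` U0"
  let ?D = "differential (U0, \<phi>) y p"
  define Y0 where "Y0 = y p"
  note oW = chart_open(2)[OF c(1)]
  have Yp: "?Y ?z = Y0" using inv_chart[OF c] by (simp add: Y0_def)
  have YS: "norm (?Y z) = 1" if "z \<in> ?W" for z
    using chart_inv(2)[OF that] chart_subset[OF c(1)] y_sphere by auto
  have Y0: "Y0 \<bullet> Y0 = 1" using y_sphere[OF assms] by (simp add: Y0_def norm_eq_1)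
  have zW: "?z \<in> ?W" using c by auto
  have Y: "C_k k ?Y ?W" for k by (rule smooth_in_chartsD[OF y_smooth c(1)])
  have D: "(?Y has_derivative ?D) (at ?z)" by (rule differential_has_derivative[OF y_smooth c])
  have linD: "linear ?D" by (rule linear_differential[OF y_smooth c])
  define D1 D2 where "D1 = ?D (axis 1 1)" and "D2 = ?D (axis 2 1)"
  have Dv: "?D v = v$1 *\<^sub>R D1 + v$2 *\<^sub>R D2" for v
    unfolding D1_def D2_def by (rule linear_real2[OF linD])
  have D0: "v = 0" if "?D v \<bullet> ?D v = 0" for v
    using that f_spacelike[OF c, of v] y_metric[of "(U0, \<phi>)" p v v] c by fastforce
  have orth: "?D v \<bullet> Y0 = 0" for v
  proof -
    have "?Y ?z \<bullet> ?D v + ?D v \<bullet> ?Y ?z = 0"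
      by (rule has_derivative_locally_const[OF has_derivative_inner[OF D D] oW zW])
        (use YS in \<open>simp add: norm_eq_1\<close>)
    then show ?thesis unfolding Yp by (simp add: inner_commute)
  qed
  have span: "d = 0" if "d \<bullet> Y0 = 0" "d \<bullet> D1 = 0" "d \<bullet> D2 = 0" for d :: "real^3"
  proof -
    let ?T = "\<lambda>c::real^3. c$1 *\<^sub>R Y0 + c$2 *\<^sub>R D1 + c$3 *\<^sub>R D2"
    have linT: "linear ?T" by (rule linearI) (simp_all add: algebra_simps)
    have "c = 0" if "?T c = 0" for c
    proof -
      let ?v = "vector [c$2, c$3] :: real^2"
      have T: "?T c = c$1 *\<^sub>R Y0 + ?D ?v" by (simp add: Dv[of ?v])
      have "?T c \<bullet> Y0 = c$1" unfolding T by (simp add: inner_add_left orth Y0)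
      then have c1: "c$1 = 0" using that by simp
      then have "?D ?v = 0" using that T by simp
      then have "?v = 0" using D0[of ?v] by simp
      then show ?thesis using c1 by (simp add: vec_eq_iff forall_2 forall_3)
    qed
    then have "inj ?T" unfolding linear_injective_0[OF linT] by (intro allI impI)
    then have "surj ?T" by (rule linear_inj_imp_surj[OF linT])
    from surjD[OF this, of d] obtain c where "d = ?T c" ..
    then have "d \<bullet> d = d \<bullet> ?T c" by (rule arg_cong)
    also have "\<dots> = 0" using that by (simp add: inner_add_right)
    finally show ?thesis by simp
  qed
  define P where "P w = (vector [D1 \<bullet> w, D2 \<bullet> w] :: real^2)" for w
  have "linear P" by (rule linearI) (simp_all add: P_def vec_eq_iff forall_2 inner_add_right)
  then have P: "bounded_linear P" by (simp add: linear_conv_bounded_linear)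
  \<comment> \<open>the difference of the two points is a multiple of \<open>Y0\<close>, and a line in direction \<open>Y0\<close> meets the open hemisphere at most once\<close>
  have graph: "w = w'" if "norm w = 1" "norm w' = 1" "w \<bullet> Y0 > 0" "w' \<bullet> Y0 > 0" "P w = P w'" for w w'
  proof -
    let ?d = "w' - w" let ?t = "?d \<bullet> Y0"
    have D12: "w' \<bullet> D1 = w \<bullet> D1" "w' \<bullet> D2 = w \<bullet> D2"
      using that(5) unfolding P_def vec_eq_iff forall_2 by (simp_all add: inner_commute)
    have Y12: "Y0 \<bullet> D1 = 0" "Y0 \<bullet> D2 = 0"
      using orth unfolding D1_def D2_def by (simp_all add: inner_commute)
    have "?d - ?t *\<^sub>R Y0 = 0"
      by (rule span) (simp_all add: inner_diff_left D12 Y12 Y0)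
    then have w': "w' = w + ?t *\<^sub>R Y0" by (simp add: algebra_simps)
    have "w' \<bullet> w' = w \<bullet> w + 2 * ?t * (w \<bullet> Y0) + ?t * ?t"
      by (subst (1 2) w') (simp add: inner_add_left inner_add_right Y0 inner_commute[of Y0 w] algebra_simps)
    then have "?t * (2 * (w \<bullet> Y0) + ?t) = 0" using that(1,2) by (simp add: norm_eq_1 algebra_simps)
    moreover have "2 * (w \<bullet> Y0) + ?t > 0" using that(3,4) by (simp add: inner_diff_left)
    ultimately have "?t = 0" by auto
    then show ?thesis using w' by simp
  qed
  let ?F = "P \<circ> ?Y"
  let ?W1 = "?W \<inter> (\<lambda>z. ?Y z \<bullet> Y0) -` {0<..}"
  have oW1: "open ?W1"
    by (rule continuous_open_preimage[OF _ oW])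
      (use C_k_continuous[OF Y[of 0]] in \<open>auto intro: continuous_intros\<close>)
  have zW1: "?z \<in> ?W1" using zW Yp Y0 by auto
  have F: "C_k k ?F ?W1" for k
    using C_k_subset[OF C_k_linear_comp[OF oW P Y]] by (auto simp: o_def)
  have dF: "(?F has_derivative (\<lambda>v. P (?D v))) (at ?z)"
    using bounded_linear.has_derivative[OF P D] by (simp add: o_def)
  have inj: "inj (frechet_derivative ?F (at ?z))"
  proof -
    have "v = 0" if "P (?D v) = 0" for v
    proof -
      have "D1 \<bullet> ?D v = 0" "D2 \<bullet> ?D v = 0" using that by (simp_all add: P_def vec_eq_iff forall_2)
      then have "?D v \<bullet> ?D v = 0" by (subst Dv) (simp add: inner_add_left)
      then show ?thesis by (rule D0)
    qed
    then have "inj (\<lambda>v. P (?D v))"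
      unfolding linear_injective_0[OF has_derivative_linear[OF dF]] by (intro allI impI)
    then show ?thesis using frechet_derivative_at[OF dF] by simp
  qed
  obtain U' V k where U': "open U'" "U' \<subseteq> ?W1" "?z \<in> U'" "open V" "homeomorphism U' V ?F k" "\<And>j. C_k j k V"
    by (rule smooth_inverse_function_real2[OF oW1 F zW1 inj]) blast
  let ?U = "U0 \<inter> \<phi> -` U'" and ?O = "P -` V \<inter> (\<lambda>w. w \<bullet> Y0) -` {0<..}" and ?K = "k \<circ> P"
  have oU: "open ?U"
    using chart_homeomorphism[OF c(1)] chart_open(1)[OF c(1)] U'(1)
    by (intro continuous_open_preimage) (auto simp: homeomorphism_def)
  have oO: "open ?O"
  proof (rule open_Int)
    show "open (P -` V)"
      using open_vimage[OF U'(4)] linear_continuous_on[OF P] continuous_on_eq_continuous_at by blast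
    show "open ((\<lambda>w. w \<bullet> Y0) -` {0<..})" by (rule open_vimage) (auto intro: continuous_intros)
  qed
  have k: "k v \<in> U'" "?F (k v) = v" if "v \<in> V" for v
    using U'(5) that by (auto simp: homeomorphism_def)
  have F': "?F z \<in> V" "k (?F z) = z" if "z \<in> U'" for z
    using U'(5) that by (auto simp: homeomorphism_def)
  have KO: "?K w \<in> U'" if "w \<in> ?O" for w using k that by auto
  have YK: "?Y (?K w) = w" if w: "w \<in> ?O" "norm w = 1" for w
  proof (rule graph)
    have K: "?K w \<in> ?W1" using KO[OF w(1)] U'(2) by blast
    then show "norm (?Y (?K w)) = 1" using YS by auto
    show "?Y (?K w) \<bullet> Y0 > 0" using K by auto
    show "P (?Y (?K w)) = P w" using k[of "P w"] w by auto
  qed (use w in auto)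
  have KW: "?K w \<in> ?W" if "w \<in> ?O" for w using KO[OF that] U'(2) by blast
  have homeo: "homeomorphism ?U (sphere 0 1 \<inter> ?O) y (inv_into U0 \<phi> \<circ> ?K)"
  proof (rule homeomorphismI)
    have y_on: "y q = ?Y (\<phi> q)" if "q \<in> U0" for q using inv_chart[OF c(1) that] by simp
    have cy: "continuous_on U0 (?Y \<circ> \<phi>)"
      by (rule continuous_on_compose)
        (use chart_homeomorphism[OF c(1)] C_k_continuous[OF Y[of 0]] in \<open>simp_all add: homeomorphism_def\<close>)
    show "continuous_on ?U y"
      by (rule continuous_on_eq[OF continuous_on_subset[OF cy]]) (use y_on in auto)
    show "continuous_on (sphere 0 1 \<inter> ?O) (inv_into U0 \<phi> \<circ> ?K)"
    proof (rule continuous_on_compose)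
      show "continuous_on (sphere 0 1 \<inter> ?O) ?K"
        by (rule continuous_on_compose[OF linear_continuous_on[OF P]])
          (rule continuous_on_subset[of V], use U'(5) in \<open>auto simp: homeomorphism_def\<close>)
      show "continuous_on (?K ` (sphere 0 1 \<inter> ?O)) (inv_into U0 \<phi>)"
        by (rule continuous_on_subset[of ?W]) (use chart_homeomorphism[OF c(1)] KW in \<open>auto simp: homeomorphism_def\<close>)
    qed
    show "y ` ?U \<subseteq> sphere 0 1 \<inter> ?O"
    proof clarify
      fix q assume q: "q \<in> U0" "\<phi> q \<in> U'"
      have "q \<in> M" using q chart_subset[OF c(1)] by blast
      then have "norm (y q) = 1" by (rule y_sphere)
      moreover have "P (y q) \<in> V" using F'(1)[OF q(2)] y_on[OF q(1)] by simp
      moreover have "y q \<bullet> Y0 > 0" using U'(2) q(2) y_on[OF q(1)] by auto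
      ultimately show "y q \<in> sphere 0 1 \<inter> ?O" by simp
    qed
    show "(inv_into U0 \<phi> \<circ> ?K) ` (sphere 0 1 \<inter> ?O) \<subseteq> ?U"
    proof (rule image_subsetI)
      fix w assume "w \<in> sphere 0 1 \<inter> ?O"
      then have w: "w \<in> ?O" by blast
      show "(inv_into U0 \<phi> \<circ> ?K) w \<in> ?U"
        using chart_inv[OF KW[OF w]] KO[OF w] by simp
    qed
    show "(inv_into U0 \<phi> \<circ> ?K) (y q) = q" if q: "q \<in> ?U" for q
    proof -
      have "k (P (y q)) = \<phi> q" using F'(2)[of "\<phi> q"] inv_chart[OF c(1), of q] q by simp
      then show ?thesis using inv_chart[OF c(1), of q] q by simp
    qed
    show "y ((inv_into U0 \<phi> \<circ> ?K) w) = w" if "w \<in> sphere 0 1 \<inter> ?O" for w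
      using YK[of w] that by auto
  qed
  have "C_k j ?K ?O" for j
    by (rule C_k_compose[OF oO C_k_bounded_linear[OF P] U'(6)]) auto
  then have "smooth_on ?O ?K" by (simp add: smooth_on_open_iff[OF oO])
  moreover have "?K ` ?O \<subseteq> ?W" using KW by blast
  moreover have "p \<in> ?U" "y p \<in> ?O" using c U'(3) F'(1)[OF U'(3)] Yp Y0 by (auto simp: Y0_def)
  ultimately show ?thesis by (intro that[OF c(1) oU _ _ oO _ homeo]) simp_all
qed

lemma locally_injective:
  assumes "p \<in> M"
  obtains U where "open U" "p \<in> U" "inj_on y U"
proof -
  obtain U0 \<phi> U W K where U: "(U0, \<phi>) \<in> \<A>" "open U" "p \<in> U" "U \<subseteq> U0" "open W" "y p \<in> W"
    "homeomorphism U (sphere 0 1 \<inter> W) y (inv_into U0 \<phi> \<circ> K)"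
    "smooth_on W K" "K ` W \<subseteq> \<phi> ` U0"
    by (rule local_section[OF assms])
  have "inj_on y U"
    by (rule inj_on_inverseI[of _ "inv_into U0 \<phi> \<circ> K"]) (use U(7) in \<open>simp add: homeomorphism_def\<close>)
  with U(2,3) show ?thesis by (rule that)
qed

text \<open>The set where two lifts agree is open because \<open>y\<close> is locally injective, and closed because the surface is
  Hausdorff.\<close>

lemma lifts_agree:
  fixes g1 g2 :: "'b::topological_space \<Rightarrow> 'a"
  assumes S: "connected S" and g: "continuous_on S g1" "continuous_on S g2"
    and M: "g1 ` S \<subseteq> M" and eq: "\<And>x. x \<in> S \<Longrightarrow> y (g1 x) = y (g2 x)"
    and a: "a \<in> S" "g1 a = g2 a" and b: "b \<in> S"
  shows "g1 b = g2 b"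
proof -
  have pre: "\<exists>T. open T \<and> T \<inter> S = g -` A \<inter> S" if "continuous_on S g" "open A" for g :: "'b \<Rightarrow> 'a" and A
    using that unfolding continuous_on_open_invariant by metis
  have "(g1 b = g2 b) = (g1 a = g2 a)"
  proof (rule connected_local_const[OF S b a(1)], rule ballI)
    fix x assume x: "x \<in> S"
    show "eventually (\<lambda>z. (g1 x = g2 x) = (g1 z = g2 z)) (at x within S)"
    proof (cases "g1 x = g2 x")
      case True
      have "g1 x \<in> M" using x M by auto
      then obtain U where U: "open U" "g1 x \<in> U" "inj_on y U"
        by (rule locally_injective)
      obtain T1 T2 where T: "open T1" "T1 \<inter> S = g1 -` U \<inter> S" "open T2" "T2 \<inter> S = g2 -` U \<inter> S"
        using pre[OF g(1) U(1)] pre[OF g(2) U(1)] by blast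
      have "g1 z = g2 z" if "z \<in> T1 \<inter> T2" "z \<in> S" for z
      proof (rule inj_onD[OF U(3) eq[OF that(2)]])
        show "g1 z \<in> U" "g2 z \<in> U" using T that by auto
      qed
      moreover have "x \<in> T1 \<inter> T2" using T x U(2) True by auto
      ultimately show ?thesis
        using True T open_Int unfolding eventually_at_topological by (intro exI[of _ "T1 \<inter> T2"]) auto
    next
      case False
      obtain A B where A: "open A" "open B" "g1 x \<in> A" "g2 x \<in> B" "A \<inter> B = {}"
        using hausdorff[OF False] by blast
      obtain T1 T2 where T: "open T1" "T1 \<inter> S = g1 -` A \<inter> S" "open T2" "T2 \<inter> S = g2 -` B \<inter> S"
        using pre[OF g(1) A(1)] pre[OF g(2) A(2)] by blast
      have "g1 z \<noteq> g2 z" if "z \<in> T1 \<inter> T2" "z \<in> S" for z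
      proof -
        have "g1 z \<in> A" "g2 z \<in> B" using T that by auto
        then show ?thesis using A(5) by auto
      qed
      moreover have "x \<in> T1 \<inter> T2" using T x A by auto
      ultimately show ?thesis
        using False T open_Int unfolding eventually_at_topological by (intro exI[of _ "T1 \<inter> T2"]) auto
    qed
  qed
  then show ?thesis using a by simp
qed

end

section \<open>Lengths of curves\<close>

lemma (in surface) chart_curve_derivative:
  assumes h: "smooth_in_charts \<A> h" and c: "(U, \<phi>) \<in> \<A>" and S: "\<gamma> ` S \<subseteq> U" "t \<in> S"
    and D: "((\<phi> \<circ> \<gamma>) has_vector_derivative D) (at t within S)"
  shows "((h \<circ> \<gamma>) has_vector_derivative differential (U, \<phi>) h (\<gamma> t) D) (at t within S)"
proof -
  have t: "\<gamma> t \<in> U" using S by blast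
  have "(h \<circ> inv_into U \<phi> has_derivative differential (U, \<phi>) h (\<gamma> t))
      (at ((\<phi> \<circ> \<gamma>) t) within (\<phi> \<circ> \<gamma>) ` S)"
    using has_derivative_at_withinI[OF differential_has_derivative[OF h c t]] by (simp only: o_apply)
  from vector_derivative_diff_chain_within[OF D this] show ?thesis
  proof (rule has_vector_derivative_transform[rotated -1])
    show "(h \<circ> \<gamma>) s = ((h \<circ> inv_into U \<phi>) \<circ> (\<phi> \<circ> \<gamma>)) s" if "s \<in> S" for s
      using inv_chart[OF c, of "\<gamma> s"] S(1) that by auto
  qed (rule S(2))
qed

context spherical_development
begin

definition speed :: "(real \<Rightarrow> 'a) \<Rightarrow> real \<Rightarrow> real" where
  "speed \<gamma> t = sqrt (lor (vector_derivative (f \<circ> \<gamma>) (at t)) (vector_derivative (f \<circ> \<gamma>) (at t)))"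

lemma curve_length_speed: "curve_length f \<gamma> = integral {0..1} (speed \<gamma>)"
  by (simp add: curve_length_def speed_def[abs_def])

text \<open>The statement about curves that is additive under subdivision: it will be proved on short intervals,
  whose image lies in one chart, and then spread over \<open>[0,1]\<close> by compactness.\<close>

definition rectifiable_piece :: "(real \<Rightarrow> 'a) \<Rightarrow> real \<Rightarrow> real \<Rightarrow> bool" where
  "rectifiable_piece \<gamma> a b \<longleftrightarrow> (\<exists>I N. (speed \<gamma> has_integral I) {a..b} \<and> norm (y (\<gamma> b) - y (\<gamma> a)) \<le> I \<and>
     finite N \<and> (\<forall>t\<in>{a..b} - N. (f \<circ> \<gamma>) differentiable (at t) \<and> (y \<circ> \<gamma>) differentiable (at t) \<and>
        speed \<gamma> t = norm (vector_derivative (y \<circ> \<gamma>) (at t))))"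

text \<open>In a chart the speed of the curve equals the norm of the derivative of \<open>y \<circ> \<gamma>\<close>, by the isometry property.  At the
  two ends of the interval only one-sided derivatives are known, hence the exceptional set.\<close>

lemma chart_piece:
  assumes c: "(U, \<phi>) \<in> \<A>" and ab: "a < b" and sub: "\<gamma> ` {a..b} \<subseteq> U"
    and C1: "C1_on_interval (\<phi> \<circ> \<gamma>) a b"
  shows "rectifiable_piece \<gamma> a b"
proof -
  obtain D where D: "continuous_on {a..b} D"
    "\<And>t. t \<in> {a..b} \<Longrightarrow> ((\<phi> \<circ> \<gamma>) has_vector_derivative D t) (at t within {a..b})"
    using C1 unfolding C1_on_interval_def by blast
  define DY where "DY t = differential (U, \<phi>) y (\<gamma> t) (D t)" for t
  have dy: "((y \<circ> \<gamma>) has_vector_derivative DY t) (at t within {a..b})" if "t \<in> {a..b}" for t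
    unfolding DY_def by (rule chart_curve_derivative[OF y_smooth c sub that D(2)[OF that]])
  have df: "((f \<circ> \<gamma>) has_vector_derivative differential (U, \<phi>) f (\<gamma> t) (D t)) (at t within {a..b})"
    if "t \<in> {a..b}" for t
    by (rule chart_curve_derivative[OF f_smooth c sub that D(2)[OF that]])
  have "continuous_on {a..b} DY"
  proof -
    have z: "continuous_on {a..b} (\<lambda>t. \<phi> (\<gamma> t))"
      using D(2) continuous_on_vector_derivative[of "{a..b}" "\<phi> \<circ> \<gamma>" D] by (simp add: o_def)
    let ?Y = "\<lambda>z. frechet_derivative (y \<circ> inv_into U \<phi>) (at z)"
    have "continuous_on (\<phi> ` U) (\<lambda>z. ?Y z v)" for v
      using smooth_in_chartsD[OF y_smooth c, of 1] by simp
    then have Y: "continuous_on {a..b} (\<lambda>t. ?Y (\<phi> (\<gamma> t)) v)" for v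
      by (rule continuous_on_compose2[OF _ z]) (use sub in auto)
    have "DY t = D t $ 1 *\<^sub>R ?Y (\<phi> (\<gamma> t)) (axis 1 1) + D t $ 2 *\<^sub>R ?Y (\<phi> (\<gamma> t)) (axis 2 1)"
      if "t \<in> {a..b}" for t
      unfolding DY_def differential_eq[symmetric]
      by (rule linear_real2[OF linear_differential[OF y_smooth c]]) (use sub that in auto)
    then show ?thesis
      using Y D(1) by (subst continuous_on_cong[OF refl]) (auto intro!: continuous_intros)
  qed
  then have "(\<lambda>t. norm (DY t)) integrable_on {a..b}"
    by (intro integrable_continuous_real continuous_on_norm)
  then obtain I where I: "((\<lambda>t. norm (DY t)) has_integral I) {a..b}" by blast
  have FTC: "(DY has_integral ((y \<circ> \<gamma>) b - (y \<circ> \<gamma>) a)) {a..b}"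
    by (rule fundamental_theorem_of_calculus[OF less_imp_le[OF ab] dy])
  have le: "norm (y (\<gamma> b) - y (\<gamma> a)) \<le> I"
    using integral_norm_bound_integral[of DY "{a..b}" "\<lambda>t. norm (DY t)"] FTC I
    by (auto simp: has_integral_iff)
  have int: "(f \<circ> \<gamma>) differentiable (at t) \<and> (y \<circ> \<gamma>) differentiable (at t) \<and>
      vector_derivative (y \<circ> \<gamma>) (at t) = DY t \<and> speed \<gamma> t = norm (DY t)" if t: "t \<in> {a..b} - {a, b}" for t
  proof -
    have w: "at t within {a..b} = at t" using t by (intro at_within_Icc_at) auto
    have 1: "((y \<circ> \<gamma>) has_vector_derivative DY t) (at t)" using dy[of t] t unfolding w by blast
    have 2: "((f \<circ> \<gamma>) has_vector_derivative differential (U, \<phi>) f (\<gamma> t) (D t)) (at t)" using df[of t] t unfolding w by blast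
    have "lor (differential (U, \<phi>) f (\<gamma> t) (D t)) (differential (U, \<phi>) f (\<gamma> t) (D t)) = DY t \<bullet> DY t"
      unfolding DY_def by (rule y_metric[symmetric]) (use c sub t in auto)
    then have "speed \<gamma> t = norm (DY t)"
      unfolding speed_def vector_derivative_at[OF 2] by (simp add: norm_eq_sqrt_inner)
    then show ?thesis
      using 1 2 vector_derivative_at[OF 1] unfolding has_vector_derivative_def differentiable_def by blast
  qed
  have "(speed \<gamma> has_integral I) {a..b}"
    by (rule has_integral_spike_finite[OF _ _ I, of "{a, b}"]) (use int in auto)
  then show ?thesis
    unfolding rectifiable_piece_def using le int by (intro exI[of _ I] exI[of _ "{a, b}"]) auto
qed

lemma trivial_piece: "rectifiable_piece \<gamma> a a"
  unfolding rectifiable_piece_def by (intro exI[of _ 0] exI[of _ "{a}"]) auto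

lemma rectifiable_piece_combine:
  assumes "rectifiable_piece \<gamma> a b" "rectifiable_piece \<gamma> b c" "a \<le> b" "b \<le> c"
  shows "rectifiable_piece \<gamma> a c"
proof -
  obtain I N where 1: "(speed \<gamma> has_integral I) {a..b}" "norm (y (\<gamma> b) - y (\<gamma> a)) \<le> I" "finite N"
    "\<forall>t\<in>{a..b} - N. (f \<circ> \<gamma>) differentiable (at t) \<and> (y \<circ> \<gamma>) differentiable (at t) \<and>
        speed \<gamma> t = norm (vector_derivative (y \<circ> \<gamma>) (at t))"
    using assms(1) unfolding rectifiable_piece_def by blast
  obtain J K where 2: "(speed \<gamma> has_integral J) {b..c}" "norm (y (\<gamma> c) - y (\<gamma> b)) \<le> J" "finite K"
    "\<forall>t\<in>{b..c} - K. (f \<circ> \<gamma>) differentiable (at t) \<and> (y \<circ> \<gamma>) differentiable (at t) \<and>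
        speed \<gamma> t = norm (vector_derivative (y \<circ> \<gamma>) (at t))"
    using assms(2) unfolding rectifiable_piece_def by blast
  have "(speed \<gamma> has_integral (I + J)) {a..c}" by (rule has_integral_combine[OF assms(3,4) 1(1) 2(1)])
  moreover have "norm (y (\<gamma> c) - y (\<gamma> a)) \<le> I + J"
    using norm_triangle_ineq[of "y (\<gamma> b) - y (\<gamma> a)" "y (\<gamma> c) - y (\<gamma> b)"] 1(2) 2(2) by simp
  moreover have "\<forall>t\<in>{a..c} - (N \<union> K). (f \<circ> \<gamma>) differentiable (at t) \<and> (y \<circ> \<gamma>) differentiable (at t) \<and>
        speed \<gamma> t = norm (vector_derivative (y \<circ> \<gamma>) (at t))"
  proof
    fix t assume "t \<in> {a..c} - (N \<union> K)"
    then have "t \<in> {a..b} - N \<or> t \<in> {b..c} - K" by auto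
    then show "(f \<circ> \<gamma>) differentiable (at t) \<and> (y \<circ> \<gamma>) differentiable (at t) \<and>
        speed \<gamma> t = norm (vector_derivative (y \<circ> \<gamma>) (at t))"
      using 1(4) 2(4) by blast
  qed
  ultimately show ?thesis
    unfolding rectifiable_piece_def using 1(3) 2(3) by (intro exI[of _ "I + J"] exI[of _ "N \<union> K"] conjI) simp_all
qed

definition C1_apart_from :: "real set \<Rightarrow> (real \<Rightarrow> 'a) \<Rightarrow> bool" where
  "C1_apart_from T \<gamma> \<longleftrightarrow> (\<forall>(U, \<phi>)\<in>\<A>. \<forall>a b. 0 \<le> a \<and> a < b \<and> b \<le> 1 \<and> {a<..<b} \<inter> T = {} \<and>
     \<gamma> ` {a..b} \<subseteq> U \<longrightarrow> C1_on_interval (\<phi> \<circ> \<gamma>) a b)"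

lemma C1_apart_fromD:
  assumes "C1_apart_from T \<gamma>" "(U, \<phi>) \<in> \<A>" "0 \<le> a" "a < b" "b \<le> 1" "{a<..<b} \<inter> T = {}"
    "\<gamma> ` {a..b} \<subseteq> U"
  shows "C1_on_interval (\<phi> \<circ> \<gamma>) a b"
  using assms unfolding C1_apart_from_def by blast

lemma C1_apart_fromI:
  assumes "\<And>U \<phi> a b. (U, \<phi>) \<in> \<A> \<Longrightarrow> 0 \<le> a \<Longrightarrow> a < b \<Longrightarrow> b \<le> 1 \<Longrightarrow> {a<..<b} \<inter> T = {} \<Longrightarrow>
      \<gamma> ` {a..b} \<subseteq> U \<Longrightarrow> C1_on_interval (\<phi> \<circ> \<gamma>) a b"
  shows "C1_apart_from T \<gamma>"
  using assms unfolding C1_apart_from_def by blast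

lemma piecewise_C1_curve_iff:
  "piecewise_C1_curve \<A> \<gamma> \<longleftrightarrow> path \<gamma> \<and> path_image \<gamma> \<subseteq> M \<and> (\<exists>T. finite T \<and> C1_apart_from T \<gamma>)"
  unfolding piecewise_C1_curve_def C1_apart_from_def ..

text \<open>Around each parameter \<open>x\<close> the intervals \<open>[a,x]\<close> and \<open>[x,b]\<close> are short enough to stay in one chart and contain
  no break point in their interior.\<close>

lemma rectifiable_curve:
  assumes \<gamma>: "piecewise_C1_curve \<A> \<gamma>" and ab: "0 \<le> a" "a \<le> b" "b \<le> 1"
  shows "rectifiable_piece \<gamma> a b"
proof -
  obtain T where T: "finite T" "C1_apart_from T \<gamma>"
    using \<gamma> unfolding piecewise_C1_curve_iff by blast
  have cont: "continuous_on {0..1} \<gamma>" and img: "\<gamma> ` {0..1} \<subseteq> M"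
    using \<gamma> by (auto simp: piecewise_C1_curve_def path_def path_image_def)
  have "0 \<le> a \<longrightarrow> b \<le> 1 \<longrightarrow> rectifiable_piece \<gamma> a b"
    using ab(2)
  proof (induction rule: Bolzano)
    case (trans a b c)
    then show ?case using rectifiable_piece_combine by force
  next
    case (local x)
    then have x: "x \<in> {0..1}" using ab by auto
    then obtain U \<phi> where c: "(U, \<phi>) \<in> \<A>" "\<gamma> x \<in> U" using chart_at img by blast
    obtain A where A: "open A" "A \<inter> {0..1} = \<gamma> -` U \<inter> {0..1}"
      using cont chart_open(1)[OF c(1)] unfolding continuous_on_open_invariant by metis
    have "open (A - (T - {x}))" using A(1) T(1) by (intro open_Diff finite_imp_closed) auto
    have "x \<in> \<gamma> -` U \<inter> {0..1}" using c(2) x by simp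
    then have "x \<in> A" unfolding A(2)[symmetric] by simp
    then have "x \<in> A - (T - {x})" by simp
    with \<open>open (A - (T - {x}))\<close> obtain d where d: "d > 0" "ball x d \<subseteq> A - (T - {x})"
      using open_contains_ball_eq by blast
    have piece: "rectifiable_piece \<gamma> a b"
      if "0 \<le> a" "a \<le> b" "b \<le> 1" "x - d < a" "b < x + d" "x \<notin> {a<..<b}" for a b
    proof (cases "a = b")
      case False
      have sub: "{a..b} \<subseteq> ball x d" using that by (auto simp: dist_real_def)
      have "{a<..<b} \<inter> T = {}"
      proof (rule ccontr)
        assume "{a<..<b} \<inter> T \<noteq> {}"
        then obtain t where t: "t \<in> {a<..<b}" "t \<in> T" by blast
        then have "t \<in> ball x d" using sub by (meson greaterThanLessThan_subseteq_atLeastAtMost_iff order_refl subsetD)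
        then have "t \<in> A - (T - {x})" using d(2) by blast
        then have "t = x" using t(2) by simp
        then show False using t(1) that(6) by simp
      qed
      moreover have "\<gamma> ` {a..b} \<subseteq> U"
      proof clarify
        fix t assume t: "t \<in> {a..b}"
        then have "t \<in> ball x d" using sub by blast
        then have "t \<in> A" using d(2) by blast
        then have "t \<in> A \<inter> {0..1}" using t that by simp
        then show "\<gamma> t \<in> U" unfolding A(2) by simp
      qed
      ultimately show ?thesis using chart_piece[OF c(1)] C1_apart_fromD[OF T(2) c(1)] that False by auto
    qed (simp add: trivial_piece)
    show ?case
    proof (intro exI[of _ d] conjI allI impI)
      fix a b assume *: "a \<le> x \<and> x \<le> b \<and> b - a < d" "0 \<le> a" "b \<le> 1"
      have "rectifiable_piece \<gamma> a x" "rectifiable_piece \<gamma> x b" using * by (auto intro!: piece)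
      then show "rectifiable_piece \<gamma> a b" using * rectifiable_piece_combine by blast
    qed (rule d(1))
  qed
  then show ?thesis using ab by simp
qed

lemma speed_has_integral:
  assumes "piecewise_C1_curve \<A> \<gamma>"
  shows "(speed \<gamma> has_integral curve_length f \<gamma>) {0..1}"
  using rectifiable_curve[OF assms, of 0 1] unfolding rectifiable_piece_def curve_length_speed
  by (auto simp: has_integral_iff)

lemma dist_le_curve_length:
  assumes \<gamma>: "piecewise_C1_curve \<A> \<gamma>" and t: "t \<in> {0..1}"
  shows "dist (y (\<gamma> 0)) (y (\<gamma> t)) \<le> curve_length f \<gamma>"
proof -
  obtain I where 1: "(speed \<gamma> has_integral I) {0..t}" "norm (y (\<gamma> t) - y (\<gamma> 0)) \<le> I"
    using rectifiable_curve[OF \<gamma>, of 0 t] t unfolding rectifiable_piece_def by auto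
  obtain J where 2: "(speed \<gamma> has_integral J) {t..1}" "norm (y (\<gamma> 1) - y (\<gamma> t)) \<le> J"
    using rectifiable_curve[OF \<gamma>, of t 1] t unfolding rectifiable_piece_def by auto
  have "(speed \<gamma> has_integral (I + J)) {0..1}" by (rule has_integral_combine[OF _ _ 1(1) 2(1)]) (use t in auto)
  then have "curve_length f \<gamma> = I + J" using has_integral_unique speed_has_integral[OF \<gamma>] by blast
  moreover have "0 \<le> J" using order_trans[OF norm_ge_zero 2(2)] .
  ultimately show ?thesis using 1(2) by (simp add: dist_norm norm_minus_commute)
qed

lemma curve_length_nonneg: "piecewise_C1_curve \<A> \<gamma> \<Longrightarrow> curve_length f \<gamma> \<ge> 0"
  using dist_le_curve_length[of \<gamma> 0] by simp

text \<open>Speed is measured by \<open>y \<circ> \<gamma>\<close> except at finitely many parameters; there the integrand is replaced by the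
  bound itself.\<close>

lemma curve_length_le:
  assumes \<gamma>: "piecewise_C1_curve \<A> \<gamma>"
    and B: "\<And>t. 0 < t \<Longrightarrow> t < 1 \<Longrightarrow> \<exists>D. ((y \<circ> \<gamma>) has_vector_derivative D) (at t) \<and> norm D \<le> B"
  shows "curve_length f \<gamma> \<le> B"
proof -
  obtain I N where I: "(speed \<gamma> has_integral I) {0..1}" "finite N"
    "\<forall>t\<in>{0..1} - N. speed \<gamma> t = norm (vector_derivative (y \<circ> \<gamma>) (at t))"
    using rectifiable_curve[OF \<gamma>, of 0 1] unfolding rectifiable_piece_def by auto
  let ?g = "\<lambda>t. if t \<in> N \<union> {0, 1} then B else speed \<gamma> t"
  have "(?g has_integral I) {0..1}"
    by (rule has_integral_spike_finite[OF _ _ I(1), of "N \<union> {0,1}"]) (use I(2) in auto)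
  moreover have "((\<lambda>_. B) has_integral B) {0..1::real}" using has_integral_const_real[of B 0 1] by simp
  moreover have "?g t \<le> B" if "t \<in> {0..1}" for t
  proof (cases "t \<in> N \<union> {0, 1}")
    case False
    then obtain D where "((y \<circ> \<gamma>) has_vector_derivative D) (at t)" "norm D \<le> B" using B[of t] \<open>t \<in> _\<close> by auto
    then show ?thesis using False I(3) that vector_derivative_at by auto
  qed simp
  ultimately have "I \<le> B" by (rule has_integral_le)
  then show ?thesis using has_integral_unique[OF I(1) speed_has_integral[OF \<gamma>]] by simp
qed

lemma speed_affine:
  assumes d: "(f \<circ> \<gamma>) differentiable (at (m * t + c))" and S: "open S" "t \<in> S"
    and eq: "\<And>s. s \<in> S \<Longrightarrow> \<delta> s = \<gamma> (m * s + c)"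
  shows "speed \<delta> t = \<bar>m\<bar> * speed \<gamma> (m * t + c)"
proof -
  let ?v = "vector_derivative (f \<circ> \<gamma>) (at (m * t + c))"
  have 1: "((f \<circ> \<gamma>) has_vector_derivative ?v) (at (m * t + c))"
    using d vector_derivative_works by blast
  have "((\<lambda>s. m * s + c) has_vector_derivative m) (at t)"
    by (auto intro!: derivative_eq_intros)
  from vector_diff_chain_at[OF this 1]
  have "((f \<circ> \<gamma>) \<circ> (\<lambda>s. m * s + c) has_vector_derivative m *\<^sub>R ?v) (at t)" .
  then have "((f \<circ> \<delta>) has_vector_derivative m *\<^sub>R ?v) (at t)"
    by (rule has_vector_derivative_transform_within_open[OF _ S]) (simp add: eq)
  from vector_derivative_at[OF this] have "vector_derivative (f \<circ> \<delta>) (at t) = m *\<^sub>R ?v" .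
  then have "speed \<delta> t = sqrt (m\<^sup>2 * lor ?v ?v)"
    by (simp add: speed_def lor.scaleR_left lor.scaleR_right power2_eq_square)
  then show ?thesis by (simp add: speed_def real_sqrt_mult)
qed

lemma C1_on_interval_affine:
  assumes g: "C1_on_interval g a' b'" and sub: "(\<lambda>t. m * t + c) ` {a..b} \<subseteq> {a'..b'}"
    and eq: "\<And>t. t \<in> {a..b} \<Longrightarrow> h t = g (m * t + c)"
  shows "C1_on_interval h a b"
proof -
  let ?k = "\<lambda>t. m * t + c"
  obtain D where D: "continuous_on {a'..b'} D"
    "\<And>t. t \<in> {a'..b'} \<Longrightarrow> (g has_vector_derivative D t) (at t within {a'..b'})"
    using g unfolding C1_on_interval_def by blast
  have "(h has_vector_derivative m *\<^sub>R D (?k t)) (at t within {a..b})" if t: "t \<in> {a..b}" for t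
  proof -
    have "(?k has_vector_derivative m) (at t within {a..b})" by (auto intro!: derivative_eq_intros)
    moreover have "(g has_vector_derivative D (?k t)) (at (?k t) within ?k ` {a..b})"
      using has_vector_derivative_within_subset[OF D(2) sub] sub t by blast
    ultimately have "(g \<circ> ?k has_vector_derivative m *\<^sub>R D (?k t)) (at t within {a..b})"
      by (rule vector_diff_chain_within)
    then show ?thesis
      by (rule has_vector_derivative_transform[OF t, rotated]) (simp add: eq)
  qed
  moreover have "continuous_on {a..b} (\<lambda>t. m *\<^sub>R D (?k t))"
    by (intro continuous_intros continuous_on_compose2[OF D(1)]) (use sub in auto)
  ultimately show ?thesis unfolding C1_on_interval_def by blast
qed

lemma not_differentiable_finite:
  assumes "piecewise_C1_curve \<A> \<gamma>"
  shows "finite {t \<in> {0..1}. \<not> (f \<circ> \<gamma>) differentiable (at t)}"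
proof -
  obtain N where N: "finite N" "\<forall>t\<in>{0..1} - N. (f \<circ> \<gamma>) differentiable (at t)"
    using rectifiable_curve[OF assms, of 0 1] unfolding rectifiable_piece_def by auto
  show ?thesis by (rule finite_subset[OF _ N(1)]) (use N(2) in blast)
qed

text \<open>Reversal and concatenation of curves are affine reparametrisations on subintervals.  This lemma and the next one
  treat them together, for smoothness and for length.\<close>

lemma C1_affine_pullback:
  assumes \<gamma>: "C1_apart_from T \<gamma>" and c: "(U, \<phi>) \<in> \<A>" and ab: "a < b" and m: "m \<noteq> 0"
    and sub: "(\<lambda>t. m * t + k) ` {a..b} \<subseteq> {0..1}" and T: "(\<lambda>t. m * t + k) ` {a<..<b} \<inter> T = {}"
    and eq: "\<And>t. t \<in> {a..b} \<Longrightarrow> \<delta> t = \<gamma> (m * t + k)" and U: "\<delta> ` {a..b} \<subseteq> U"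
  shows "C1_on_interval (\<phi> \<circ> \<delta>) a b"
proof -
  let ?h = "\<lambda>t. m * t + k"
  define a' b' where "a' = min (?h a) (?h b)" and "b' = max (?h a) (?h b)"
  have closed: "?h ` {a..b} = {a'..b'}"
    using ab m by (cases "m > 0") (auto simp: image_affinity_atLeastAtMost a'_def b'_def min_def max_def)
  have "open": "{a'<..<b'} \<subseteq> ?h ` {a<..<b}"
  proof
    fix t assume t: "t \<in> {a'<..<b'}"
    then have "t \<in> ?h ` {a..b}" unfolding closed by simp
    then obtain s where s: "s \<in> {a..b}" "t = ?h s" by blast
    have "s \<noteq> a" "s \<noteq> b" using t s(2) by (auto simp: a'_def b'_def)
    with s show "t \<in> ?h ` {a<..<b}" by auto
  qed
  have min_less_max: "min x z < max x z" if "x \<noteq> z" for x z :: real using that by (auto simp: min_def max_def)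
  have "a' < b'" unfolding a'_def b'_def by (rule min_less_max) (use ab m in simp)
  moreover have "0 \<le> a'" "b' \<le> 1" using sub \<open>a' < b'\<close> unfolding closed by auto
  moreover have "{a'<..<b'} \<inter> T = {}" using "open" T by blast
  moreover have "\<gamma> ` {a'..b'} \<subseteq> U" unfolding closed[symmetric] using eq U by auto
  ultimately have "C1_on_interval (\<phi> \<circ> \<gamma>) a' b'" by (intro C1_apart_fromD[OF \<gamma> c])
  then show ?thesis
    by (rule C1_on_interval_affine[where m=m and c=k]) (use closed eq in auto)
qed

lemma speed_affine_has_integral:
  assumes \<gamma>: "piecewise_C1_curve \<A> \<gamma>" and m: "m \<noteq> 0"
    and ab: "(\<lambda>x. (x - k) / m) ` {0..1} = {a..b}" and eq: "\<And>t. t \<in> {a..b} \<Longrightarrow> \<delta> t = \<gamma> (m * t + k)"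
  shows "(speed \<delta> has_integral curve_length f \<gamma>) {a..b}"
proof -
  let ?N = "{t \<in> {0..1}. \<not> (f \<circ> \<gamma>) differentiable (at t)}" and ?g = "\<lambda>x. (x - k) / m"
  have "(\<lambda>x. (1 / m) *\<^sub>R x + - ((1 / m) *\<^sub>R k)) ` {0..1} = {a..b}"
    unfolding ab[symmetric] by (simp add: diff_divide_distrib)
  then have "((\<lambda>t. speed \<gamma> (m * t + k)) has_integral (1 / \<bar>m\<bar>) * curve_length f \<gamma>) {a..b}"
    using has_integral_affinity01[OF speed_has_integral[OF \<gamma>] m, of k] by simp
  from has_integral_mult_right[OF this, of "\<bar>m\<bar>"]
  have 1: "((\<lambda>t. \<bar>m\<bar> * speed \<gamma> (m * t + k)) has_integral curve_length f \<gamma>) {a..b}" using m by simp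
  show ?thesis
  proof (rule has_integral_spike_finite[OF _ _ 1])
    show "finite ({a, b} \<union> ?g ` ?N)" using not_differentiable_finite[OF \<gamma>] by simp
    fix t :: real assume t: "t \<in> {a..b} - ({a, b} \<union> ?g ` ?N)"
    have inv: "?g (m * t + k) = t" using m by simp
    have "t \<in> ?g ` {0..1}" unfolding ab using t by simp
    then obtain x where x: "x \<in> {0..1}" "t = ?g x" by blast
    then have mx: "m * t + k = x" using m by simp
    have "x \<notin> ?N" using t imageI[of x ?N ?g] x(2) by auto
    then have "(f \<circ> \<gamma>) differentiable (at (m * t + k))" using x(1) unfolding mx by simp
    from speed_affine[OF this open_greaterThanLessThan[of a b], of \<delta>] eq t
    show "speed \<delta> t = \<bar>m\<bar> * speed \<gamma> (m * t + k)" by auto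
  qed
qed

lemma curve_reverse:
  assumes \<gamma>: "piecewise_C1_curve \<A> \<gamma>"
  shows "piecewise_C1_curve \<A> (reversepath \<gamma>)" "curve_length f (reversepath \<gamma>) = curve_length f \<gamma>"
proof -
  obtain T where T: "finite T" "C1_apart_from T \<gamma>"
    using \<gamma> unfolding piecewise_C1_curve_iff by blast
  have rev: "reversepath \<gamma> t = \<gamma> (-1 * t + 1)" for t by (simp add: reversepath_def)
  have "C1_apart_from ((\<lambda>t. 1 - t) ` T) (reversepath \<gamma>)"
  proof (rule C1_apart_fromI)
    fix U \<phi> a b assume c: "(U, \<phi>) \<in> \<A>" and ab: "0 \<le> a" "a < b" "b \<le> (1::real)"
      and T': "{a<..<b} \<inter> (\<lambda>t. 1 - t) ` T = {}" and U: "reversepath \<gamma> ` {a..b} \<subseteq> U"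
    show "C1_on_interval (\<phi> \<circ> reversepath \<gamma>) a b"
      by (rule C1_affine_pullback[OF T(2) c ab(2), where m="-1" and k=1]) (use ab T' U rev in force)+
  qed
  moreover have "path (reversepath \<gamma>)" "path_image (reversepath \<gamma>) \<subseteq> M"
    using \<gamma> by (auto simp: piecewise_C1_curve_def)
  ultimately show r: "piecewise_C1_curve \<A> (reversepath \<gamma>)"
    unfolding piecewise_C1_curve_iff using T(1) by blast
  have "(speed (reversepath \<gamma>) has_integral curve_length f \<gamma>) {0..1}"
    by (rule speed_affine_has_integral[OF \<gamma>, where m="-1" and k=1])
      (use rev image_affinity_atLeastAtMost[of "-1::real" 1 0 1] in auto)
  then show "curve_length f (reversepath \<gamma>) = curve_length f \<gamma>"
    using has_integral_unique speed_has_integral[OF r] by blast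
qed

lemma curve_join:
  assumes \<gamma>: "piecewise_C1_curve \<A> \<gamma>" and \<delta>: "piecewise_C1_curve \<A> \<delta>"
    and join: "pathfinish \<gamma> = pathstart \<delta>"
  shows "piecewise_C1_curve \<A> (\<gamma> +++ \<delta>)" "curve_length f (\<gamma> +++ \<delta>) = curve_length f \<gamma> + curve_length f \<delta>"
proof -
  obtain T1 where T1: "finite T1" "C1_apart_from T1 \<gamma>"
    using \<gamma> unfolding piecewise_C1_curve_iff by blast
  obtain T2 where T2: "finite T2" "C1_apart_from T2 \<delta>"
    using \<delta> unfolding piecewise_C1_curve_iff by blast
  have left: "(\<gamma> +++ \<delta>) t = \<gamma> (2 * t + 0)" if "t \<le> 1/2" for t
    using that by (simp add: joinpaths_def)
  have right: "(\<gamma> +++ \<delta>) t = \<delta> (2 * t + -1)" if "t \<ge> 1/2" for t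
  proof (cases "t = 1/2")
    case True
    show ?thesis unfolding True using join by (simp add: joinpaths_def pathfinish_def pathstart_def)
  qed (use that in \<open>simp add: joinpaths_def\<close>)
  let ?T = "{1/2} \<union> (\<lambda>t. t / 2) ` T1 \<union> (\<lambda>t. (t + 1) / 2) ` T2"
  have "C1_apart_from ?T (\<gamma> +++ \<delta>)"
  proof (rule C1_apart_fromI)
    fix U \<phi> a b assume c: "(U, \<phi>) \<in> \<A>" and ab: "0 \<le> a" "a < b" "b \<le> (1::real)" and T': "{a<..<b} \<inter> ?T = {}"
      and U: "(\<gamma> +++ \<delta>) ` {a..b} \<subseteq> U"
    have "1/2 \<notin> {a<..<b}" using T' by blast
    then consider "b \<le> 1/2" | "a \<ge> 1/2" by fastforce
    then show "C1_on_interval (\<phi> \<circ> (\<gamma> +++ \<delta>)) a b"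
    proof cases
      case 1
      have "t / 2 \<notin> {a<..<b}" if "t \<in> T1" for t using T' that by blast
      then have "(\<lambda>t. 2 * t + 0) ` {a<..<b} \<inter> T1 = {}" by force
      then show ?thesis
        by (intro C1_affine_pullback[OF T1(2) c ab(2), where m=2 and k=0]) (use ab 1 U left in auto)
    next
      case 2
      have "(t + 1) / 2 \<notin> {a<..<b}" if "t \<in> T2" for t using T' that by blast
      then have "(\<lambda>t. 2 * t + -1) ` {a<..<b} \<inter> T2 = {}" by force
      then show ?thesis
        by (intro C1_affine_pullback[OF T2(2) c ab(2), where m=2 and k="-1"]) (use ab 2 U right in auto)
    qed
  qed
  moreover have "path (\<gamma> +++ \<delta>)" "path_image (\<gamma> +++ \<delta>) \<subseteq> M"
    using \<gamma> \<delta> join path_image_join_subset[of \<gamma> \<delta>] by (auto simp: piecewise_C1_curve_def)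
  moreover have "finite ?T" using T1(1) T2(1) by simp
  ultimately show j: "piecewise_C1_curve \<A> (\<gamma> +++ \<delta>)"
    unfolding piecewise_C1_curve_iff by (intro conjI exI[of _ ?T])
  have "(speed (\<gamma> +++ \<delta>) has_integral curve_length f \<gamma>) {0..1/2}"
    by (rule speed_affine_has_integral[OF \<gamma>, where m=2 and k=0])
      (use left image_affinity_atLeastAtMost[of "1/2::real" 0 0 1] in auto)
  moreover have "(speed (\<gamma> +++ \<delta>) has_integral curve_length f \<delta>) {1/2..1}"
    by (rule speed_affine_has_integral[OF \<delta>, where m=2 and k="-1"])
      (use right image_affinity_atLeastAtMost[of "1/2::real" "1/2" 0 1] in \<open>auto simp: add_divide_distrib\<close>)
  ultimately have "(speed (\<gamma> +++ \<delta>) has_integral curve_length f \<gamma> + curve_length f \<delta>) {0..1}"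
    by (intro has_integral_combine[of 0 "1/2" 1]) auto
  then show "curve_length f (\<gamma> +++ \<delta>) = curve_length f \<gamma> + curve_length f \<delta>"
    using has_integral_unique speed_has_integral[OF j] by blast
qed

end

section \<open>Spherical caps\<close>

definition cap :: "real^3 \<Rightarrow> real \<Rightarrow> (real^3) set" where
  "cap u c = {x \<in> sphere 0 1. x \<bullet> u > c}"

lemma cap_eq: "cap u c = sphere 0 1 \<inter> {x. x \<bullet> u > c}"
  by (auto simp: cap_def)

lemma open_halfspace: "open {x::real^3. x \<bullet> u > c}"
  using open_halfspace_gt[of c u] by (simp add: inner_commute)

lemma cap_mono: "c \<le> c' \<Longrightarrow> cap u c' \<subseteq> cap u c"
  by (auto simp: cap_def)

lemma dist_unit:
  fixes x u :: "'a::real_inner" assumes "norm x = 1" "norm u = 1"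
  shows "(dist x u)\<^sup>2 = 2 - 2 * (x \<bullet> u)"
  using assms by (simp add: dist_norm power2_norm_eq_inner inner_diff_left inner_diff_right norm_eq_1
      inner_commute[of u x])

lemma dist_less_if_cap:
  assumes "norm u = 1" "x \<in> cap u (1 - \<delta>\<^sup>2 / 2)" "\<delta> > 0"
  shows "dist u x < \<delta>"
proof -
  have "(dist x u)\<^sup>2 < \<delta>\<^sup>2" using assms dist_unit[of x u] by (simp add: cap_def)
  then show ?thesis using assms(3) power_less_imp_less_base[of "dist x u" 2 \<delta>] by (simp add: dist_commute)
qed

text \<open>For nonnegative \<open>c\<close> the cone over a cap, \<open>{z. z \<bullet> u > c |z|}\<close>, is convex because the norm is.  So the
  intersection of two caps is the radial projection of a convex set.\<close>

lemma connected_cap_Int: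
  assumes "0 \<le> c" "0 \<le> d"
  shows "connected (cap u c \<inter> cap v d)"
proof -
  let ?C = "{z::real^3. z \<bullet> u > c * norm z \<and> z \<bullet> v > d * norm z}"
  have conv: "convex {z::real^3. z \<bullet> u > c * norm z}" if "0 \<le> c" for u c
  proof (rule convexI)
    fix x z :: "real^3" and s t :: real
    assume *: "x \<in> {z. z \<bullet> u > c * norm z}" "z \<in> {z. z \<bullet> u > c * norm z}" "0 \<le> s" "0 \<le> t" "s + t = 1"
    have "norm (s *\<^sub>R x + t *\<^sub>R z) \<le> s * norm x + t * norm z"
      using norm_triangle_ineq[of "s *\<^sub>R x" "t *\<^sub>R z"] *(3,4) by simp
    then have "c * norm (s *\<^sub>R x + t *\<^sub>R z) \<le> c * (s * norm x + t * norm z)"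
      by (rule mult_left_mono) (rule that)
    also have "\<dots> = s * (c * norm x) + t * (c * norm z)" by (simp add: algebra_simps)
    also have "\<dots> < s * (x \<bullet> u) + t * (z \<bullet> u)"
    proof (cases "s = 0")
      case True
      then show ?thesis using * by simp
    next
      case False
      then have "s * (c * norm x) < s * (x \<bullet> u)" using * by simp
      moreover have "t * (c * norm z) \<le> t * (z \<bullet> u)" using * by (simp add: mult_left_mono)
      ultimately show ?thesis by simp
    qed
    finally show "s *\<^sub>R x + t *\<^sub>R z \<in> {z. z \<bullet> u > c * norm z}" by (simp add: inner_add_left)
  qed
  have "?C = {z. z \<bullet> u > c * norm z} \<inter> {z. z \<bullet> v > d * norm z}" by auto
  then have "convex ?C" using conv assms by (simp add: convex_Int)
  then have "connected ?C" by (rule convex_connected)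
  moreover have nz: "z \<noteq> 0" if "z \<in> ?C" for z using that by auto
  ultimately have "connected (sgn ` ?C)"
    by (intro connected_continuous_image continuous_on_sgn) (auto intro: continuous_intros)
  moreover have "sgn ` ?C = cap u c \<inter> cap v d"
  proof
    show "sgn ` ?C \<subseteq> cap u c \<inter> cap v d"
      using nz by (auto simp: cap_def norm_sgn sgn_div_norm field_simps)
    show "cap u c \<inter> cap v d \<subseteq> sgn ` ?C"
    proof
      fix z assume "z \<in> cap u c \<inter> cap v d"
      then have "norm z = 1" "z \<in> ?C" by (auto simp: cap_def)
      then show "z \<in> sgn ` ?C" by (intro image_eqI[of _ _ z]) (auto simp: sgn_div_norm)
    qed
  qed
  ultimately show ?thesis by simp
qed

text \<open>If \<open>c = cos \<theta>\<close> with \<open>0 \<le> \<theta> \<le> \<pi>\<close>, this is \<open>cos (\<theta>/2)\<close>: the passage from a cap to the one with the same centre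
  and half the angular radius.\<close>

definition half_cos :: "real \<Rightarrow> real" where
  "half_cos c = sqrt ((1 + c) / 2)"

lemma half_cos:
  assumes "-1 \<le> c" "c < 1"
  shows "0 \<le> half_cos c" "half_cos c < 1" "1 - half_cos c \<le> (1 - c) / 2"
proof -
  show 0: "0 \<le> half_cos c" using assms by (simp add: half_cos_def)
  show 1: "half_cos c < 1" using assms by (simp add: half_cos_def)
  have sq: "(half_cos c)\<^sup>2 = (1 + c) / 2" using assms by (simp add: half_cos_def)
  have "(1 - c) / 2 - (1 - half_cos c) = (1 - half_cos c) * half_cos c"
    using sq by (simp add: power2_eq_square field_simps)
  moreover have "(1 - half_cos c) * half_cos c \<ge> 0" using 0 1 by simp
  ultimately show "1 - half_cos c \<le> (1 - c) / 2" by linarith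
qed

text \<open>The point \<open>m\<close> is the midpoint of the great circle arc from \<open>u\<close> to \<open>z\<close>.\<close>

lemma midpoint_cap:
  assumes u: "norm u = 1" and c: "-1 \<le> c" and z: "z \<in> cap u c"
  obtains m where "m \<in> cap u (half_cos c)" "z \<in> cap m (half_cos c)"
proof -
  have z: "norm z = 1" "z \<bullet> u > c" using z by (auto simp: cap_def)
  define h where "h = (1 + z \<bullet> u) / 2"
  have h: "h > (1 + c) / 2" "h > 0" using z c by (auto simp: h_def)
  define w where "w = z + u"
  have ww: "w \<bullet> w = 4 * h"
    using u z by (simp add: w_def h_def inner_add_left inner_add_right norm_eq_1 inner_commute[of u z])
  have nw: "norm w = 2 * sqrt h" unfolding norm_eq_sqrt_inner ww by (simp add: real_sqrt_mult)
  have wu: "w \<bullet> u = 2 * h" "z \<bullet> w = 2 * h"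
    using u z by (simp_all add: w_def h_def inner_add_left inner_add_right norm_eq_1 inner_commute[of u z])
  have "2 * h / norm w = sqrt h" using h(2) unfolding nw by (simp add: real_div_sqrt)
  then have m: "sgn w \<bullet> u = sqrt h" "z \<bullet> sgn w = sqrt h"
    using wu by (simp_all add: sgn_div_norm divide_inverse mult.commute)
  have "half_cos c < sqrt h" unfolding half_cos_def using h(1) by simp
  moreover have "norm (sgn w) = 1" using nw h(2) by (auto simp: norm_sgn)
  ultimately show ?thesis using m z(1) by (intro that[of "sgn w"]) (auto simp: cap_def)
qed

text \<open>Radial projection identifies the open hemisphere with a plane, and a plane without a point is connected.\<close>

lemma connected_cap_minus_point:
  assumes w: "norm w = 1" and b: "b \<in> cap w 0"
  shows "connected (cap w 0 - {b})"
proof -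
  let ?H = "{z::real^3. z \<bullet> w = 1}"
  have H: "?H = {z. w \<bullet> z = 1}" by (auto simp: inner_commute)
  have "\<not> collinear ?H"
    unfolding collinear_aff_dim H using w by (subst aff_dim_hyperplane) auto
  moreover have "convex ?H" unfolding H by (rule convex_hyperplane)
  ultimately have "connected (?H - {(1 / (b \<bullet> w)) *\<^sub>R b})"
    by (intro connected_convex_diff_countable) auto
  moreover have nz: "z \<noteq> 0" if "z \<in> ?H" for z using that by auto
  ultimately have "connected (sgn ` (?H - {(1 / (b \<bullet> w)) *\<^sub>R b}))"
    by (intro connected_continuous_image continuous_on_sgn) (auto intro: continuous_intros)
  moreover have "sgn ` (?H - {(1 / (b \<bullet> w)) *\<^sub>R b}) = cap w 0 - {b}"
  proof
    show "sgn ` (?H - {(1 / (b \<bullet> w)) *\<^sub>R b}) \<subseteq> cap w 0 - {b}"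
    proof (rule image_subsetI)
      fix z assume z: "z \<in> ?H - {(1 / (b \<bullet> w)) *\<^sub>R b}"
      then have zw: "z \<bullet> w = 1" and "z \<noteq> 0" by auto
      then have "sgn z \<in> cap w 0" by (simp add: cap_def norm_sgn sgn_div_norm)
      moreover have "sgn z \<noteq> b"
      proof
        assume "sgn z = b"
        then have b': "b = inverse (norm z) *\<^sub>R z" by (simp add: sgn_div_norm)
        then have "b \<bullet> w = inverse (norm z)" using zw by simp
        then have "(1 / (b \<bullet> w)) *\<^sub>R b = z" using b' \<open>z \<noteq> 0\<close> by simp
        then show False using z by simp
      qed
      ultimately show "sgn z \<in> cap w 0 - {b}" by simp
    qed
    show "cap w 0 - {b} \<subseteq> sgn ` (?H - {(1 / (b \<bullet> w)) *\<^sub>R b})"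
    proof
      fix z assume z: "z \<in> cap w 0 - {b}"
      then have zw: "norm z = 1" "z \<bullet> w > 0" by (auto simp: cap_def)
      have bw: "norm b = 1" "b \<bullet> w > 0" using b by (auto simp: cap_def)
      let ?z = "(1 / (z \<bullet> w)) *\<^sub>R z"
      have sg: "sgn ((1 / (x \<bullet> w)) *\<^sub>R x) = x" if "norm x = 1" "x \<bullet> w > 0" for x
        using that by (simp add: sgn_scaleR sgn_div_norm)
      have "?z \<noteq> (1 / (b \<bullet> w)) *\<^sub>R b"
      proof
        assume "?z = (1 / (b \<bullet> w)) *\<^sub>R b"
        then have "sgn ?z = sgn ((1 / (b \<bullet> w)) *\<^sub>R b)" by (rule arg_cong)
        then show False using sg[OF zw] sg[OF bw] z by simp
      qed
      moreover have "?z \<in> ?H" using zw by simp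
      ultimately show "z \<in> sgn ` (?H - {(1 / (b \<bullet> w)) *\<^sub>R b})"
        using sg[OF zw] by (intro image_eqI[of _ _ ?z]) auto
    qed
  qed
  ultimately show ?thesis by simp
qed

text \<open>The arc is the radial projection of the segment from \<open>u\<close> to \<open>x\<close>.  As the angle between the two vectors is less than
  \<open>\<pi>/2\<close>, the segment \<open>w\<close> stays at distance at least \<open>2/3\<close> from the origin.  The derivative of \<open>w / |w|\<close> has two
  terms of norm at most \<open>|w'| / |w|\<close>, whence the constant \<open>3 = 2 * (3/2)\<close>.\<close>

lemma cap_arc:
  fixes u x :: "real^3"
  assumes u: "norm u = 1" and c: "0 \<le> c" "c < 1" and x: "x \<in> cap u c"
  obtains g g' where "g 0 = u" "g 1 = x" "g ` {0..1} \<subseteq> cap u c" "continuous_on {0..1} g'"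
    "\<And>t. t \<in> {0..1} \<Longrightarrow> (g has_vector_derivative g' t) (at t) \<and> norm (g' t) \<le> 3 * dist u x"
proof -
  have x: "norm x = 1" "x \<bullet> u > c" using x by (auto simp: cap_def)
  define w where "w t = (1 - t) *\<^sub>R u + t *\<^sub>R x" for t :: real
  have w_norm: "norm (w t) > 0" "inverse (norm (w t)) \<le> 3/2" "norm (w t) \<le> 1" if t: "t \<in> {0..1}" for t
  proof -
    have "(norm (w t))\<^sup>2 = (1 - t)\<^sup>2 + t\<^sup>2 + 2 * t * (1 - t) * (x \<bullet> u)"
      using u x(1) unfolding power2_norm_eq_inner w_def
      by (simp add: inner_add_left inner_add_right norm_eq_1 inner_commute[of u x] power2_eq_square)
        (simp add: algebra_simps)
    moreover have "2 * t * (1 - t) * (x \<bullet> u) \<ge> 0" using t x(2) c by simp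
    moreover have "(1 - t)\<^sup>2 + t\<^sup>2 = 1/2 + 2 * (t - 1/2)\<^sup>2" by (simp add: power2_eq_square algebra_simps)
    moreover have "2 * (t - 1/2)\<^sup>2 \<ge> 0" by simp
    ultimately have "(norm (w t))\<^sup>2 \<ge> 1/2" by linarith
    then have "(2/3)\<^sup>2 \<le> (norm (w t))\<^sup>2" by (simp add: power2_eq_square)
    then have "2/3 \<le> norm (w t)" by (rule power2_le_imp_le) simp
    then show "norm (w t) > 0" "inverse (norm (w t)) \<le> 3/2"
      using le_imp_inverse_le[of "2/3" "norm (w t)"] by auto
    have "norm (w t) \<le> (1 - t) * norm u + t * norm x"
      unfolding w_def using norm_triangle_ineq[of "(1 - t) *\<^sub>R u" "t *\<^sub>R x"] t by simp
    then show "norm (w t) \<le> 1" using u x by simp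
  qed
  define g where "g t = inverse (norm (w t)) *\<^sub>R w t" for t
  define g' where "g' t = inverse (norm (w t)) *\<^sub>R (x - u) -
     (inverse (norm (w t)) ^ 3 * (w t \<bullet> (x - u))) *\<^sub>R w t" for t
  have dw: "(w has_vector_derivative (x - u)) (at t)" for t
    unfolding w_def[abs_def] by (auto intro!: derivative_eq_intros simp: algebra_simps)
  have contw: "continuous_on {0..1} w" unfolding w_def[abs_def] by (intro continuous_intros)
  show ?thesis
  proof (rule that[of g g'])
    show "g 0 = u" "g 1 = x" using u x by (simp_all add: g_def w_def)
    show "g ` {0..1} \<subseteq> cap u c"
    proof (rule image_subsetI)
      fix t :: real assume t: "t \<in> {0..1}"
      have "norm (g t) = 1" using w_norm(1)[OF t] by (simp add: g_def)
      moreover have "c < g t \<bullet> u"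
      proof -
        have "w t \<bullet> u = (1 - t) * 1 + t * (x \<bullet> u)" using u by (simp add: w_def inner_add_left norm_eq_1)
        moreover have "c < (1 - t) * 1 + t * (x \<bullet> u)"
        proof (cases "t = 0")
          case False
          have "t * c < t * (x \<bullet> u)" using t False x(2) by simp
          moreover have "(1 - t) * c \<le> (1 - t) * 1" by (rule mult_left_mono) (use t c in auto)
          ultimately show ?thesis by (simp add: algebra_simps)
        qed (use c in simp)
        ultimately have wu: "c < w t \<bullet> u" by simp
        have "1 \<le> inverse (norm (w t))" using w_norm(1,3)[OF t] by (simp add: one_le_inverse)
        then have "w t \<bullet> u \<le> inverse (norm (w t)) * (w t \<bullet> u)"
          using wu c(1) by (simp add: mult_le_cancel_right1)
        then show ?thesis using wu by (simp add: g_def)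
      qed
      ultimately show "g t \<in> cap u c" by (simp add: cap_def)
    qed
    show "continuous_on {0..1} g'"
      unfolding g'_def[abs_def] using w_norm(1) by (intro continuous_intros contw) (auto simp: less_imp_neq)
    fix t :: real assume t: "t \<in> {0..1}"
    have w0: "w t \<noteq> 0" using w_norm(1)[OF t] by auto
    have "((\<lambda>t. norm (w t)) has_real_derivative (w t \<bullet> (x - u)) / norm (w t)) (at t)"
    proof -
      have "((\<lambda>t. norm (w t)) has_derivative (\<lambda>h. sgn (w t) \<bullet> (h *\<^sub>R (x - u)))) (at t)"
        using has_derivative_compose[OF dw[of t, unfolded has_vector_derivative_def] has_derivative_norm[OF w0]]
        by (simp add: inner_commute)
      then show ?thesis
        unfolding has_field_derivative_def
        by (rule has_derivative_eq_rhs)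
          (simp add: fun_eq_iff sgn_div_norm divide_inverse inner_diff_right algebra_simps)
    qed
    then have "((\<lambda>t. inverse (norm (w t))) has_real_derivative
        - (inverse (norm (w t)) * ((w t \<bullet> (x - u)) / norm (w t)) * inverse (norm (w t)))) (at t)"
      by (rule DERIV_inverse') (use w0 in simp)
    from has_vector_derivative_scaleR[OF this dw]
    have "(g has_vector_derivative g' t) (at t)"
      unfolding g_def[abs_def] g'_def by (rule has_vector_derivative_eq_rhs)
        (simp add: divide_inverse power3_eq_cube ac_simps)
    moreover have "norm (g' t) \<le> 3 * dist u x"
    proof -
      let ?i = "inverse (norm (w t))"
      have "\<bar>w t \<bullet> (x - u)\<bar> \<le> norm (w t) * norm (x - u)" by (rule Cauchy_Schwarz_ineq2)
      then have "norm ((?i ^ 3 * (w t \<bullet> (x - u))) *\<^sub>R w t) \<le> ?i ^ 3 * (norm (w t) * norm (x - u)) * norm (w t)"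
        using w_norm(1)[OF t] by (auto simp: abs_mult mult.commute[of "norm (x - u)"] intro!: mult_right_mono mult_left_mono)
      also have "\<dots> = ?i * norm (x - u)"
        using w_norm(1)[OF t] by (simp add: power3_eq_cube field_simps)
      finally have "norm ((?i ^ 3 * (w t \<bullet> (x - u))) *\<^sub>R w t) \<le> ?i * norm (x - u)" .
      moreover have "norm (?i *\<^sub>R (x - u)) = ?i * norm (x - u)" by simp
      ultimately have "norm (g' t) \<le> ?i * norm (x - u) + ?i * norm (x - u)"
        unfolding g'_def by (intro order_trans[OF norm_triangle_ineq4] add_mono) simp_all
      also have "\<dots> \<le> 3/2 * norm (x - u) + 3/2 * norm (x - u)"
        using w_norm(2)[OF t] by (intro add_mono mult_right_mono) auto
      finally show ?thesis by (simp add: dist_norm norm_minus_commute)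
    qed
    ultimately show "(g has_vector_derivative g' t) (at t) \<and> norm (g' t) \<le> 3 * dist u x" ..
  qed
qed

text \<open>Only local extensions of \<open>h\<close> are differentiable, and they differ from point to point.  The derivative of the
  composition along the interval, however, is unique, so the local formulas for it fit together.\<close>

lemma C1_on_interval_smooth_comp:
  fixes h :: "'b::euclidean_space \<Rightarrow> real^2"
  assumes h: "smooth_on S h" and ab: "a < b" and im: "g ` {a..b} \<subseteq> S"
    and g: "continuous_on {a..b} g'" "\<And>t. t \<in> {a..b} \<Longrightarrow> (g has_vector_derivative g' t) (at t)"
  shows "C1_on_interval (h \<circ> g) a b"
proof -
  define D where "D t = vector_derivative (h \<circ> g) (at t within {a..b})" for t
  have cg: "continuous_on {a..b} g"
    using g(2) by (meson continuous_at_imp_continuous_on has_vector_derivative_continuous)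
  have loc: "\<exists>A k. open A \<and> t \<in> A \<and> continuous_on (A \<inter> {a..b}) k \<and>
      (\<forall>s\<in>A \<inter> {a..b}. ((h \<circ> g) has_vector_derivative k s) (at s within {a..b}))" if t: "t \<in> {a..b}" for t
  proof -
    have "g t \<in> S" using im t by auto
    then obtain W H where W: "open W" "g t \<in> W" "\<forall>k. C_k k H W" "\<forall>z. z \<in> S \<longrightarrow> z \<in> W \<longrightarrow> H z = h z"
      using smooth_onE[OF h] by metis
    obtain A where A: "open A" "A \<inter> {a..b} = g -` W \<inter> {a..b}"
      using cg W(1) unfolding continuous_on_open_invariant by metis
    have gW: "g s \<in> W" if "s \<in> A \<inter> {a..b}" for s using that unfolding A(2) by simp
    have "t \<in> g -` W \<inter> {a..b}" using W(2) t by simp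
    then have "t \<in> A" unfolding A(2)[symmetric] by simp
    let ?k = "\<lambda>s. frechet_derivative H (at (g s)) (g' s)"
    have HD: "(H has_derivative frechet_derivative H (at z)) (at z)" if "z \<in> W" for z
      using C_k_SucE[OF _ that, of 0 H] W(3) by blast
    have vd: "((h \<circ> g) has_vector_derivative ?k s) (at s within {a..b})" if s: "s \<in> A \<inter> {a..b}" for s
    proof -
      have "(H has_derivative frechet_derivative H (at (g s))) (at (g s) within g ` {a..b})"
        by (rule has_derivative_at_withinI[OF HD[OF gW[OF s]]])
      then have "((H \<circ> g) has_vector_derivative ?k s) (at s within {a..b})"
        using g(2) s by (intro vector_derivative_diff_chain_within) (auto intro: has_vector_derivative_at_within)
      then have "((H \<circ> g) has_vector_derivative ?k s) (at s within A \<inter> {a..b})"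
        by (rule has_vector_derivative_within_subset) simp
      then have "((h \<circ> g) has_vector_derivative ?k s) (at s within A \<inter> {a..b})"
      proof (rule has_vector_derivative_transform[OF s, rotated])
        show "(h \<circ> g) x = (H \<circ> g) x" if "x \<in> A \<inter> {a..b}" for x
        proof -
          have "g x \<in> S" using im that by blast
          then show ?thesis using gW[OF that] W(4) by simp
        qed
      qed
      moreover have "at s within A \<inter> {a..b} = at s within {a..b}"
        by (rule at_within_nhd[of s A]) (use s A(1) in auto)
      ultimately show ?thesis by simp
    qed
    have "continuous_on (A \<inter> {a..b}) ?k"
    proof -
      have e: "?k s = (\<Sum>i\<in>Basis. (g' s \<bullet> i) *\<^sub>R frechet_derivative H (at (g s)) i)" if "s \<in> A \<inter> {a..b}" for s
      proof -
        have L: "linear (frechet_derivative H (at (g s)))" using HD[OF gW[OF that]] has_derivative_linear by blast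
        have "?k s = frechet_derivative H (at (g s)) (\<Sum>i\<in>Basis. (g' s \<bullet> i) *\<^sub>R i)"
          by (simp add: euclidean_representation)
        then show ?thesis by (simp add: linear_sum[OF L] linear_scale[OF L])
      qed
      have "C_k 0 (\<lambda>z. frechet_derivative H (at z) i) W" for i
        using W(3)[rule_format, of "Suc 0"] by simp
      then have "continuous_on W (\<lambda>z. frechet_derivative H (at z) i)" for i by simp
      then have "continuous_on (A \<inter> {a..b}) (\<lambda>s. frechet_derivative H (at (g s)) i)" for i
        by (rule continuous_on_compose2[OF _ continuous_on_subset[OF cg]]) (use gW in auto)
      then show ?thesis
        using e continuous_on_subset[OF g(1)]
        by (subst continuous_on_cong[OF refl e]) (auto intro!: continuous_intros)
    qed
    then show ?thesis using A(1) \<open>t \<in> A\<close> vd by (intro exI[of _ A] exI[of _ ?k]) auto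
  qed
  have vd: "((h \<circ> g) has_vector_derivative D t) (at t within {a..b})" if "t \<in> {a..b}" for t
  proof -
    have "(h \<circ> g) differentiable (at t within {a..b})"
      using loc[OF that] that unfolding has_vector_derivative_def differentiable_def by blast
    then show ?thesis unfolding D_def by (simp add: vector_derivative_works)
  qed
  moreover have "continuous_on {a..b} D"
    unfolding continuous_on_eq_continuous_within
  proof
    fix t assume t: "t \<in> {a..b}"
    obtain A k where A: "open A" "t \<in> A" "continuous_on (A \<inter> {a..b}) k"
      "\<forall>s\<in>A \<inter> {a..b}. ((h \<circ> g) has_vector_derivative k s) (at s within {a..b})"
      using loc[OF t] by blast
    have e: "k s = D s" if "s \<in> A \<inter> {a..b}" for s
      unfolding D_def using that A(4) ab
      by (intro vector_derivative_within_closed_interval[symmetric]) auto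
    have "continuous_on (A \<inter> {a..b}) D" by (rule continuous_on_eq[OF A(3) e])
    then have "continuous (at t within A \<inter> {a..b}) D"
      using A(2) t by (simp add: continuous_on_eq_continuous_within)
    moreover have "at t within A \<inter> {a..b} = at t within {a..b}"
      by (rule at_within_nhd[of t A]) (use t A in auto)
    ultimately show "continuous (at t within {a..b}) D" by simp
  qed
  ultimately show ?thesis unfolding C1_on_interval_def by blast
qed

lemma continuous_on_locally:
  fixes C :: "'a::t2_space set" and s :: "'a \<Rightarrow> 'b::topological_space"
  assumes "\<And>x. x \<in> C \<Longrightarrow> \<exists>A. open A \<and> x \<in> A \<and> continuous_on (C \<inter> A) s"
  shows "continuous_on C s"
  unfolding continuous_on_eq_continuous_within
proof
  fix x assume x: "x \<in> C"
  obtain A where A: "open A" "x \<in> A" "continuous_on (C \<inter> A) s" using assms[OF x] by blast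
  then have "continuous (at x within C \<inter> A) s" using x by (simp add: continuous_on_eq_continuous_within)
  moreover have "at x within C \<inter> A = at x within C"
    by (rule at_within_nhd[of x A]) (use x A in auto)
  ultimately show "continuous (at x within C) s" by simp
qed

context spherical_development
begin

section \<open>Sections over caps\<close>

definition section_on :: "(real^3) set \<Rightarrow> (real^3 \<Rightarrow> 'a) \<Rightarrow> bool" where
  "section_on C s \<longleftrightarrow> continuous_on C s \<and> s ` C \<subseteq> M \<and> (\<forall>x\<in>C. y (s x) = x)"

lemma section_on_subset: "section_on C s \<Longrightarrow> C' \<subseteq> C \<Longrightarrow> section_on C' s"
  by (auto simp: section_on_def intro: continuous_on_subset)

lemma section_onD:
  assumes "section_on C s"
  shows "continuous_on C s" "x \<in> C \<Longrightarrow> s x \<in> M" "x \<in> C \<Longrightarrow> y (s x) = x"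
  using assms by (auto simp: section_on_def)

lemma sections_agree:
  assumes s: "section_on C s" "section_on C' s'" and K: "connected K" "K \<subseteq> C" "K \<subseteq> C'"
    and a: "a \<in> K" "s a = s' a" and b: "b \<in> K"
  shows "s b = s' b"
proof -
  have sK: "section_on K s" "section_on K s'" using section_on_subset s K(2,3) by simp_all
  show ?thesis
    by (rule lifts_agree[OF K(1) section_onD(1)[OF sK(1)] section_onD(1)[OF sK(2)] _ _ a b])
      (use section_onD[OF sK(1)] section_onD[OF sK(2)] in auto)
qed

text \<open>A continuous section coincides locally with the smooth local inverse of \<open>y\<close>.\<close>

lemma section_smooth:
  assumes s: "section_on C s" and C: "C \<subseteq> sphere 0 1" and V: "(V, \<psi>) \<in> \<A>"
  shows "smooth_on (C \<inter> s -` V) (\<psi> \<circ> s)"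
proof (rule smooth_on_local)
  fix x assume x: "x \<in> C \<inter> s -` V"
  then have sM: "s x \<in> M" "y (s x) = x" using s by (auto simp: section_on_def)
  obtain U0 \<phi> U W K where U: "(U0, \<phi>) \<in> \<A>" "open U" "s x \<in> U" "U \<subseteq> U0" "open W" "y (s x) \<in> W"
    "homeomorphism U (sphere 0 1 \<inter> W) y (inv_into U0 \<phi> \<circ> K)" "smooth_on W K" "K ` W \<subseteq> \<phi> ` U0"
    by (rule local_section[OF sM(1)])
  have "open (U \<inter> V)" using U(2) chart_open(1)[OF V] by blast
  then obtain A where A: "open A" "A \<inter> C = s -` (U \<inter> V) \<inter> C"
    using s unfolding section_on_def continuous_on_open_invariant by metis
  have "x \<in> s -` (U \<inter> V) \<inter> C" using x U(3) by simp
  then have "x \<in> A" unfolding A(2)[symmetric] by simp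
  let ?S = "C \<inter> s -` V \<inter> (A \<inter> W)"
  have s_eq: "s w = inv_into U0 \<phi> (K w)" "K w \<in> \<phi> ` (U0 \<inter> V)" if w: "w \<in> ?S" for w
  proof -
    have "w \<in> A \<inter> C" using w by simp
    then have sU: "s w \<in> U" "s w \<in> V" unfolding A(2) by simp_all
    have "y (s w) = w" using s w by (simp add: section_on_def)
    then show e: "s w = inv_into U0 \<phi> (K w)"
      using homeomorphism_apply1[OF U(7) sU(1)] by simp
    have "K w \<in> \<phi> ` U0" using U(9) w by blast
    then have "K w = \<phi> (s w)" unfolding e by (rule chart_inv(1)[symmetric])
    then show "K w \<in> \<phi> ` (U0 \<inter> V)" using sU U(4) by blast
  qed
  have "smooth_on ?S ((\<psi> \<circ> inv_into U0 \<phi>) \<circ> K)"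
  proof (rule smooth_on_compose)
    show "smooth_on ?S K" by (rule smooth_on_subset[OF U(8)]) blast
    show "smooth_on (\<phi> ` (U0 \<inter> V)) (\<psi> \<circ> inv_into U0 \<phi>)"
      using smooth_on_open_iff[OF chart_image_open[OF U(1) chart_open(1)[OF V]]] transition_smooth[OF U(1) V] by blast
    show "K ` ?S \<subseteq> \<phi> ` (U0 \<inter> V)" using s_eq(2) by blast
  qed
  then have "smooth_on ?S (\<psi> \<circ> s)" by (rule smooth_on_cong) (simp add: s_eq(1)[symmetric])
  moreover have "open (A \<inter> W)" "x \<in> A \<inter> W" using A(1) U(5,6) \<open>x \<in> A\<close> sM(2) by auto
  ultimately show "\<exists>N. open N \<and> x \<in> N \<and> smooth_on (C \<inter> s -` V \<inter> N) (\<psi> \<circ> s)" by blast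
qed

text \<open>The cosine \<open>c\<close> of the angular radius serves as parameter: \<open>c = 0\<close> is a hemisphere, and \<open>c = -1\<close> is the sphere
  without the antipode of \<open>y p\<close>.\<close>

definition has_cap_section :: "'a \<Rightarrow> real \<Rightarrow> bool" where
  "has_cap_section p c \<longleftrightarrow> (\<exists>s. section_on (cap (y p) c) s \<and> s (y p) = p)"

lemma has_cap_section_mono: "has_cap_section p c \<Longrightarrow> c \<le> c' \<Longrightarrow> has_cap_section p c'"
  unfolding has_cap_section_def using section_on_subset cap_mono by blast

lemma center_cap: "p \<in> M \<Longrightarrow> c < 1 \<Longrightarrow> y p \<in> cap (y p) c"
  using y_sphere[of p] by (simp add: cap_def norm_eq_1)

lemma local_cap_section:
  assumes p: "p \<in> M"
  obtains c s N where "0 \<le> c" "c < 1" "section_on (cap (y p) c) s" "s (y p) = p"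
    "open N" "p \<in> N" "\<And>q. q \<in> N \<Longrightarrow> y q \<in> cap (y p) c \<and> s (y q) = q"
proof -
  obtain U0 \<phi> U W K where U: "(U0, \<phi>) \<in> \<A>" "open U" "p \<in> U" "U \<subseteq> U0" "open W" "y p \<in> W"
    "homeomorphism U (sphere 0 1 \<inter> W) y (inv_into U0 \<phi> \<circ> K)" "smooth_on W K" "K ` W \<subseteq> \<phi> ` U0"
    by (rule local_section[OF p])
  obtain d where d: "d > 0" "ball (y p) d \<subseteq> W" using U(5,6) open_contains_ball_eq by blast
  define e where "e = min d 1"
  have e: "e > 0" "e \<le> 1" "e \<le> d" using d by (auto simp: e_def)
  let ?c = "1 - e\<^sup>2 / 2"
  have "e\<^sup>2 \<le> 1" using e by (simp add: power_le_one)
  then have c: "0 \<le> ?c" "?c < 1" using e(1) by auto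
  have sub: "cap (y p) ?c \<subseteq> sphere 0 1 \<inter> W"
  proof
    fix x assume x: "x \<in> cap (y p) ?c"
    then have "dist (y p) x < e" using dist_less_if_cap y_sphere[OF p] e(1) by blast
    then show "x \<in> sphere 0 1 \<inter> W" using x d(2) e(3) by (auto simp: cap_def)
  qed
  have "section_on (sphere 0 1 \<inter> W) (inv_into U0 \<phi> \<circ> K)"
    unfolding section_on_def
  proof (intro conjI)
    show "continuous_on (sphere 0 1 \<inter> W) (inv_into U0 \<phi> \<circ> K)"
      using U(7) by (simp only: homeomorphism_def)
    have "(inv_into U0 \<phi> \<circ> K) ` (sphere 0 1 \<inter> W) = U" using U(7) by (simp only: homeomorphism_def)
    then show "(inv_into U0 \<phi> \<circ> K) ` (sphere 0 1 \<inter> W) \<subseteq> M" using U(4) chart_subset[OF U(1)] by blast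
    show "\<forall>x\<in>sphere 0 1 \<inter> W. y ((inv_into U0 \<phi> \<circ> K) x) = x"
      using homeomorphism_apply2[OF U(7)] by blast
  qed
  moreover have "(inv_into U0 \<phi> \<circ> K) (y p) = p" by (rule homeomorphism_apply1[OF U(7,3)])
  ultimately have s: "section_on (cap (y p) ?c) (inv_into U0 \<phi> \<circ> K)" "(inv_into U0 \<phi> \<circ> K) (y p) = p"
    using section_on_subset[OF _ sub] by blast+
  let ?N = "U \<inter> y -` {x. x \<bullet> y p > ?c}"
  have "open ?N"
    using homeomorphism_cont1[OF U(7)] U(2) open_halfspace by (rule continuous_open_preimage)
  moreover have "p \<in> ?N" using U(3) center_cap[OF p c(2)] by (simp add: cap_def)
  moreover have "y q \<in> cap (y p) ?c \<and> (inv_into U0 \<phi> \<circ> K) (y q) = q" if q: "q \<in> ?N" for q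
  proof
    have "q \<in> M" using q U(4) chart_subset[OF U(1)] by blast
    then show "y q \<in> cap (y p) ?c" using y_sphere[of q] q by (simp add: cap_def)
    show "(inv_into U0 \<phi> \<circ> K) (y q) = q" using homeomorphism_apply1[OF U(7)] q by blast
  qed
  ultimately show ?thesis using that[OF c s] by blast
qed

section \<open>The Riemannian distance\<close>

lemma section_arc:
  assumes s: "section_on (cap u c) s" and u: "norm u = 1" and c: "0 \<le> c" "c < 1" and x: "x \<in> cap u c"
  obtains \<gamma> where "piecewise_C1_curve \<A> \<gamma>" "pathstart \<gamma> = s u" "pathfinish \<gamma> = s x"
    "curve_length f \<gamma> \<le> 3 * dist u x"
proof -
  obtain g g' where g: "g 0 = u" "g 1 = x" "g ` {0..1} \<subseteq> cap u c" "continuous_on {0..1} g'"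
    "\<And>t. t \<in> {0..1} \<Longrightarrow> (g has_vector_derivative g' t) (at t) \<and> norm (g' t) \<le> 3 * dist u x"
    using cap_arc[OF u c x] by blast
  let ?\<gamma> = "s \<circ> g"
  have cs: "continuous_on (cap u c) s" "s ` cap u c \<subseteq> M" "\<And>x. x \<in> cap u c \<Longrightarrow> y (s x) = x"
    using s by (auto simp: section_on_def)
  have "continuous_on {0..1} g"
    using g(5) by (meson continuous_at_imp_continuous_on has_vector_derivative_continuous)
  then have path: "path ?\<gamma>"
    unfolding path_def by (rule continuous_on_compose) (rule continuous_on_subset[OF cs(1) g(3)])
  have img: "path_image ?\<gamma> \<subseteq> M" using g(3) cs(2) by (auto simp: path_image_def)
  have "C1_apart_from {} ?\<gamma>"
  proof (rule C1_apart_fromI)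
    fix V \<psi> a b assume V: "(V, \<psi>) \<in> \<A>" and ab: "0 \<le> a" "a < b" "b \<le> (1::real)" and sub: "?\<gamma> ` {a..b} \<subseteq> V"
    have sm: "smooth_on (cap u c \<inter> s -` V) (\<psi> \<circ> s)"
      by (rule section_smooth[OF s _ V]) (auto simp: cap_def)
    have "C1_on_interval ((\<psi> \<circ> s) \<circ> g) a b"
    proof (rule C1_on_interval_smooth_comp[OF sm ab(2)])
      show "g ` {a..b} \<subseteq> cap u c \<inter> s -` V" using g(3) sub ab by fastforce
      show "continuous_on {a..b} g'" by (rule continuous_on_subset[OF g(4)]) (use ab in auto)
    qed (use g(5) ab in auto)
    then show "C1_on_interval (\<psi> \<circ> ?\<gamma>) a b" by (simp add: o_assoc)
  qed
  then have "\<exists>T. finite T \<and> C1_apart_from T ?\<gamma>" by (metis finite.emptyI)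
  then have \<gamma>: "piecewise_C1_curve \<A> ?\<gamma>" using path img piecewise_C1_curve_iff[of ?\<gamma>] by simp
  have "curve_length f ?\<gamma> \<le> 3 * dist u x"
  proof (rule curve_length_le[OF \<gamma>])
    fix t :: real assume t: "0 < t" "t < 1"
    have eq: "g z = (y \<circ> ?\<gamma>) z" if "z \<in> {0<..<1}" for z
    proof -
      have "z \<in> {0..1}" using that by simp
      then have "g z \<in> cap u c" using g(3) by blast
      then show ?thesis using cs(3) by simp
    qed
    have tI: "t \<in> {0<..<1}" "t \<in> {0..1}" using t by simp_all
    have "((y \<circ> ?\<gamma>) has_vector_derivative g' t) (at t)"
      by (rule has_vector_derivative_transform_within_open[OF conjunct1[OF g(5)[OF tI(2)]]
            open_greaterThanLessThan tI(1) eq])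
    then show "\<exists>D. ((y \<circ> ?\<gamma>) has_vector_derivative D) (at t) \<and> norm D \<le> 3 * dist u x"
      using g(5)[OF tI(2)] by blast
  qed
  then show ?thesis
    by (intro that[OF \<gamma>]) (simp_all add: pathstart_def pathfinish_def g)
qed

definition joined :: "'a \<Rightarrow> 'a \<Rightarrow> (real \<Rightarrow> 'a) \<Rightarrow> bool" where
  "joined p q \<gamma> \<longleftrightarrow> piecewise_C1_curve \<A> \<gamma> \<and> pathstart \<gamma> = p \<and> pathfinish \<gamma> = q"

lemma joined_trans:
  assumes "joined p q \<gamma>" "joined q r \<delta>"
  shows "joined p r (\<gamma> +++ \<delta>)" "curve_length f (\<gamma> +++ \<delta>) = curve_length f \<gamma> + curve_length f \<delta>"
  using assms curve_join[of \<gamma> \<delta>] unfolding joined_def by auto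

lemma joined_sym:
  assumes "joined p q \<gamma>"
  shows "joined q p (reversepath \<gamma>)" "curve_length f (reversepath \<gamma>) = curve_length f \<gamma>"
  using assms curve_reverse[of \<gamma>] unfolding joined_def by auto

text \<open>The infimum that defines the distance is taken over a nonempty set: being joined to \<open>p\<close> is a locally constant
  property.\<close>

lemma arc_connected:
  assumes "p \<in> M" "q \<in> M"
  obtains \<gamma> where "joined p q \<gamma>"
proof -
  have "(\<exists>\<gamma>. joined p q \<gamma>) = (\<exists>\<gamma>. joined p p \<gamma>)"
  proof (rule connected_local_const[OF connected_M assms(2,1)], rule ballI)
    fix a assume a: "a \<in> M"
    obtain c s N where N: "0 \<le> c" "c < 1" "section_on (cap (y a) c) s" "s (y a) = a"
      "open N" "a \<in> N" "\<And>q. q \<in> N \<Longrightarrow> y q \<in> cap (y a) c \<and> s (y q) = q"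
      by (rule local_cap_section[OF a]) blast
    have "(\<exists>\<gamma>. joined p a \<gamma>) = (\<exists>\<gamma>. joined p b \<gamma>)" if b: "b \<in> N" for b
    proof -
      have "y b \<in> cap (y a) c" using N(7)[OF b] by blast
      then obtain \<gamma> where "piecewise_C1_curve \<A> \<gamma>" "pathstart \<gamma> = s (y a)" "pathfinish \<gamma> = s (y b)"
        by (rule section_arc[OF N(3) y_sphere[OF a] N(1,2)])
      then have "joined a b \<gamma>" using N(4) N(7)[OF b] by (simp add: joined_def)
      then show ?thesis using joined_trans(1) joined_sym(1) by meson
    qed
    then show "eventually (\<lambda>b. (\<exists>\<gamma>. joined p a \<gamma>) = (\<exists>\<gamma>. joined p b \<gamma>)) (at a within M)"
      using N(5,6) unfolding eventually_at_topological by blast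
  qed
  moreover obtain \<gamma> where "joined p p \<gamma>"
  proof -
    obtain c s N where N: "0 \<le> c" "c < 1" "section_on (cap (y p) c) s" "s (y p) = p"
      "open N" "p \<in> N" "\<And>q. q \<in> N \<Longrightarrow> y q \<in> cap (y p) c \<and> s (y q) = q"
      by (rule local_cap_section[OF assms(1)]) blast
    obtain \<gamma> where "piecewise_C1_curve \<A> \<gamma>" "pathstart \<gamma> = s (y p)" "pathfinish \<gamma> = s (y p)"
      by (rule section_arc[OF N(3) y_sphere[OF assms(1)] N(1,2) center_cap[OF assms(1) N(2)]])
    then show ?thesis using that N(4) by (simp add: joined_def)
  qed
  ultimately show ?thesis using that by blast
qed

abbreviation d where "d \<equiv> riem_dist \<A> f"

lemma d_eq:
  assumes "p \<in> M" "q \<in> M" shows "d p q = Inf (curve_length f ` {\<gamma>. joined p q \<gamma>})"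
  using assms by (simp add: riem_dist_def joined_def)

lemma lengths_bdd_below: "bdd_below (curve_length f ` {\<gamma>. joined p q \<gamma>})"
  by (rule bdd_belowI[of _ 0]) (auto simp: joined_def curve_length_nonneg)

lemma d_le_length:
  assumes "p \<in> M" "q \<in> M" "joined p q \<gamma>" shows "d p q \<le> curve_length f \<gamma>"
  unfolding d_eq[OF assms(1,2)] by (rule cInf_lower[OF _ lengths_bdd_below]) (use assms(3) in auto)

lemma d_less:
  assumes "p \<in> M" "q \<in> M" "d p q < r"
  obtains \<gamma> where "joined p q \<gamma>" "curve_length f \<gamma> < r"
proof -
  obtain \<delta> where "joined p q \<delta>" by (rule arc_connected[OF assms(1,2)])
  then have "curve_length f ` {\<gamma>. joined p q \<gamma>} \<noteq> {}" by blast
  then obtain l where "l \<in> curve_length f ` {\<gamma>. joined p q \<gamma>}" "l < r"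
    using cInf_lessD[of "curve_length f ` {\<gamma>. joined p q \<gamma>}" r] assms(3) d_eq[OF assms(1,2)] by auto
  then show ?thesis using that by blast
qed

lemma d_ge_dist:
  assumes "p \<in> M" "q \<in> M" shows "dist (y p) (y q) \<le> d p q"
proof (rule ccontr)
  assume "\<not> dist (y p) (y q) \<le> d p q"
  then have "d p q < dist (y p) (y q)" by simp
  then obtain \<gamma> where "joined p q \<gamma>" "curve_length f \<gamma> < dist (y p) (y q)" by (rule d_less[OF assms])
  then show False using dist_le_curve_length[of \<gamma> 1] by (auto simp: joined_def pathstart_def pathfinish_def)
qed

lemma d_section:
  assumes s: "section_on (cap u c) s" and u: "norm u = 1" and c: "0 \<le> c" "c < 1" and x: "x \<in> cap u c"
  shows "d (s u) (s x) \<le> 3 * dist u x"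
proof -
  obtain \<gamma> where \<gamma>: "piecewise_C1_curve \<A> \<gamma>" "pathstart \<gamma> = s u" "pathfinish \<gamma> = s x"
    "curve_length f \<gamma> \<le> 3 * dist u x"
    by (rule section_arc[OF assms])
  have "u \<in> cap u c" using u c by (simp add: cap_def norm_eq_1)
  then have "s u \<in> M" "s x \<in> M" using s x by (auto simp: section_on_def)
  from d_le_length[OF this, of \<gamma>] \<gamma> show ?thesis by (simp add: joined_def)
qed

lemma y_continuous: "continuous_on M y"
proof (rule continuous_on_locally)
  fix x assume x: "x \<in> M"
  obtain U0 \<phi> U W K where U: "(U0, \<phi>) \<in> \<A>" "open U" "x \<in> U" "U \<subseteq> U0" "open W" "y x \<in> W"
    "homeomorphism U (sphere 0 1 \<inter> W) y (inv_into U0 \<phi> \<circ> K)" "smooth_on W K" "K ` W \<subseteq> \<phi> ` U0"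
    by (rule local_section[OF x])
  show "\<exists>A. open A \<and> x \<in> A \<and> continuous_on (M \<inter> A) y"
    using U(2,3) continuous_on_subset[OF homeomorphism_cont1[OF U(7)]] by (intro exI[of _ U]) auto
qed

text \<open>Let \<open>\<gamma>\<close> be a curve of length less than \<open>r\<close> from \<open>q\<close> to \<open>p\<close>.  Its image under \<open>y\<close> stays in the ball, and the
  section lifts this image to a second curve starting at \<open>q\<close>.  By uniqueness of lifts it is \<open>\<gamma>\<close>.\<close>

lemma small_ball:
  assumes q: "q \<in> M" and s: "section_on C s" "s (y q) = q" and C: "sphere 0 1 \<inter> ball (y q) r \<subseteq> C"
    and p: "p \<in> M" "d q p < r"
  shows "dist (y q) (y p) < r" "s (y p) = p"
proof -
  show "dist (y q) (y p) < r" using d_ge_dist[OF q p(1)] p(2) by simp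
  obtain \<gamma> where \<gamma>: "joined q p \<gamma>" "curve_length f \<gamma> < r" by (rule d_less[OF q p])
  have g: "piecewise_C1_curve \<A> \<gamma>" "\<gamma> 0 = q" "\<gamma> 1 = p"
    using \<gamma> by (auto simp: joined_def pathstart_def pathfinish_def)
  have path: "continuous_on {0..1} \<gamma>" "\<gamma> ` {0..1} \<subseteq> M"
    using g(1) by (auto simp: piecewise_C1_curve_def path_def path_image_def)
  have yC: "y (\<gamma> t) \<in> C" if t: "t \<in> {0..1}" for t
  proof -
    have "dist (y q) (y (\<gamma> t)) < r" using dist_le_curve_length[OF g(1) t] \<gamma>(2) g(2) by simp
    moreover have "\<gamma> t \<in> M" using path(2) t by blast
    then have "norm (y (\<gamma> t)) = 1" by (rule y_sphere)
    ultimately show ?thesis using C by auto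
  qed
  have "\<gamma> 1 = (s \<circ> (y \<circ> \<gamma>)) 1"
  proof (rule lifts_agree[of "{0..1}" _ _ 0])
    have cy: "continuous_on {0..1} (y \<circ> \<gamma>)"
      using path y_continuous by (intro continuous_on_compose) (auto intro: continuous_on_subset)
    show "continuous_on {0..1} (s \<circ> (y \<circ> \<gamma>))"
    proof (rule continuous_on_compose[OF cy])
      have "(y \<circ> \<gamma>) ` {0..1} \<subseteq> C" using yC by auto
      then show "continuous_on ((y \<circ> \<gamma>) ` {0..1}) s"
        using s(1) continuous_on_subset unfolding section_on_def by blast
    qed
    show "y (\<gamma> t) = y ((s \<circ> (y \<circ> \<gamma>)) t)" if "t \<in> {0..1}" for t
      using yC[OF that] s(1) by (simp add: section_on_def)
  qed (use path g s(2) in auto)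
  then show "s (y p) = p" using g(3) by simp
qed

text \<open>Distinct points have positive distance: the distance dominates \<open>dist (y p) (y q)\<close>, and if that vanishes,
  \<open>small_ball\<close> identifies \<open>q\<close> with the value at \<open>y p\<close> of a section through \<open>p\<close>.\<close>

lemma d_metric: "Metric_space M d"
proof
  show "0 \<le> d p q" for p q
  proof (cases "p \<in> M \<and> q \<in> M")
    case True
    then show ?thesis using d_ge_dist[of p q] zero_le_dist[of "y p" "y q"] by linarith
  qed (auto simp: riem_dist_def)
  show sym: "d p q = d q p" for p q
  proof (cases "p \<in> M \<and> q \<in> M")
    case True
    have "curve_length f ` {\<gamma>. joined p q \<gamma>} \<subseteq> curve_length f ` {\<gamma>. joined q p \<gamma>}" for p q
      using joined_sym by (metis (mono_tags) image_eqI image_subsetI mem_Collect_eq)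
    then have "curve_length f ` {\<gamma>. joined p q \<gamma>} = curve_length f ` {\<gamma>. joined q p \<gamma>}" by blast
    then show ?thesis using d_eq True by simp
  qed (auto simp: riem_dist_def)
  show "d p q = 0 \<longleftrightarrow> p = q" if pq: "p \<in> M" "q \<in> M" for p q
  proof -
    obtain c s N where N: "0 \<le> c" "c < 1" "section_on (cap (y p) c) s" "s (y p) = p"
      "open N" "p \<in> N" "\<And>q. q \<in> N \<Longrightarrow> y q \<in> cap (y p) c \<and> s (y q) = q"
      by (rule local_cap_section[OF pq(1)]) blast
    have yp: "y p \<in> {x. x \<bullet> y p > c}" using center_cap[OF pq(1) N(2)] by (simp add: cap_def)
    then obtain r where r: "r > 0" "ball (y p) r \<subseteq> {x. x \<bullet> y p > c}"
      using open_halfspace[of c "y p"] open_contains_ball_eq by blast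
    have sub: "sphere 0 1 \<inter> ball (y p) r \<subseteq> cap (y p) c" using r(2) by (auto simp: cap_def)
    have "q = p" if "d p q = 0"
    proof -
      have "y p = y q" using d_ge_dist[OF pq] that by simp
      then show ?thesis using small_ball(2)[OF pq(1) N(3,4) sub pq(2)] that r(1) N(4) by simp
    qed
    moreover have "d p p = 0"
      using d_section[OF N(3) y_sphere[OF pq(1)] N(1,2) center_cap[OF pq(1) N(2)]] d_ge_dist[OF pq(1) pq(1)]
      unfolding N(4) by simp
    ultimately show ?thesis by auto
  qed
  show "d p r \<le> d p q + d q r" if M: "p \<in> M" "q \<in> M" "r \<in> M" for p q r
  proof (rule field_le_epsilon)
    fix e :: real assume "e > 0"
    obtain \<gamma> where \<gamma>: "joined p q \<gamma>" "curve_length f \<gamma> < d p q + e / 2"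
      by (rule d_less[OF M(1,2), of "d p q + e / 2"]) (use \<open>e > 0\<close> in auto)
    obtain \<delta> where \<delta>: "joined q r \<delta>" "curve_length f \<delta> < d q r + e / 2"
      by (rule d_less[OF M(2,3), of "d q r + e / 2"]) (use \<open>e > 0\<close> in auto)
    show "d p r \<le> d p q + d q r + e"
      using d_le_length[OF M(1,3) joined_trans(1)[OF \<gamma>(1) \<delta>(1)]] joined_trans(2)[OF \<gamma>(1) \<delta>(1)] \<gamma>(2) \<delta>(2)
      by simp
  qed
qed

section \<open>Completeness yields a global section\<close>

text \<open>Every point \<open>z\<close> of the large cap lies in a half-size cap whose centre \<open>x\<close> belongs to the half-size cap around
  \<open>u = y p\<close>.  The sections over these caps through \<open>s0 x\<close> all take the value \<open>p\<close> at \<open>u\<close>, which lies in all of them;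
  since caps intersect in connected sets, any two of them agree wherever both are defined.\<close>

lemma glue_half_caps:
  assumes p: "p \<in> M" and c: "-1 \<le> c" "c < 1"
    and s0: "section_on (cap (y p) (half_cos c)) s0" "s0 (y p) = p"
    and all: "\<And>x. x \<in> cap (y p) (half_cos c) \<Longrightarrow> has_cap_section (s0 x) (half_cos c)"
  shows "has_cap_section p c"
proof -
  let ?u = "y p" and ?h = "half_cos c"
  let ?C0 = "cap ?u ?h"
  have u: "norm ?u = 1" by (rule y_sphere[OF p])
  have h: "0 \<le> ?h" "?h < 1" by (rule half_cos[OF c])+
  have ex: "\<exists>s. section_on (cap x ?h) s \<and> s x = s0 x" if x: "x \<in> ?C0" for x
    using all[OF x] section_onD(3)[OF s0(1) x] unfolding has_cap_section_def by simp
  define \<sigma> where "\<sigma> x = (SOME s. section_on (cap x ?h) s \<and> s x = s0 x)" for x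
  have \<sigma>: "section_on (cap x ?h) (\<sigma> x)" "\<sigma> x x = s0 x" if "x \<in> ?C0" for x
    using someI_ex[OF ex[OF that]] unfolding \<sigma>_def by blast+
  have sym: "?u \<in> cap x ?h" "x \<in> cap x ?h" if "x \<in> ?C0" for x
    using that u h(2) by (auto simp: cap_def inner_commute norm_eq_1)
  have \<sigma>u: "\<sigma> x ?u = p" if x: "x \<in> ?C0" for x
  proof -
    have "\<sigma> x ?u = s0 ?u"
      by (rule sections_agree[OF \<sigma>(1)[OF x] s0(1) connected_cap_Int[OF h(1) h(1), of x ?u] Int_lower1 Int_lower2,
            of x ?u])
        (use x sym[OF x] \<sigma>(2)[OF x] center_cap[OF p h(2)] in auto)
    then show ?thesis using s0(2) by simp
  qed
  have agree: "\<sigma> x z = \<sigma> x' z" if x: "x \<in> ?C0" "x' \<in> ?C0" and z: "z \<in> cap x ?h" "z \<in> cap x' ?h" for x x' z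
    by (rule sections_agree[OF \<sigma>(1)[OF x(1)] \<sigma>(1)[OF x(2)] connected_cap_Int[OF h(1) h(1), of x x']
          Int_lower1 Int_lower2, of ?u z])
      (use sym x z \<sigma>u in auto)
  define m where "m z = (SOME x. x \<in> ?C0 \<and> z \<in> cap x ?h)" for z
  have m: "m z \<in> ?C0" "z \<in> cap (m z) ?h" if z: "z \<in> cap ?u c" for z
  proof -
    obtain x where "x \<in> ?C0" "z \<in> cap x ?h" by (rule midpoint_cap[OF u c(1) z])
    then have "\<exists>x. x \<in> ?C0 \<and> z \<in> cap x ?h" by blast
    from someI_ex[OF this] show "m z \<in> ?C0" "z \<in> cap (m z) ?h" unfolding m_def by blast+
  qed
  define S where "S z = \<sigma> (m z) z" for z
  have S: "S z = \<sigma> x z" if "z \<in> cap ?u c" "x \<in> ?C0" "z \<in> cap x ?h" for z x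
    unfolding S_def by (rule agree[OF m(1)[OF that(1)] that(2) m(2)[OF that(1)] that(3)])
  have "continuous_on (cap ?u c) S"
  proof (rule continuous_on_locally)
    fix z assume z: "z \<in> cap ?u c"
    let ?A = "{w. w \<bullet> m z > ?h}"
    have sub: "cap ?u c \<inter> ?A \<subseteq> cap (m z) ?h" by (auto simp: cap_def)
    have "continuous_on (cap ?u c \<inter> ?A) S"
    proof (rule continuous_on_eq)
      show "continuous_on (cap ?u c \<inter> ?A) (\<sigma> (m z))"
        by (rule continuous_on_subset[OF section_onD(1)[OF \<sigma>(1)[OF m(1)[OF z]]] sub])
      show "\<sigma> (m z) w = S w" if "w \<in> cap ?u c \<inter> ?A" for w
        using S[OF _ m(1)[OF z], of w] that sub by auto
    qed
    moreover have "z \<in> ?A" using m(2)[OF z] by (simp add: cap_def)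
    ultimately show "\<exists>A. open A \<and> z \<in> A \<and> continuous_on (cap ?u c \<inter> A) S"
      using open_halfspace by blast
  qed
  moreover have "S z \<in> M" "y (S z) = z" if z: "z \<in> cap ?u c" for z
    using section_onD(2,3)[OF \<sigma>(1)[OF m(1)[OF z]] m(2)[OF z]] by (simp_all add: S_def)
  ultimately have "section_on (cap ?u c) S" by (auto simp: section_on_def)
  moreover have "S ?u = p"
    using S[OF center_cap[OF p c(2)] center_cap[OF p h(2)] center_cap[OF p h(2)]] \<sigma>u center_cap[OF p h(2)] by simp
  ultimately show ?thesis unfolding has_cap_section_def by blast
qed

text \<open>The contrapositive of the gluing lemma.  If there is no section through \<open>p\<close> even over the half-size cap, \<open>p\<close> itself
  is the point sought.\<close>

lemma obstruction_nearby:
  assumes p: "p \<in> M" and c: "-1 \<le> c" "c < 1" and bad: "\<not> has_cap_section p c"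
  obtains q where "q \<in> M" "\<not> has_cap_section q (half_cos c)" "d p q \<le> 3 * sqrt (1 - c)"
proof (cases "has_cap_section p (half_cos c)")
  case False
  have "d p p = 0" using Metric_space.zero[OF d_metric p p] by simp
  then show ?thesis using that[OF p False] c by simp
next
  case True
  have h: "0 \<le> half_cos c" "half_cos c < 1" "1 - half_cos c \<le> (1 - c) / 2" by (rule half_cos[OF c])+
  obtain s0 where s0: "section_on (cap (y p) (half_cos c)) s0" "s0 (y p) = p"
    using True unfolding has_cap_section_def by blast
  obtain x where x: "x \<in> cap (y p) (half_cos c)" "\<not> has_cap_section (s0 x) (half_cos c)"
    using glue_half_caps[OF p c s0] bad by blast
  have "(dist x (y p))\<^sup>2 \<le> 1 - c"
    using x(1) dist_unit[of x "y p"] y_sphere[OF p] h(3) by (simp add: cap_def)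
  then have "dist (y p) x \<le> sqrt (1 - c)" using real_le_rsqrt by (simp add: dist_commute)
  then have "d p (s0 x) \<le> 3 * sqrt (1 - c)"
    using d_section[OF s0(1) y_sphere[OF p] h(1,2) x(1)] unfolding s0(2) by simp
  then show ?thesis using that section_onD(2)[OF s0(1) x(1)] x(2) by blast
qed

text \<open>Starting from an obstruction at \<open>c = -1\<close>, the points \<open>x n\<close> are obstructed at \<open>c n = cos (\<pi> / 2\<^sup>n)\<close>.  Their distances are
  dominated by a geometric series because \<open>1 - c n\<close> at least halves in each step.  At the limit \<open>q\<close> there is a local section; it is also
  a section through \<open>x n\<close>, over a cap of fixed size, as soon as \<open>x n\<close> is close to \<open>q\<close>.\<close>

lemma section_off_antipode:
  assumes complete: "Metric_space.mcomplete M d" and p: "p \<in> M"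
  shows "has_cap_section p (-1)"
proof (rule ccontr)
  assume bad: "\<not> has_cap_section p (-1)"
  interpret Metric_space M d by (rule d_metric)
  define c where "c n = (half_cos ^^ n) (-1)" for n
  have c_Suc: "c (Suc n) = half_cos (c n)" for n by (simp add: c_def)
  have c: "-1 \<le> c n \<and> c n < 1 \<and> 1 - c n \<le> 2 / 2 ^ n" for n
  proof (induction n)
    case 0
    show ?case by (simp add: c_def)
  next
    case (Suc n)
    have "0 \<le> half_cos (c n)" "half_cos (c n) < 1" "1 - half_cos (c n) \<le> (1 - c n) / 2"
      using half_cos[of "c n"] Suc by auto
    moreover have "(1 - c n) / 2 \<le> 2 / 2 ^ n / 2" using Suc by (intro divide_right_mono) auto
    ultimately show ?case unfolding c_Suc by simp
  qed
  have "\<exists>x. \<forall>n. (x n \<in> M \<and> \<not> has_cap_section (x n) (c n)) \<and> d (x n) (x (Suc n)) \<le> 3 * sqrt (1 - c n)"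
  proof (rule dependent_nat_choice)
    show "\<exists>x. x \<in> M \<and> \<not> has_cap_section x (c 0)" using bad p by (auto simp: c_def)
    fix x n assume "x \<in> M \<and> \<not> has_cap_section x (c n)"
    then have x: "x \<in> M" "\<not> has_cap_section x (c n)" by auto
    obtain q where "q \<in> M" "\<not> has_cap_section q (half_cos (c n))" "d x q \<le> 3 * sqrt (1 - c n)"
      by (rule obstruction_nearby[OF x(1) _ _ x(2)]) (use c in auto)
    then show "\<exists>q. (q \<in> M \<and> \<not> has_cap_section q (c (Suc n))) \<and> d x q \<le> 3 * sqrt (1 - c n)"
      unfolding c_Suc by blast
  qed
  then obtain x where x: "\<And>n. x n \<in> M" "\<And>n. \<not> has_cap_section (x n) (c n)" "\<And>n. d (x n) (x (Suc n)) \<le> 3 * sqrt (1 - c n)"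
    by blast
  have c_le: "1 - c n \<le> 2 * (1/2) ^ n" for n
  proof -
    have "2 * (1/2) ^ n = 2 / (2::real) ^ n" by (simp add: power_one_over)
    then show ?thesis using c[of n] by linarith
  qed
  let ?b = "\<lambda>n. 3 * sqrt 2 * (sqrt (1/2)) ^ n"
  have step_le: "d (x n) (x (Suc n)) \<le> ?b n" for n
  proof -
    have "sqrt (1 - c n) \<le> sqrt (2 * (1/2) ^ n)" by (rule real_sqrt_le_mono[OF c_le])
    also have "\<dots> = sqrt 2 * sqrt (1/2) ^ n" by (simp only: real_sqrt_mult real_sqrt_power)
    finally show ?thesis using x(3)[of n] by simp
  qed
  have summable: "summable ?b" by (intro summable_mult summable_geometric) simp
  have chain: "d (x m) (x n) \<le> sum ?b {m..<n}" if "m \<le> n" for m n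
    using that
  proof (induction n rule: dec_induct)
    case base
    show ?case using zero[OF x(1) x(1), of m m] by simp
  next
    case (step n)
    have "d (x m) (x (Suc n)) \<le> d (x m) (x n) + d (x n) (x (Suc n))" by (rule triangle[OF x(1) x(1) x(1)])
    also have "\<dots> \<le> sum ?b {m..<n} + ?b n" using step.IH step_le by (rule add_mono)
    finally show ?case using step.hyps(1) by simp
  qed
  have "MCauchy x"
    unfolding MCauchy_def
  proof (intro conjI allI impI)
    show "range x \<subseteq> M" using x(1) by blast
    fix e :: real assume "e > 0"
    then obtain N where N: "\<And>m n. m \<ge> N \<Longrightarrow> norm (sum ?b {m..<n}) < e"
      using summable unfolding summable_Cauchy by blast
    have le: "d (x m) (x n) < e" if "N \<le> m" "m \<le> n" for m n
      using chain[OF that(2)] N[OF that(1), of n] by simp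
    show "\<exists>N. \<forall>n n'. N \<le> n \<longrightarrow> N \<le> n' \<longrightarrow> d (x n) (x n') < e"
    proof (intro exI[of _ N] allI impI)
      fix m n assume "N \<le> m" "N \<le> n"
      then show "d (x m) (x n) < e" using le[of m n] le[of n m] commute[of "x m" "x n"] by (cases "m \<le> n") auto
    qed
  qed
  then obtain q where "limitin mtopology x q sequentially" using complete unfolding mcomplete_def by blast
  then have q: "q \<in> M" and lim: "\<And>e. e > 0 \<Longrightarrow> \<exists>N. \<forall>n\<ge>N. x n \<in> M \<and> d (x n) q < e"
    unfolding limit_metric_sequentially by auto
  obtain c' s N where N: "0 \<le> c'" "c' < 1" "section_on (cap (y q) c') s" "s (y q) = q"
    "open N" "q \<in> N" "\<And>z. z \<in> N \<Longrightarrow> y z \<in> cap (y q) c' \<and> s (y z) = z"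
    by (rule local_cap_section[OF q]) blast
  have "y q \<in> {z. z \<bullet> y q > c'}" using center_cap[OF q N(2)] by (simp add: cap_def)
  then obtain r where r: "r > 0" "ball (y q) r \<subseteq> {z. z \<bullet> y q > c'}"
    using open_halfspace[of c' "y q"] open_contains_ball_eq by blast
  have sub: "sphere 0 1 \<inter> ball (y q) r \<subseteq> cap (y q) c'" using r(2) by (auto simp: cap_def)
  let ?c = "1 - (r / 2)\<^sup>2 / 2"
  have near: "has_cap_section z ?c" if z: "z \<in> M" "d q z < r / 2" for z
  proof -
    have sub2: "sphere 0 1 \<inter> ball (y q) (r / 2) \<subseteq> cap (y q) c'"
      using sub r(1) by (auto simp: subset_iff)
    have z': "dist (y q) (y z) < r / 2" "s (y z) = z" by (rule small_ball[OF q N(3,4) sub2 z])+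
    have "cap (y z) ?c \<subseteq> cap (y q) c'"
    proof
      fix w assume w: "w \<in> cap (y z) ?c"
      have "dist (y z) w < r / 2" by (rule dist_less_if_cap[OF y_sphere[OF z(1)] w]) (use r(1) in simp)
      then have "dist (y q) w < r" using z'(1) dist_triangle[of "y q" w "y z"] by simp
      then show "w \<in> cap (y q) c'" using w sub by (auto simp: cap_def)
    qed
    then have "section_on (cap (y z) ?c) s" by (rule section_on_subset[OF N(3)])
    then show ?thesis using z'(2) unfolding has_cap_section_def by blast
  qed
  obtain N1 where N1: "\<And>n. n \<ge> N1 \<Longrightarrow> d (x n) q < r / 2" using lim[of "r / 2"] r(1) by auto
  have "(\<lambda>n. 2 * (1/2) ^ n :: real) \<longlonglongrightarrow> 2 * 0" by (intro tendsto_mult tendsto_const LIMSEQ_power_zero) simp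
  then have "eventually (\<lambda>n. 2 * (1/2) ^ n < (r / 2)\<^sup>2 / 2) sequentially"
    by (rule order_tendstoD) (use r(1) in simp)
  then obtain N2 where N2: "\<And>n. n \<ge> N2 \<Longrightarrow> 2 * (1/2) ^ n < (r / 2)\<^sup>2 / 2" unfolding eventually_sequentially by blast
  let ?n = "max N1 N2"
  have "1 - c ?n \<le> 2 * (1/2) ^ ?n" by (rule c_le)
  also have "\<dots> < (r / 2)\<^sup>2 / 2" by (rule N2) simp
  finally have "?c \<le> c ?n" by simp
  moreover have "has_cap_section (x ?n) ?c" using near[OF x(1)] N1[of ?n] commute[of q] by simp
  ultimately show False using has_cap_section_mono x(2) by blast
qed

text \<open>A section over the sphere without \<open>b = - y p\<close> agrees, off \<open>b\<close>, with a section over a hemisphere containing \<open>b\<close>, because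
  the hemisphere without \<open>b\<close> is connected.  So the two together form a section over the whole sphere.\<close>

lemma global_section:
  assumes complete: "Metric_space.mcomplete M d"
  obtains s where "section_on (sphere 0 1) s" "\<And>q. q \<in> M \<Longrightarrow> s (y q) = q"
proof -
  obtain p where p: "p \<in> M" using M_nonempty by blast
  let ?u = "y p" and ?b = "- y p"
  have u: "norm ?u = 1" by (rule y_sphere[OF p])
  obtain s where s: "section_on (cap ?u (-1)) s" "s ?u = p"
    using section_off_antipode[OF complete p] unfolding has_cap_section_def by blast
  have in_cap: "x \<in> cap ?u (-1)" if "norm x = 1" "x \<noteq> ?b" for x
  proof -
    have "(dist x ?b)\<^sup>2 > 0" using that by simp
    then show ?thesis using dist_unit[of x ?b] that u by (simp add: cap_def)
  qed
  obtain v where v: "norm v = 1" "v \<bullet> ?u = 0"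
  proof -
    obtain v0 where v0: "v0 \<noteq> 0" "orthogonal v0 ?u"
      using orthogonal_to_vector_exists[of ?u] by (auto simp: orthogonal_commute)
    show ?thesis by (rule that[of "sgn v0"]) (use v0 in \<open>auto simp: norm_sgn sgn_div_norm orthogonal_def\<close>)
  qed
  \<comment> \<open>the centre of the hemisphere: any unit vector other than \<open>b\<close> with positive inner product with \<open>b\<close> would do\<close>
  define w where "w = (3/5) *\<^sub>R v + (4/5) *\<^sub>R ?b"
  have wb: "w \<bullet> ?b = 4/5" using u v by (simp add: w_def inner_diff_left norm_eq_1)
  have "w \<bullet> w = 1"
    using u v by (simp add: w_def inner_diff_left inner_diff_right norm_eq_1 inner_commute[of ?u v])
  then have w: "norm w = 1" by (simp add: norm_eq_1)
  have "w \<noteq> ?b" using wb u by (auto simp: norm_eq_1)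
  have wcap: "w \<in> cap ?u (-1)" by (rule in_cap[OF w \<open>w \<noteq> ?b\<close>])
  have sw: "s w \<in> M" "y (s w) = w" using section_onD(2,3)[OF s(1) wcap] by auto
  obtain t where t: "section_on (cap w 0) t" "t w = s w"
    using has_cap_section_mono[OF section_off_antipode[OF complete sw(1)], of 0] unfolding has_cap_section_def sw(2) by auto
  have bcap: "?b \<in> cap w 0" using wb u by (simp add: cap_def inner_commute)
  have ww: "w \<in> cap w 0" using w by (simp add: cap_def norm_eq_1)
  have agree: "t x = s x" if x: "x \<in> cap w 0 - {?b}" for x
  proof (rule sections_agree[OF t(1) s(1) connected_cap_minus_point[OF w bcap] _ _ _ t(2) x])
    show "cap w 0 - {?b} \<subseteq> cap ?u (-1)"
    proof
      fix z assume z: "z \<in> cap w 0 - {?b}"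
      then have "norm z = 1" by (simp add: cap_def)
      then show "z \<in> cap ?u (-1)" using in_cap z by blast
    qed
    show "w \<in> cap w 0 - {?b}" using ww \<open>w \<noteq> ?b\<close> by simp
  qed simp
  define S where "S x = (if x = ?b then t x else s x)" for x
  have St: "t x = S x" if "x \<in> cap w 0" for x using agree[of x] that by (auto simp: S_def)
  have "continuous_on (sphere 0 1) S"
  proof (rule continuous_on_locally)
    fix x :: "real^3" assume x: "x \<in> sphere 0 1"
    show "\<exists>A. open A \<and> x \<in> A \<and> continuous_on (sphere 0 1 \<inter> A) S"
    proof (cases "x = ?b")
      case True
      have "continuous_on (cap w 0) S" by (rule continuous_on_eq[OF section_onD(1)[OF t(1)] St])
      then show ?thesis
        using open_halfspace[of 0 w] bcap True unfolding cap_eq by (intro exI[of _ "{x. x \<bullet> w > 0}"]) auto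
    next
      case False
      have "continuous_on (sphere 0 1 \<inter> - {?b}) S"
      proof (rule continuous_on_eq)
        show "continuous_on (sphere 0 1 \<inter> - {?b}) s"
        proof (rule continuous_on_subset[OF section_onD(1)[OF s(1)]], rule subsetI)
          fix z assume z: "z \<in> sphere 0 1 \<inter> - {?b}"
          then have "norm z = 1" "z \<noteq> ?b" by auto
          then show "z \<in> cap ?u (-1)" by (rule in_cap)
        qed
      qed (simp add: S_def)
      then show ?thesis using False by (intro exI[of _ "- {?b}"]) auto
    qed
  qed
  moreover have "S x \<in> M \<and> y (S x) = x" if "norm x = 1" for x
    using section_onD(2,3)[OF s(1) in_cap[OF that]] section_onD(2,3)[OF t(1) bcap] by (simp add: S_def)
  ultimately have S: "section_on (sphere 0 1) S" by (auto simp: section_on_def)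
  have "(S \<circ> y) q = (\<lambda>q. q) q" if q: "q \<in> M" for q
  proof (rule lifts_agree[OF connected_M _ continuous_on_id _ _ p _ q])
    show "continuous_on M (S \<circ> y)"
      by (rule continuous_on_compose[OF y_continuous continuous_on_subset[OF section_onD(1)[OF S]]])
        (use y_sphere in auto)
    show "(S \<circ> y) ` M \<subseteq> M" using section_onD(2)[OF S] y_sphere by auto
    show "y ((S \<circ> y) z) = y z" if "z \<in> M" for z using section_onD(3)[OF S, of "y z"] y_sphere[OF that] by simp
    have "?u \<noteq> ?b"
    proof
      assume "?u = ?b"
      then have "?u \<bullet> ?u = - (?u \<bullet> ?u)" by (metis inner_minus_left)
      then show False using u by (simp add: norm_eq_1)
    qed
    then show "(S \<circ> y) p = p" using s(2) by (simp add: S_def)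
  qed
  then show ?thesis using that[OF S] by simp
qed

lemma complete_isometric_to_S2:
  assumes complete: "Metric_space.mcomplete M d"
  shows "isometric_to_S2 \<A> f"
proof -
  obtain s where s: "section_on (sphere 0 1) s" "\<And>q. q \<in> M \<Longrightarrow> s (y q) = q"
    using global_section[OF complete] by blast
  have yS: "y ` M \<subseteq> sphere 0 1" using y_sphere by auto
  have homeo: "homeomorphism M (sphere 0 1) y s"
  proof (rule homeomorphismI)
    show "continuous_on M y" by (rule y_continuous)
    show "continuous_on (sphere 0 1) s" by (rule section_onD(1)[OF s(1)])
    show "s ` sphere 0 1 \<subseteq> M" using section_onD(2)[OF s(1)] by blast
    show "y (s x) = x" if "x \<in> sphere 0 1" for x by (rule section_onD(3)[OF s(1) that])
  qed (use yS s(2) in auto)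
  have "diffeo_into_S2 \<A> M (sphere 0 1) y"
    unfolding diffeo_into_S2_def
  proof (intro conjI exI[of _ s] ballI open_M order_refl homeo)
    show "openin (top_of_set (sphere 0 1)) (sphere 0 1 :: (real^3) set)" by simp
    fix c assume "c \<in> \<A>"
    then obtain V \<psi> where c: "c = (V, \<psi>)" "(V, \<psi>) \<in> \<A>" by (cases c) auto
    have "smooth_on (\<psi> ` V) (y \<circ> inv_into V \<psi>)" using y_smooth c(2) unfolding smooth_in_charts_def by blast
    then have "smooth_on (\<psi> ` (M \<inter> V)) (y \<circ> inv_into V \<psi>)" by (rule smooth_on_subset) blast
    moreover have "smooth_on (y ` (M \<inter> V)) (\<psi> \<circ> s)"
      by (rule smooth_on_subset[OF section_smooth[OF s(1) order_refl c(2)]]) (use yS s(2) in auto)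
    ultimately show "case c of (W, \<phi>) \<Rightarrow>
        smooth_on (\<phi> ` (M \<inter> W)) (y \<circ> inv_into W \<phi>) \<and> smooth_on (y ` (M \<inter> W)) (\<phi> \<circ> s)"
      unfolding c(1) by simp
  qed
  then show ?thesis unfolding isometric_to_S2_def using y_metric by blast
qed

text \<open>Composition with a local inverse of \<open>y\<close> expresses \<open>h\<close> as a smooth function near \<open>y p\<close>, whose germ extends to all of
  space; \<open>U\<close> is shrunk to where the extension is unchanged.\<close>

lemma local_graph:
  fixes h :: "'a \<Rightarrow> real"
  assumes p: "p \<in> M" and h: "smooth_in_charts \<A> h"
  obtains U V l where "p \<in> U" "diffeo_into_S2 \<A> U V y" "smooth_on (sphere 0 1) l"
    "\<And>q. q \<in> U \<Longrightarrow> h q = l (y q)"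
proof -
  obtain U0 \<phi> U W K where U: "(U0, \<phi>) \<in> \<A>" "open U" "p \<in> U" "U \<subseteq> U0" "open W" "y p \<in> W"
    "homeomorphism U (sphere 0 1 \<inter> W) y (inv_into U0 \<phi> \<circ> K)" "smooth_on W K" "K ` W \<subseteq> \<phi> ` U0"
    by (rule local_section[OF p])
  let ?x = "inv_into U0 \<phi> \<circ> K"
  have UM: "U \<subseteq> M" using U(4) chart_subset[OF U(1)] by blast
  have "smooth_on (\<phi> ` U0) (h \<circ> inv_into U0 \<phi>)" using h U(1) unfolding smooth_in_charts_def by blast
  from smooth_on_compose[OF U(8) this U(9)]
  have "C_k k ((h \<circ> inv_into U0 \<phi>) \<circ> K) W" for k unfolding smooth_on_open_iff[OF U(5)] by blast
  then obtain r H where H: "r > 0" "\<And>k. C_k k H UNIV" "\<And>x. x \<in> ball (y p) r \<Longrightarrow> H x = ((h \<circ> inv_into U0 \<phi>) \<circ> K) x"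
    by (rule smooth_germ_extends[OF U(5) _ U(6)]) blast
  let ?U = "U \<inter> y -` ball (y p) r" and ?V = "sphere 0 1 \<inter> (W \<inter> ball (y p) r)"
  have oU: "open ?U"
    by (rule continuous_open_preimage[OF homeomorphism_cont1[OF U(7)] U(2) open_ball])
  have yU: "y ` U = sphere 0 1 \<inter> W" by (rule homeomorphism_image1[OF U(7)])
  have "y ` ?U = y ` U \<inter> ball (y p) r" by blast
  then have yV: "y ` ?U = ?V" unfolding yU by blast
  have homeo: "homeomorphism ?U ?V y ?x"
    by (rule homeomorphism_of_subsets[OF U(7) Int_lower1 order_refl yV])
  have sec: "section_on (sphere 0 1 \<inter> W) ?x"
    unfolding section_on_def
    using homeomorphism_cont2[OF U(7)] homeomorphism_image2[OF U(7)] homeomorphism_apply2[OF U(7)] UM by simp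
  have "diffeo_into_S2 \<A> ?U ?V y"
    unfolding diffeo_into_S2_def
  proof (intro conjI exI[of _ ?x] ballI oU homeo)
    show "?U \<subseteq> M" using UM by blast
    show "openin (top_of_set (sphere 0 1)) ?V" using U(5) by (intro openin_open_Int open_Int open_ball)
    fix c assume "c \<in> \<A>"
    then obtain V \<psi> where c: "c = (V, \<psi>)" "(V, \<psi>) \<in> \<A>" by (cases c) auto
    have "smooth_on (\<psi> ` V) (y \<circ> inv_into V \<psi>)" using y_smooth c(2) unfolding smooth_in_charts_def by blast
    then have "smooth_on (\<psi> ` (?U \<inter> V)) (y \<circ> inv_into V \<psi>)" by (rule smooth_on_subset) blast
    moreover have "smooth_on (y ` (?U \<inter> V)) (\<psi> \<circ> ?x)"
    proof (rule smooth_on_subset[OF section_smooth[OF sec Int_lower1 c(2)]], rule image_subsetI)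
      fix q assume q: "q \<in> ?U \<inter> V"
      then have "?x (y q) = q" by (intro homeomorphism_apply1[OF U(7)]) blast
      moreover have "y q \<in> sphere 0 1 \<inter> W" using yU q by blast
      ultimately show "y q \<in> sphere 0 1 \<inter> W \<inter> ?x -` V" using q by simp
    qed
    ultimately show "case c of (W, \<phi>) \<Rightarrow>
        smooth_on (\<phi> ` (?U \<inter> W)) (y \<circ> inv_into W \<phi>) \<and> smooth_on (y ` (?U \<inter> W)) (\<phi> \<circ> ?x)"
      unfolding c(1) by simp
  qed
  moreover have "smooth_on (sphere 0 1) H"
    by (rule smooth_on_subset[OF _ subset_UNIV]) (simp add: smooth_on_open_iff H(2))
  moreover have "h q = H (y q)" if q: "q \<in> ?U" for q
  proof -
    have "?x (y q) = q" using q by (intro homeomorphism_apply1[OF U(7)]) blast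
    then show ?thesis using H(3)[of "y q"] q by simp
  qed
  moreover have "p \<in> ?U" using U(3) H(1) by simp
  ultimately show ?thesis using that[of ?U ?V H] by blast
qed

end

theorem theorem3p5:
  fixes \<A> :: "'a::{t2_space, second_countable_topology} chart set"
    and f :: "'a \<Rightarrow> real^5" and \<epsilon> :: real
  assumes "\<epsilon> \<in> {1, -1}"
    and "oriented_surface \<A>"
    and "spacelike_immersion \<A> f"
    and "plus_isotropic \<epsilon> \<A> f"
  shows "(complete_surface \<A> f \<longrightarrow> isometric_to_S2 \<A> f) \<and>
         (\<exists>\<Phi>. isometry_S41 \<Phi> \<and>
            (\<forall>p\<in>carrier_of \<A>. \<exists>U V y l.
               p \<in> U \<and> diffeo_into_S2 \<A> U V y \<and> smooth_on (sphere 0 1) l \<and>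
               (\<forall>q\<in>U. \<Phi> (f q) = i_map l (y q))))"
proof -
  interpret isotropic_surface \<A> f \<epsilon>
    by unfold_locales (fact assms)+
  obtain n where n: "lor n n = 0" "n $ 1 = 1" "\<And>p. p \<in> M \<Longrightarrow> lor n (f p) = 0"
    by (rule constant_null_normal) blast
  obtain \<Phi> where \<Phi>: "linear \<Phi>" "\<And>x y. lor (\<Phi> x) (\<Phi> y) = lor x y" "\<And>x. \<Phi> (\<Phi> x) = x"
    "\<And>x. lor n x = 0 \<Longrightarrow> \<Phi> x $ 1 = \<Phi> x $ 2"
    by (rule lorentz_reflection[OF n(1,2)]) blast
  define y :: "'a \<Rightarrow> real^3" where "y p = vector [\<Phi> (f p) $ 3, \<Phi> (f p) $ 4, \<Phi> (f p) $ 5]" for p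
  interpret spherical_development \<A> f y
    unfolding y_def[abs_def] by (rule development[OF n(3) \<Phi>(1,2,4)])
  have "complete_surface \<A> f \<longrightarrow> isometric_to_S2 \<A> f"
    using complete_isometric_to_S2 unfolding complete_surface_def by blast
  moreover have "isometry_S41 \<Phi>" by (rule isometry_S41_if_linear[OF \<Phi>(1-3)])
  moreover have "\<exists>U V y l. p \<in> U \<and> diffeo_into_S2 \<A> U V y \<and> smooth_on (sphere 0 1) l \<and>
      (\<forall>q\<in>U. \<Phi> (f q) = i_map l (y q))" if p: "p \<in> M" for p
  proof -
    have bl: "bounded_linear (\<lambda>x. \<Phi> x $ 1)"
      using \<Phi>(1) bounded_linear_compose[OF bounded_linear_vec_nth, of \<Phi>] by (simp add: linear_conv_bounded_linear)
    have "smooth_in_charts \<A> (\<lambda>q. \<Phi> (f q) $ 1)"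
      unfolding smooth_in_charts_def
    proof clarify
      fix V \<psi> assume c: "(V, \<psi>) \<in> \<A>"
      show "smooth_on (\<psi> ` V) ((\<lambda>q. \<Phi> (f q) $ 1) \<circ> inv_into V \<psi>)"
        unfolding smooth_on_open_iff[OF chart_open(2)[OF c]]
        using C_k_linear_comp[OF chart_open(2)[OF c] bl smooth_in_chartsD[OF f_smooth c]] by (simp add: o_def)
    qed
    then obtain U V l where U: "p \<in> U" "diffeo_into_S2 \<A> U V y" "smooth_on (sphere 0 1) l"
      "\<And>q. q \<in> U \<Longrightarrow> \<Phi> (f q) $ 1 = l (y q)"
      by (rule local_graph[OF p]) blast
    have "\<Phi> (f q) = i_map l (y q)" if q: "q \<in> U" for q
    proof -
      have "q \<in> M" using U(2) q unfolding diffeo_into_S2_def by blast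
      then have "\<Phi> (f q) $ 1 = \<Phi> (f q) $ 2" by (rule \<Phi>(4)[OF n(3)])
      then show ?thesis
        using U(4)[OF q] unfolding i_map_def vec_eq_iff forall_5 by (simp add: y_def)
    qed
    with U(1-3) show ?thesis by blast
  qed
  ultimately show ?thesis by blast
qed

end
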